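(* Let $\sigma\in(0,1)$ and $a>\sigma$. Let $\mathcal{C}\subseteq\mathbb{R}^2$ be a $C^{1,a}$ curve (of finite length, not necessarily connected), let $z\in\mathbb{R}^2$, and let $\mathbf{u}$ be a unit vector, where, if $z\in\mathcal{C}$, $\mathbf{u}$ is one of the two unit normals to $\mathcal{C}$ at $z$. Then for every $\varepsilon>0$ there are a countable number of partial linear interpolating splines $\{\mathcal{S}_i \mid i\in\mathbb{N}\}$ of $\mathcal{C}$, based on disjoint subcurves $\mathcal{C}_i\subseteq\mathcal{C}$, $i\in\mathbb{N}$, such that $$\big|\kappa_\sigma(z,\mathcal{C},\mathbf{u})-\kappa_\sigma\big(z,\textstyle\bigcup_{i\in\mathbb{N}}\mathcal{S}_i,\mathbf{u}\big)\big|<\varepsilon .$$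
   Context: Curves. A curve $\mathcal{C}$ is a one-dimensional $C^1$ manifold with boundary in $\mathbb{R}^2$ (a simple, $C^1$ planar curve, not necessarily connected) of finite length. Some or all endpoints may be removed, and the definitions below also make sense when $\mathcal{C}$ is only piecewise $C^1$ (if $z\in\mathcal{C}$, then $z$ must be a point where $\mathcal{C}$ is $C^1$). A $C^{1,a}$ curve is one which is of class $C^1$ with first derivatives Hölder continuous of exponent $a$. For $x,y\in\mathbb{R}^2$, $[x,y]$ denotes the closed line segment with endpoints $x$ and $y$. Transversality. An open line segment $\mathcal{L}$ and $\mathcal{C}$ are transversal if at every $p\in\mathcal{L}\cap\mathcal{C}$ the tangent to $\mathcal{C}$ at $p$ is not parallel to $\mathcal{L}$. $\mathcal{X}(\mathcal{C})$ is the set of all pairs $(x,y)\in\mathbb{R}^2\times\mathbb{R}^2$ such that the open line segment $\mathcal{L}$ connecting $x$ and $y$ is transversal to $\mathcal{C}$ and $\mathcal{C}\cap\mathcal{L}$ has an odd number of elements; $\mathcal{X}(\mathcal{C})^c$ is its complement. Nonlocal curvature. For $z\in\mathcal{C}$ and a unit normal $\mathbf{u}$ to $\mathcal{C}$ at $z$, set $$\mathcal{A}_e(z)=\{y \mid ((z,y)\in\mathcal{X}(\mathcal{C})\text{ and }(z-y)\cdot\mathbf{u}>0)\text{ or }((z,y)\in\mathcal{X}(\mathcal{C})^c\text{ and }(z-y)\cdot\mathbf{u}<0)\},$$ $$\mathcal{A}_i(z)=\{y \mid ((z,y)\in\mathcal{X}(\mathcal{C})^c\text{ and }(z-y)\cdot\mathbf{u}>0)\text{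 or }((z,y)\in\mathcal{X}(\mathcal{C})\text{ and }(z-y)\cdot\mathbf{u}<0)\},$$ let $\widehat\chi_{\mathcal{C}}(z,y)$ equal $1$ if $y\in\mathcal{A}_i(z)$, $-1$ if $y\in\mathcal{A}_e(z)$, and $0$ otherwise, and define (principal value) $$\kappa_\sigma(z,\mathcal{C},\mathbf{u})=\lim_{\varepsilon\to0}\frac12\int_{\mathbb{R}^2\setminus B_\varepsilon(z)}\frac{\widehat\chi_{\mathcal{C}}(z,y)}{|z-y|^{2+\sigma}}\,dy,$$ where $B_\varepsilon(z)$ is the ball of radius $\varepsilon$ centered at $z$. For $z\notin\mathcal{C}$ and an arbitrary unit vector $\mathbf{u}$, define $$\kappa_\sigma(z,\mathcal{C},\mathbf{u})=\lim_{\delta\downarrow0}\kappa_\sigma(z,\mathcal{C}\cup[z-\delta\mathbf{u}^\perp,z+\delta\mathbf{u}^\perp],\mathbf{u}),$$ where $\mathbf{u}^\perp$ is $\mathbf{u}$ rotated clockwise by $90^\circ$ (the right side is constant for small $\delta$). In particular $\kappa_\sigma(z,\emptyset,\mathbf{u})=0$. Splines. A linear interpolating spline of a connected curve with parameterization $\gamma:[\alpha,\beta]\to\mathbb{R}^2$ and uniform partition $\{\alpha+\tfrac{\beta-\alpha}{n}k \mid k=0,1,\dots,n\}$ is the set $$\bigcup_{k=1}^{n}\Big[\gamma\big(\alpha+\tfrac{\beta-\alpha}{n}(k-1)\big),\gamma\big(\alpha+\tfrac{\beta-\alpha}{n}k\big)\Big].$$ For a possibly disconnected curve $\mathcal{C}$,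 a partial linear interpolating spline of $\mathcal{C}$ is a linear interpolating spline of some connected subcurve of $\mathcal{C}$ (the subcurve on which it is based). *)

theory Defs
  imports "HOL-Analysis.Analysis"
begin

definition C1_regular_on :: "(real \<Rightarrow> real^2) \<Rightarrow> (real \<Rightarrow> real^2) \<Rightarrow> real set \<Rightarrow> bool"
  where "C1_regular_on g g' T \<longleftrightarrow>
    (\<forall>t\<in>T. (g has_vector_derivative g' t) (at t within T) \<and> g' t \<noteq> 0) \<and> continuous_on T g'"

definition holder_on :: "real \<Rightarrow> (real \<Rightarrow> real^2) \<Rightarrow> real set \<Rightarrow> bool"
  where "holder_on a f T \<longleftrightarrow> (\<exists>M. \<forall>s\<in>T. \<forall>t\<in>T. norm (f s - f t) \<le> M * \<bar>s - t\<bar> powr a)"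

text \<open>Charts of a one-dimensional submanifold with boundary. The interval \<open>T\<close> may be open,
  half-open or closed, so \<open>p\<close> may be a boundary point of the curve. The topology is that of
  the plane (the curve is embedded, not merely immersed).\<close>

definition C1_chart_at ::
    "(real^2) set \<Rightarrow> real^2 \<Rightarrow> real set \<Rightarrow> (real \<Rightarrow> real^2) \<Rightarrow> (real \<Rightarrow> real^2) \<Rightarrow> bool"
  where "C1_chart_at C p T g g' \<longleftrightarrow>
    p \<in> C \<and> is_interval T \<and> interior T \<noteq> {} \<and> C1_regular_on g g' T \<and>
    (\<exists>U h. open U \<and> p \<in> U \<and> homeomorphism T (C \<inter> U) g h)"

definition tangent_vector :: "(real^2) set \<Rightarrow> real^2 \<Rightarrow> real^2 \<Rightarrow> bool"
  where "tangent_vector C p v \<longleftrightarrow> (\<exists>T g g' t. C1_chart_at C p T g g' \<and> t \<in> T \<and> g t = p \<and> g' t = v)"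

definition unit_normal :: "(real^2) set \<Rightarrow> real^2 \<Rightarrow> real^2 \<Rightarrow> bool"
  where "unit_normal C p u \<longleftrightarrow> norm u = 1 \<and> (\<exists>v. tangent_vector C p v \<and> u \<bullet> v = 0)"

text \<open>Connected subcurves given by a regular parameterization over a compact interval;
  \<open>g \<alpha> = g \<beta>\<close> is allowed (closed curves).\<close>

definition subcurve_param :: "(real^2) set \<Rightarrow> (real \<Rightarrow> real^2) \<Rightarrow> real \<Rightarrow> real \<Rightarrow> bool"
  where "subcurve_param C g \<alpha> \<beta> \<longleftrightarrow>
    \<alpha> < \<beta> \<and> (\<exists>g'. C1_regular_on g g' {\<alpha>..\<beta>}) \<and>
    inj_on g {\<alpha>..<\<beta>} \<and> inj_on g {\<alpha><..\<beta>} \<and> g ` {\<alpha>..\<beta>} \<subseteq> C"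

definition param_length :: "(real \<Rightarrow> real^2) \<Rightarrow> real \<Rightarrow> real \<Rightarrow> real"
  where "param_length g \<alpha> \<beta> =
    integral {\<alpha>..\<beta>} (\<lambda>t. norm (vector_derivative g (at t within {\<alpha>..\<beta>})))"

text \<open>Total length of a possibly disconnected curve (which may have infinitely many components
  and need not contain its endpoints): the supremum of the total lengths of finite families
  of pairwise disjoint compact subcurves.\<close>

definition curve_length :: "(real^2) set \<Rightarrow> ennreal"
  where "curve_length C =
    (SUP P \<in> {P. finite P \<and> (\<forall>(g, \<alpha>, \<beta>) \<in> P. subcurve_param C g \<alpha> \<beta>) \<and>
                 pairwise (\<lambda>(g, \<alpha>, \<beta>) (h, \<alpha>', \<beta>'). disjnt (g ` {\<alpha>..\<beta>}) (h ` {\<alpha>'..\<beta>'})) P}.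
       \<Sum>(g, \<alpha>, \<beta>) \<in> P. ennreal (param_length g \<alpha> \<beta>))"

text \<open>The Hoelder bound is required chart by chart; no uniformity over the whole curve or up to
  removed endpoints is assumed.\<close>

definition C1_holder_curve :: "real \<Rightarrow> (real^2) set \<Rightarrow> bool"
  where "C1_holder_curve a C \<longleftrightarrow>
    (\<forall>p\<in>C. \<exists>T g g'. C1_chart_at C p T g g' \<and> holder_on a g' T) \<and> curve_length C < \<infinity>"

text \<open>A segment through a point where \<open>C\<close> has no tangent (such as a corner of a polygonal
  line) is not transversal. From a given \<open>x\<close>, the endpoints \<open>y\<close> of segments meeting one of
  countably many corners other than \<open>x\<close> form a null set.\<close>

definition transversal :: "real^2 \<Rightarrow> real^2 \<Rightarrow> (real^2) set \<Rightarrow> bool"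
  where "transversal x y C \<longleftrightarrow>
    (\<forall>p \<in> open_segment x y \<inter> C. \<exists>v. tangent_vector C p v \<and> \<not> (\<exists>c. v = c *\<^sub>R (y - x)))"

text \<open>An infinite intersection has cardinality \<open>0\<close> here, hence is not counted as odd.\<close>

definition odd_crossings :: "(real^2) set \<Rightarrow> ((real^2) \<times> (real^2)) set"
  where "odd_crossings C =
    {(x, y). transversal x y C \<and> odd (card (C \<inter> open_segment x y))}"

definition exterior_set :: "real^2 \<Rightarrow> (real^2) set \<Rightarrow> real^2 \<Rightarrow> (real^2) set"
  where "exterior_set z C u =
    {y. (z, y) \<in> odd_crossings C \<and> (z - y) \<bullet> u > 0 \<or>
        (z, y) \<notin> odd_crossings C \<and> (z - y) \<bullet> u < 0}"

definition interior_set :: "real^2 \<Rightarrow> (real^2) set \<Rightarrow> real^2 \<Rightarrow> (real^2) set"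
  where "interior_set z C u =
    {y. (z, y) \<notin> odd_crossings C \<and> (z - y) \<bullet> u > 0 \<or>
        (z, y) \<in> odd_crossings C \<and> (z - y) \<bullet> u < 0}"

definition chi_hat :: "real^2 \<Rightarrow> (real^2) set \<Rightarrow> real^2 \<Rightarrow> real^2 \<Rightarrow> real"
  where "chi_hat z C u y =
    (if y \<in> interior_set z C u then 1 else if y \<in> exterior_set z C u then - 1 else 0)"

definition truncated_curvature :: "real \<Rightarrow> real^2 \<Rightarrow> (real^2) set \<Rightarrow> real^2 \<Rightarrow> real \<Rightarrow> real"
  where "truncated_curvature \<sigma> z C u \<epsilon> =
    1 / 2 * (LINT y:(- ball z \<epsilon>)|lebesgue. chi_hat z C u y / norm (z - y) powr (2 + \<sigma>))"

definition rotate_clockwise :: "real^2 \<Rightarrow> real^2"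
  where "rotate_clockwise u = vector [u $ 2, - (u $ 1)]"

definition add_segment :: "(real^2) set \<Rightarrow> real^2 \<Rightarrow> real^2 \<Rightarrow> real \<Rightarrow> (real^2) set"
  where "add_segment C z u \<delta> =
    C \<union> closed_segment (z - \<delta> *\<^sub>R rotate_clockwise u) (z + \<delta> *\<^sub>R rotate_clockwise u)"

text \<open>The relation states that the defining limits exist. For \<open>z \<in> C\<close> it includes that
  \<open>C\<close> is \<open>C\<^sup>1\<close> at \<open>z\<close> and that \<open>u\<close> is normal to it there.\<close>

definition has_nonlocal_curvature ::
    "real \<Rightarrow> real^2 \<Rightarrow> (real^2) set \<Rightarrow> real^2 \<Rightarrow> real \<Rightarrow> bool"
  where "has_nonlocal_curvature \<sigma> z C u k \<longleftrightarrow>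
    (if z \<in> C
     then unit_normal C z u \<and> (truncated_curvature \<sigma> z C u \<longlongrightarrow> k) (at_right 0)
     else norm u = 1 \<and>
       (\<exists>K. (\<forall>\<^sub>F \<delta> in at_right 0.
                (truncated_curvature \<sigma> z (add_segment C z u \<delta>) u \<longlongrightarrow> K \<delta>) (at_right 0)) \<and>
            (K \<longlongrightarrow> k) (at_right 0)))"

definition nonlocal_curvature_exists :: "real \<Rightarrow> real^2 \<Rightarrow> (real^2) set \<Rightarrow> real^2 \<Rightarrow> bool"
  where "nonlocal_curvature_exists \<sigma> z C u \<longleftrightarrow> (\<exists>k. has_nonlocal_curvature \<sigma> z C u k)"

definition nonlocal_curvature :: "real \<Rightarrow> real^2 \<Rightarrow> (real^2) set \<Rightarrow> real^2 \<Rightarrow> real"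
  where "nonlocal_curvature \<sigma> z C u = (THE k. has_nonlocal_curvature \<sigma> z C u k)"

definition linear_spline :: "(real \<Rightarrow> real^2) \<Rightarrow> real \<Rightarrow> real \<Rightarrow> nat \<Rightarrow> (real^2) set"
  where "linear_spline g \<alpha> \<beta> n =
    (\<Union>k\<in>{1..n}. closed_segment (g (\<alpha> + (\<beta> - \<alpha>) / real n * (real k - 1)))
                              (g (\<alpha> + (\<beta> - \<alpha>) / real n * real k)))"

text \<open>\<open>S\<close> is a partial linear interpolating spline of \<open>C\<close> based on the subcurve \<open>D\<close>.\<close>

definition partial_linear_spline :: "(real^2) set \<Rightarrow> (real^2) set \<Rightarrow> (real^2) set \<Rightarrow> bool"
  where "partial_linear_spline C D S \<longleftrightarrow>
    (\<exists>g \<alpha> \<beta> n. subcurve_param C g \<alpha> \<beta> \<and> D = g ` {\<alpha>..\<beta>} \<and> n \<ge> 1 \<and> S = linear_spline g \<alpha> \<beta> n)"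

end

(*
  The spline need not resemble the curve. In polar coordinates about z, the curvature is the
  difference of the kernel integrals over the points of odd parity on the two sides of the line
  through z orthogonal to u; the parity sets have positive distance from z, or lie near z in a wedge
  |(y - z) . u| <= M |y - z|^(1 + a), which the kernel integrates since a > sigma.
  If, say, the difference k is positive, exhaust the odd set of the positive side by a compact set K
  and cut the directions into thin columns: a chord of the curve below the lowest point of K in each
  column casts a shadow that contains K, so finitely many chords have total shadow at least about k.
  Their shadows are disjoint and small, so some of the chords have total shadow within epsilon of k.
  If z is an accumulation point where the curvature does not exist, one of the odd sets has infinite
  kernel measure; chords over infinitely many disjoint sets of directions then give a spline
  whose curvature does not exist either, and both sides have the same default value.
*)
theory Submission imports Defs begin

section \<open>The kernel measure\<close>

text \<open>Parity along a ray depends only on what that ray meets, and \<open>slope\<close> labels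
  the rays of a half plane. Chords with pairwise disjoint closed slope ranges never share a ray, so
  up to countably many rays the parity set of their union is the disjoint union of the single
  shadows, and its mass is a plain sum. All chords lie strictly on one side of the line through
  \<open>z\<close>, so the opposite parity set is empty and nothing cancels: the curvature of the
  polygon is its total shadow. A negative value is reached by exchanging \<open>u\<close> for
  \<open>- u\<close>, the value zero by the empty polygon.

  The obstacle is the lack of uniform control: there may be infinitely many components, Hoelder
  constants are local, and measurability of the parity sets is not given. So no convergence of
  splines to the curve is used, only single transversal crossings: near one, slope is strictly
  monotone along an arc, which yields a chord with any prescribed end slopes nearby. Nonmeasurable
  parity sets are caught by the default value 0 of the integral: a nonzero or missing limit of the
  truncations already forces measurability.\<close>

definition kernel :: "real \<Rightarrow> real^2 \<Rightarrow> real^2 \<Rightarrow> real"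
  where "kernel \<sigma> z y = 1 / norm (z - y) powr (2 + \<sigma>)"

text \<open>As a measure, the kernel turns truncation into removal of a ball from a set, and the
  failure of convergence into infinite mass.\<close>

definition kernel_measure :: "real \<Rightarrow> real^2 \<Rightarrow> (real^2) measure"
  where "kernel_measure \<sigma> z = density lebesgue (\<lambda>y. ennreal (kernel \<sigma> z y))"

lemma kernel_nonneg [simp]: "0 \<le> kernel \<sigma> z y"
  by (simp add: kernel_def)

lemma kernel_measurable_borel [measurable]: "kernel \<sigma> z \<in> borel_measurable borel"
  unfolding kernel_def[abs_def] by measurable

lemma kernel_measurable [measurable]: "kernel \<sigma> z \<in> borel_measurable lebesgue"
  using measurable_completion[of "kernel \<sigma> z" lborel borel] by simp

lemma sets_kernel_measure [simp, measurable_cong]: "sets (kernel_measure \<sigma> z) = sets lebesgue"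
  by (simp add: kernel_measure_def)

lemma space_kernel_measure [simp]: "space (kernel_measure \<sigma> z) = UNIV"
  by (simp add: kernel_measure_def)

lemma kernel_null_set:
  assumes "negligible X"
  shows "X \<in> null_sets (kernel_measure \<sigma> z)"
proof -
  have "X \<in> null_sets lebesgue" using assms by (simp add: negligible_iff_null_sets)
  then show ?thesis
    unfolding kernel_measure_def
    by (subst null_sets_density_iff) (auto simp: null_setsD2 dest: AE_not_in elim: eventually_mono)
qed

lemma kernel_measure_le:
  assumes "0 < r" "X \<in> sets lebesgue" "X \<inter> ball z r = {}" "0 < \<sigma>"
  shows "emeasure (kernel_measure \<sigma> z) X \<le> ennreal (1 / r powr (2 + \<sigma>)) * emeasure lebesgue X"
proof -
  have "emeasure (kernel_measure \<sigma> z) X = (\<integral>\<^sup>+y. ennreal (kernel \<sigma> z y) * indicator X y \<partial>lebesgue)"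
    unfolding kernel_measure_def using assms by (subst emeasure_density) auto
  also have "\<dots> \<le> (\<integral>\<^sup>+y. ennreal (1 / r powr (2 + \<sigma>)) * indicator X y \<partial>lebesgue)"
  proof (rule nn_integral_mono)
    fix y
    have "kernel \<sigma> z y \<le> 1 / r powr (2 + \<sigma>)" if "y \<in> X"
    proof -
      have "r \<le> norm (z - y)" using that assms by (auto simp: dist_norm disjoint_iff not_less[symmetric])
      then show ?thesis unfolding kernel_def using assms
        by (intro divide_left_mono powr_mono2 mult_pos_pos) auto
    qed
    then show "ennreal (kernel \<sigma> z y) * indicator X y \<le> ennreal (1 / r powr (2 + \<sigma>)) * indicator X y"
      by (auto split: split_indicator intro!: ennreal_leI)
  qed
  also have "\<dots> = ennreal (1 / r powr (2 + \<sigma>)) * emeasure lebesgue X"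
    using assms by (subst nn_integral_cmult_indicator) auto
  finally show ?thesis .
qed

text \<open>Feeds both dyadic arguments below, with shells growing away from \<open>z\<close> and
  shells shrinking towards it. \<open>Y\<close> may be any set: \<open>emeasure\<close> is monotone
  as soon as the larger set is measurable.\<close>

lemma kernel_measure_finite_of_cover:
  assumes "0 < \<sigma>" and X: "\<And>n. X n \<in> sets lebesgue" "\<And>n. X n \<inter> ball z (\<rho> n) = {}" "\<And>n. 0 < \<rho> n"
    and m: "\<And>n. emeasure lebesgue (X n) \<le> ennreal (m n)" "\<And>n. 0 \<le> m n"
    and sum: "summable (\<lambda>n::nat. m n / \<rho> n powr (2 + \<sigma>))"
    and Y: "Y \<subseteq> (\<Union>n. X n)"
  shows "emeasure (kernel_measure \<sigma> z) Y < \<infinity>"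
proof -
  let ?M = "kernel_measure \<sigma> z"
  have "emeasure ?M Y \<le> emeasure ?M (\<Union>n. X n)"
    using X Y by (intro emeasure_mono) auto
  also have "\<dots> \<le> (\<Sum>n. emeasure ?M (X n))"
    using X by (intro emeasure_subadditive_countably) auto
  also have "\<dots> \<le> (\<Sum>n. ennreal (m n / \<rho> n powr (2 + \<sigma>)))"
  proof (intro suminf_le summableI)
    fix n
    have "emeasure ?M (X n) \<le> ennreal (1 / \<rho> n powr (2 + \<sigma>)) * emeasure lebesgue (X n)"
      using assms by (intro kernel_measure_le) auto
    also have "\<dots> \<le> ennreal (1 / \<rho> n powr (2 + \<sigma>)) * ennreal (m n)"
      using m by (intro mult_left_mono) auto
    also have "\<dots> = ennreal (m n / \<rho> n powr (2 + \<sigma>))"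
      using m by (subst ennreal_mult[symmetric]) auto
    finally show "emeasure ?M (X n) \<le> ennreal (m n / \<rho> n powr (2 + \<sigma>))" .
  qed
  also have "\<dots> = ennreal (\<Sum>n. m n / \<rho> n powr (2 + \<sigma>))"
    using sum m by (intro suminf_ennreal2) auto
  also have "\<dots> < \<infinity>" by simp
  finally show ?thesis .
qed

lemma ball_in_lebesgue [simp]: "ball z r \<in> sets lebesgue" for z :: "real^2"
  by (simp add: borel_open)

lemma two_power_powr: "(2 ^ n) powr x = (2 powr x) ^ n" for x :: real
proof -
  have "(2 ^ n) powr x = (2 powr real n) powr x" by (simp add: powr_realpow)
  also have "\<dots> = 2 powr (x * real n)" by (simp add: powr_powr mult.commute)
  also have "\<dots> = (2 powr x) ^ n" by (simp add: powr_powr[symmetric] powr_realpow)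
  finally show ?thesis .
qed

text \<open>The shell at radius \<open>2 ^ n * r\<close> has area of the order of the radius
  squared, and the kernel decays with exponent \<open>2 + \<sigma>\<close>, so the masses are
  bounded by a geometric series of ratio \<open>1 / 2 powr \<sigma>\<close>.\<close>

lemma kernel_measure_off_ball:
  assumes "0 < \<sigma>" "0 < r"
  shows "emeasure (kernel_measure \<sigma> z) (- ball z r) < \<infinity>"
proof (rule kernel_measure_finite_of_cover[where \<rho>="\<lambda>n. 2^n * r"
      and X="\<lambda>n. ball z (2^Suc n * r) - ball z (2^n * r)" and m="\<lambda>n. 4 * unit_ball_vol 2 * (2^n * r)^2"])
  show "emeasure lebesgue (ball z (2 ^ Suc n * r) - ball z (2 ^ n * r)) \<le> ennreal (4 * unit_ball_vol 2 * (2 ^ n * r)\<^sup>2)" for n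
  proof -
    have "emeasure lebesgue (ball z (2 ^ Suc n * r) - ball z (2 ^ n * r)) \<le> emeasure lebesgue (ball z (2 ^ Suc n * r))"
      by (intro emeasure_mono) auto
    also have "\<dots> = ennreal (4 * unit_ball_vol 2 * (2 ^ n * r)\<^sup>2)"
      using assms by (simp add: emeasure_ball power2_eq_square algebra_simps)
    finally show ?thesis .
  qed
  have q: "(4 * unit_ball_vol 2 * (2 ^ n * r)\<^sup>2) / (2^n * r) powr (2 + \<sigma>) = (4 * unit_ball_vol 2 / r powr \<sigma>) * (1 / 2 powr \<sigma>)^n" for n
  proof -
    have "(2^n * r) powr (2 + \<sigma>) = (2^n * r)\<^sup>2 * ((2 powr \<sigma>)^n * r powr \<sigma>)"
    proof -
      have "(2^n * r) powr \<sigma> = (2^n) powr \<sigma> * r powr \<sigma>"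
        using assms by (simp add: powr_mult)
      also have "(2^n) powr \<sigma> = (2 powr \<sigma>)^n"
        by (rule two_power_powr)
      finally show ?thesis using assms by (simp add: powr_add)
    qed
    then show ?thesis using assms by (simp add: power_one_over power_divide)
  qed
  show "summable (\<lambda>n. (4 * unit_ball_vol 2 * (2 ^ n * r)\<^sup>2) / (2^n * r) powr (2 + \<sigma>))"
    unfolding q using assms by (intro summable_mult summable_geometric) (auto simp: divide_less_eq)
  show "- ball z r \<subseteq> (\<Union>n. ball z (2 ^ Suc n * r) - ball z (2 ^ n * r))"
  proof
    fix y assume "y \<in> - ball z r"
    then have y: "r \<le> dist z y" by auto
    obtain N where N: "dist z y / r < 2 ^ N"
      using real_arch_pow[of 2 "dist z y / r"] by auto
    \<comment> \<open>The least ball containing \<open>y\<close>; its shell is the one with the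
      preceding index.\<close>
    define n where "n = (LEAST n. dist z y < 2^n * r)"
    have ex: "dist z y < 2^N * r" using N assms by (simp add: field_simps)
    have n: "dist z y < 2^n * r" unfolding n_def by (rule LeastI[of "\<lambda>n. dist z y < 2^n * r", OF ex])
    with y have "n \<noteq> 0" by (intro notI) auto
    then obtain k where k: "n = Suc k" by (cases n) auto
    have "\<not> dist z y < 2^k * r" using not_less_Least[of k "\<lambda>n. dist z y < 2^n * r"] k n_def by auto
    with n k show "y \<in> (\<Union>n. ball z (2 ^ Suc n * r) - ball z (2 ^ n * r))" by auto
  qed
qed (use assms in auto)

text \<open>Rotating \<open>u\<close> to the first axis puts the slab into a box with sides
  \<open>2 * h\<close> and \<open>2 * r\<close>.\<close>

lemma emeasure_slab_le:
  fixes u z :: "real^2"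
  assumes "norm u = 1" "0 \<le> r" "0 \<le> h"
  shows "emeasure lebesgue {y. norm (y - z) \<le> r \<and> \<bar>(y - z) \<bullet> u\<bar> \<le> h} \<le> ennreal (4 * r * h)"
proof -
  let ?S = "{v. norm v \<le> r \<and> \<bar>v \<bullet> u\<bar> \<le> h}"
  have cl: "compact ?S"
  proof -
    have "?S = cball 0 r \<inter> {v. \<bar>v \<bullet> u\<bar> \<le> h}" by auto
    moreover have "closed {v::real^2. \<bar>v \<bullet> u\<bar> \<le> h}" by (intro closed_Collect_le continuous_intros)
    ultimately show ?thesis by (simp add: compact_Int_closed)
  qed
  then have S: "?S \<in> lmeasurable" by (rule lmeasurable_compact)
  obtain f :: "real^2 \<Rightarrow> real^2" where f: "orthogonal_transformation f" "f u = axis 1 1"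
    using orthogonal_transformation_exists_1[of u "axis 1 1"] assms by auto
  have "f ` ?S \<subseteq> cbox (vector [-h, -r]) (vector [h, r])"
  proof clarify
    fix v assume v: "norm v \<le> r" "\<bar>v \<bullet> u\<bar> \<le> h"
    have "f v \<bullet> axis 1 1 = v \<bullet> u" using f by (metis orthogonal_transformation_def)
    then have "f v $ 1 = v \<bullet> u" by (simp add: inner_axis)
    moreover have "\<bar>f v $ 2\<bar> \<le> r"
      using component_le_norm_cart[of "f v" 2] f v orthogonal_transformation_norm by (metis order_trans)
    ultimately show "f v \<in> cbox (vector [-h, -r]) (vector [h, r])"
      using v by (auto simp: mem_box_cart forall_2)
  qed
  then have "measure lebesgue (f ` ?S) \<le> measure lebesgue (cbox (vector [-h, -r]) (vector [h, r] :: real^2))"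
    using measurable_orthogonal_image[OF f(1) S] by (intro measure_mono_fmeasurable) (auto simp: fmeasurableD)
  also have "\<dots> = 4 * r * h"
    using assms by (subst measure_completion) (auto simp: content_cbox_cart interval_ne_empty_cart forall_2 UNIV_2)
  finally have le: "measure lebesgue ?S \<le> 4 * r * h"
    using measure_orthogonal_image[OF f(1) S] by simp
  have "{y. norm (y - z) \<le> r \<and> \<bar>(y - z) \<bullet> u\<bar> \<le> h} = (\<lambda>x. x + z) ` ?S"
    by (auto simp: image_iff intro!: exI[of _ "_ - z"])
  then have "emeasure lebesgue {y. norm (y - z) \<le> r \<and> \<bar>(y - z) \<bullet> u\<bar> \<le> h} = emeasure lebesgue ?S"
    using emeasure_lebesgue_affine[of 1 z ?S] by simp
  also have "\<dots> = ennreal (measure lebesgue ?S)"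
    using S by (simp add: emeasure_eq_measure2)
  finally show ?thesis using le by (auto intro: ennreal_leI)
qed

text \<open>At radius r a dyadic shell meets the wedge in area of order
  \<open>r powr (2 + a)\<close>, while the kernel is of order
  \<open>1 / r powr (2 + \<sigma>)\<close>. The resulting ratio
  \<open>1 / 2 powr (a - \<sigma>)\<close> is below 1 because \<open>\<sigma> < a\<close>.\<close>

lemma kernel_measure_wedge:
  assumes "0 < \<sigma>" "\<sigma> < a" "0 < d" "norm u = 1" "0 \<le> M"
  shows "emeasure (kernel_measure \<sigma> z)
    {y. y \<noteq> z \<and> norm (y - z) < d \<and> \<bar>(y - z) \<bullet> u\<bar> \<le> M * norm (y - z) powr (1 + a)} < \<infinity>"
    (is "emeasure _ ?Y < _")
proof (rule kernel_measure_finite_of_cover[where \<rho>="\<lambda>n. d / 2^Suc n"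
      and X="\<lambda>n. {y. norm (y - z) \<le> d / 2^n \<and> \<bar>(y - z) \<bullet> u\<bar> \<le> M * (d / 2^n) powr (1 + a)} - ball z (d / 2 ^ Suc n)"
      and m="\<lambda>n. 4 * (d / 2^n) * (M * (d / 2^n) powr (1 + a))"])
  let ?S = "\<lambda>n. {y. norm (y - z) \<le> d / 2^n \<and> \<bar>(y - z) \<bullet> u\<bar> \<le> M * (d / 2^n) powr (1 + a)}"
  have meas: "?S n \<in> sets lebesgue" for n
  proof -
    have "closed {y. norm (y - z) \<le> d / 2^n}" "closed {y. \<bar>(y - z) \<bullet> u\<bar> \<le> M * (d / 2^n) powr (1 + a)}"
      by (intro closed_Collect_le continuous_intros)+
    then have "closed (?S n)" by (rule closed_Collect_conj)
    then show ?thesis by (simp add: borel_closed)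
  qed
  then show "?S n - ball z (d / 2 ^ Suc n) \<in> sets lebesgue" for n by auto
  show "emeasure lebesgue (?S n - ball z (d / 2 ^ Suc n)) \<le> ennreal (4 * (d / 2^n) * (M * (d / 2^n) powr (1 + a)))" for n
  proof -
    have "emeasure lebesgue (?S n - ball z (d / 2 ^ Suc n)) \<le> emeasure lebesgue (?S n)"
      using meas by (intro emeasure_mono) auto
    also have "\<dots> \<le> ennreal (4 * (d / 2^n) * (M * (d / 2^n) powr (1 + a)))"
      using assms by (intro emeasure_slab_le) auto
    finally show ?thesis .
  qed
  \<comment> \<open>The factor \<open>2 powr (2 + \<sigma>)\<close> is the price of bounding the
    kernel at the inner radius, half the outer one.\<close>
  have q: "4 * (d / 2^n) * (M * (d / 2^n) powr (1 + a)) / (d / 2^Suc n) powr (2 + \<sigma>)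
     = (4 * M * 2 powr (2 + \<sigma>) * d powr (a - \<sigma>)) * (1 / 2 powr (a - \<sigma>))^n" for n
  proof -
    define r where "r = d / 2^n"
    have r: "0 < r" using assms by (simp add: r_def)
    have "4 * r * (M * r powr (1 + a)) / (r / 2) powr (2 + \<sigma>) = 4 * M * 2 powr (2 + \<sigma>) * ((r * r powr (1 + a)) / r powr (2 + \<sigma>))"
      using r by (simp add: powr_divide)
    also have "r * r powr (1 + a) = r powr (2 + a)" using r by (simp add: powr_mult_base add.commute)
    also have "\<dots> / r powr (2 + \<sigma>) = r powr (a - \<sigma>)" using r by (simp add: powr_diff[symmetric])
    also have "r powr (a - \<sigma>) = d powr (a - \<sigma>) * (1 / 2 powr (a - \<sigma>))^n"
      using assms by (simp add: r_def powr_divide two_power_powr power_one_over)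
    finally have "4 * r * (M * r powr (1 + a)) / (r / 2) powr (2 + \<sigma>)
        = 4 * M * 2 powr (2 + \<sigma>) * d powr (a - \<sigma>) * (1 / 2 powr (a - \<sigma>))^n" by simp
    moreover have "d / 2 ^ Suc n = r / 2" by (simp add: r_def)
    ultimately show ?thesis by (simp only: r_def)
  qed
  show "summable (\<lambda>n. 4 * (d / 2^n) * (M * (d / 2^n) powr (1 + a)) / (d / 2^Suc n) powr (2 + \<sigma>))"
    unfolding q using assms by (intro summable_mult summable_geometric) (auto simp: divide_less_eq)
  show "?Y \<subseteq> (\<Union>n. ?S n - ball z (d / 2 ^ Suc n))"
  proof
    fix y assume y: "y \<in> ?Y"
    define v where "v = norm (y - z)"
    have v: "0 < v" "v < d" "dist z y = v" using y by (auto simp: v_def dist_norm norm_minus_commute)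
    obtain N where N: "d / v < 2 ^ N"
      using real_arch_pow[of 2 "d / v"] by auto
    define n where "n = (LEAST n. d < 2^n * v)"
    have ex: "d < 2^N * v" using N v by (simp add: field_simps)
    have n: "d < 2^n * v" unfolding n_def by (rule LeastI[of "\<lambda>n. d < 2^n * v", OF ex])
    with v have "n \<noteq> 0" by (intro notI) auto
    then obtain k where k: "n = Suc k" by (cases n) auto
    have "\<not> d < 2^k * v" using not_less_Least[of k "\<lambda>n. d < 2^n * v"] k n_def by auto
    then have 1: "v \<le> d / 2^k" by (simp add: field_simps)
    have 2: "\<not> v < d / 2^Suc k" using n k by (simp add: field_simps)
    have "\<bar>(y - z) \<bullet> u\<bar> \<le> M * v powr (1 + a)" using y by (simp add: v_def)
    also have "\<dots> \<le> M * (d / 2^k) powr (1 + a)"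
      using 1 v assms by (intro mult_left_mono powr_mono2) auto
    finally show "y \<in> (\<Union>n. ?S n - ball z (d / 2 ^ Suc n))"
      using 1 2 v v_def by auto
  qed
qed (use assms in \<open>auto simp: disjoint_iff\<close>)

section \<open>Truncated curvature and parity sets\<close>

text \<open>Vectors are taken from \<open>z\<close> to \<open>y\<close>, opposite to the convention
  of \<open>interior_set\<close>. With \<open>u\<close> this is the odd part of
  \<open>interior_set\<close>, with \<open>- u\<close> the odd part of \<open>exterior_set\<close>,
  so the geometry is developed once for both sides.\<close>

definition odd_front :: "real^2 \<Rightarrow> real^2 \<Rightarrow> (real^2) set \<Rightarrow> (real^2) set"
  where "odd_front z u C = {y. (z, y) \<in> odd_crossings C \<and> 0 < (y - z) \<bullet> u}"

text \<open>With no odd points the value would be the sign of \<open>(z - y) \<bullet> u\<close>;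
  odd parity flips that sign, a change by 2 in front and by -2 behind.\<close>

lemma chi_hat_eq:
  "chi_hat z C u y =
    2 * indicator (odd_front z u C) y - 2 * indicator (odd_front z (- u) C) y + sgn ((z - y) \<bullet> u)"
  by (auto simp: chi_hat_def interior_set_def exterior_set_def odd_front_def indicator_def
      inner_diff_left sgn_if)

lemma kernel_measure_eq_integral:
  assumes "X \<in> sets lebesgue"
  shows "measure (kernel_measure \<sigma> z) X = (\<integral>y. indicator X y * kernel \<sigma> z y \<partial>lebesgue)"
proof -
  have "measure (kernel_measure \<sigma> z) X = (\<integral>y. indicator X y \<partial>kernel_measure \<sigma> z)"
    by simp
  also have "\<dots> = (\<integral>y. kernel \<sigma> z y *\<^sub>R indicator X y \<partial>lebesgue)"
    unfolding kernel_measure_def using assms by (subst integral_density) auto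
  finally show ?thesis by (simp add: mult.commute)
qed

lemma kernel_integrable:
  assumes "X \<in> sets lebesgue" "emeasure (kernel_measure \<sigma> z) X < \<infinity>"
  shows "integrable lebesgue (\<lambda>y. indicator X y * kernel \<sigma> z y)"
proof -
  have "integrable (kernel_measure \<sigma> z) (indicator X :: _ \<Rightarrow> real)"
    using assms by (intro integrable_real_indicator) auto
  then have "integrable lebesgue (\<lambda>y. kernel \<sigma> z y *\<^sub>R (indicator X y :: real))"
    unfolding kernel_measure_def using assms by (subst (asm) integrable_density) auto
  then show ?thesis by (simp add: mult.commute)
qed

text \<open>The point reflection in \<open>z\<close> preserves Lebesgue measure, so the integral
  equals its own negative.\<close>

lemma integral_reflect_odd:
  fixes h :: "real^2 \<Rightarrow> real"
  assumes h: "h \<in> borel_measurable lebesgue" and odd: "\<And>y. h (2 *\<^sub>R z - y) = - h y"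
  shows "(\<integral>y. h y \<partial>lebesgue) = 0"
proof -
  \<comment> \<open>The reflection in coordinates, with scaling factor -1 on every axis; the
    Jacobian factor is then a product of ones.\<close>
  define T where "T = (\<lambda>x::real^2. 2 *\<^sub>R z + (\<Sum>j\<in>Basis. ((-1) * (x \<bullet> j)) *\<^sub>R j))"
  have T: "T x = 2 *\<^sub>R z - x" for x
    by (simp add: T_def sum_negf euclidean_representation)
  have T_meas: "T \<in> lebesgue \<rightarrow>\<^sub>M lebesgue"
    unfolding T_def by (rule lebesgue_affine_measurable) auto
  have "(lebesgue :: (real^2) measure) = density (distr lebesgue lebesgue T) (\<lambda>_. ennreal (\<Prod>j\<in>(Basis::(real^2) set). \<bar>- 1 :: real\<bar>))"
    unfolding T_def by (rule lebesgue_affine_euclidean) auto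
  then have eq: "(lebesgue :: (real^2) measure) = distr lebesgue lebesgue T"
    by (simp add: density_1)
  have "(\<integral>y. h y \<partial>lebesgue) = (\<integral>y. h y \<partial>distr lebesgue lebesgue T)"
    using eq by simp
  also have "\<dots> = (\<integral>y. h (T y) \<partial>lebesgue)"
    using T_meas h by (rule integral_distr)
  also have "\<dots> = - (\<integral>y. h y \<partial>lebesgue)"
    by (simp add: T odd)
  finally show ?thesis by simp
qed

text \<open>In \<open>chi_hat_eq\<close> the factors 2 cancel the 1/2 in front of the integral, and
  the sign term vanishes by reflection. Off the ball all three terms are integrable, so the integral
  may be split.\<close>

lemma truncated_curvature_eq:
  assumes "0 < \<sigma>" "0 < \<epsilon>" "odd_front z u C \<in> sets lebesgue" "odd_front z (- u) C \<in> sets lebesgue"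
  shows "truncated_curvature \<sigma> z C u \<epsilon> =
    measure (kernel_measure \<sigma> z) (odd_front z u C - ball z \<epsilon>) -
    measure (kernel_measure \<sigma> z) (odd_front z (- u) C - ball z \<epsilon>)"
proof -
  let ?F = "odd_front z u C - ball z \<epsilon>" and ?G = "odd_front z (- u) C - ball z \<epsilon>" and ?k = "kernel \<sigma> z"
  let ?h = "\<lambda>y. indicator (- ball z \<epsilon>) y * sgn ((z - y) \<bullet> u) * ?k y"
  have fin: "emeasure (kernel_measure \<sigma> z) X < \<infinity>" if "X \<subseteq> - ball z \<epsilon>" for X
    using emeasure_mono[OF that, of "kernel_measure \<sigma> z"] kernel_measure_off_ball[OF assms(1,2), of z]
    by (auto simp: Compl_in_sets_lebesgue intro: le_less_trans)
  have F: "integrable lebesgue (\<lambda>y. indicator ?F y * ?k y)" and G: "integrable lebesgue (\<lambda>y. indicator ?G y * ?k y)"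
    using assms by (intro kernel_integrable fin; auto)+
  have "(\<lambda>y. sgn ((z - y) \<bullet> u)) \<in> borel_measurable lborel" by measurable
  then have sgn: "(\<lambda>y. sgn ((z - y) \<bullet> u)) \<in> borel_measurable lebesgue"
    by (rule measurable_completion)
  have ind: "indicator (- ball z \<epsilon>) \<in> borel_measurable lebesgue"
    by (intro borel_measurable_indicator) (simp add: Compl_in_sets_lebesgue)
  have hm: "?h \<in> borel_measurable lebesgue"
    using sgn ind by (intro borel_measurable_times) auto
  have hi: "integrable lebesgue ?h"
  proof (rule Bochner_Integration.integrable_bound)
    show "integrable lebesgue (\<lambda>y. indicator (- ball z \<epsilon>) y * ?k y)"
      by (intro kernel_integrable fin) (auto simp: Compl_in_sets_lebesgue)
    show "AE y in lebesgue. norm (?h y) \<le> norm (indicator (- ball z \<epsilon>) y * ?k y)"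
      by (auto simp: indicator_def abs_mult sgn_if)
  qed (rule hm)
  have h0: "(\<integral>y. ?h y \<partial>lebesgue) = 0"
  proof (rule integral_reflect_odd[OF hm])
    show "?h (2 *\<^sub>R z - y) = - ?h y" for y
    proof -
      have e: "z - (2 *\<^sub>R z - y) = - (z - y)" by (simp add: algebra_simps scaleR_2)
      then have "dist z (2 *\<^sub>R z - y) = dist z y" by (metis dist_norm norm_minus_cancel)
      then have "indicator (- ball z \<epsilon>) (2 *\<^sub>R z - y) = (indicator (- ball z \<epsilon>) y :: real)"
        by (simp add: indicator_def)
      moreover have "?k (2 *\<^sub>R z - y) = ?k y" unfolding kernel_def e norm_minus_cancel ..
      moreover have "sgn ((z - (2 *\<^sub>R z - y)) \<bullet> u) = - sgn ((z - y) \<bullet> u)"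
        unfolding e inner_minus_left sgn_minus ..
      ultimately show ?thesis by simp
    qed
  qed
  have "truncated_curvature \<sigma> z C u \<epsilon> =
    1/2 * (\<integral>y. 2 * (indicator ?F y * ?k y) - 2 * (indicator ?G y * ?k y) + ?h y \<partial>lebesgue)"
    unfolding truncated_curvature_def set_lebesgue_integral_def chi_hat_eq
    by (intro arg_cong[where f="\<lambda>x. 1/2 * x"] Bochner_Integration.integral_cong)
      (auto simp: kernel_def indicator_def add_divide_distrib diff_divide_distrib)
  also have "\<dots> = 1/2 * (2 * (\<integral>y. indicator ?F y * ?k y \<partial>lebesgue) - 2 * (\<integral>y. indicator ?G y * ?k y \<partial>lebesgue))"
    using F G hi h0 by simp
  also have "\<dots> = measure (kernel_measure \<sigma> z) ?F - measure (kernel_measure \<sigma> z) ?G"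
    using assms by (subst (1 2) kernel_measure_eq_integral) auto
  finally show ?thesis .
qed

lemma halfplane_in_lebesgue [simp]: "{y. 0 < (y - z) \<bullet> u} \<in> sets lebesgue" for z u :: "real^2"
proof -
  have "open {y. 0 < (y - z) \<bullet> u}" by (intro open_Collect_less continuous_intros)
  then show ?thesis by (simp add: borel_open)
qed

text \<open>Without measurability the Lebesgue integral over the complement of a small ball takes its
  default value \<open>0\<close>.\<close>

lemma odd_front_measurable_or_truncated_zero:
  assumes "0 < \<sigma>"
  shows "(odd_front z u C \<in> sets lebesgue \<and> odd_front z (- u) C \<in> sets lebesgue) \<or>
    (\<forall>\<^sub>F \<epsilon> in at_right 0. truncated_curvature \<sigma> z C u \<epsilon> = 0)"
proof (cases "\<forall>\<epsilon>>0. set_integrable lebesgue (- ball z \<epsilon>) (\<lambda>y. chi_hat z C u y / norm (z - y) powr (2 + \<sigma>))")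
  case True
  \<comment> \<open>Away from \<open>z\<close> the kernel is positive, so \<open>g n\<close> has the
    sign of \<open>chi_hat\<close> off the n-th ball; the union over n recovers the parity sets from
    measurable functions.\<close>
  define g where "g n y = indicator (- ball z (1 / real (Suc n))) y * (chi_hat z C u y * kernel \<sigma> z y)" for n y
  have g: "g n \<in> borel_measurable lebesgue" for n
  proof -
    have "set_integrable lebesgue (- ball z (1 / real (Suc n))) (\<lambda>y. chi_hat z C u y / norm (z - y) powr (2 + \<sigma>))"
      using True by simp
    then have "(\<lambda>y. indicator (- ball z (1 / real (Suc n))) y *\<^sub>R (chi_hat z C u y / norm (z - y) powr (2 + \<sigma>))) \<in> borel_measurable lebesgue"
      unfolding set_integrable_def by (rule borel_measurable_integrable)
    then show ?thesis by (simp add: g_def[abs_def] kernel_def)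
  qed
  have pos: "\<exists>n. 0 < (indicator (- ball z (1 / real (Suc n))) y :: real) * kernel \<sigma> z y" if "y \<noteq> z" for y
  proof -
    have "0 < dist z y" using that by simp
    then obtain n where "1 / real (Suc n) < dist z y" by (rule nat_approx_posE)
    then show ?thesis using that by (intro exI[of _ n]) (auto simp: kernel_def indicator_def)
  qed
  have sign: "0 < g n y \<Longrightarrow> 0 < chi_hat z C u y" "g n y < 0 \<Longrightarrow> chi_hat z C u y < 0" for n y
  proof -
    have "0 \<le> indicator (- ball z (1 / real (Suc n))) y * kernel \<sigma> z y" by simp
    moreover have "g n y = chi_hat z C u y * (indicator (- ball z (1 / real (Suc n))) y * kernel \<sigma> z y)"
      by (simp add: g_def)
    ultimately show "0 < g n y \<Longrightarrow> 0 < chi_hat z C u y" "g n y < 0 \<Longrightarrow> chi_hat z C u y < 0"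
      by (smt (verit) mult_nonneg_nonneg mult_nonpos_nonneg)+
  qed
  have "odd_front z u C = (\<Union>n. {y. 0 < g n y}) \<inter> {y. 0 < (y - z) \<bullet> u}"
  proof safe
    fix y assume y: "y \<in> odd_front z u C"
    then show "0 < (y - z) \<bullet> u" by (simp add: odd_front_def)
    with y have "chi_hat z C u y = 1" "y \<noteq> z"
      by (auto simp: chi_hat_def interior_set_def odd_front_def inner_diff_left)
    with pos[of y] show "y \<in> (\<Union>n. {y. 0 < g n y})" by (auto simp: g_def)
  next
    fix y n assume "0 < g n y" "0 < (y - z) \<bullet> u"
    with sign(1)[of n y] show "y \<in> odd_front z u C"
      by (auto simp: chi_hat_def interior_set_def exterior_set_def odd_front_def inner_diff_left split: if_splits)
  qed
  moreover have "odd_front z (- u) C = (\<Union>n. {y. g n y < 0}) \<inter> {y. 0 < (y - z) \<bullet> (- u)}"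
  proof safe
    fix y assume y: "y \<in> odd_front z (- u) C"
    then show "0 < (y - z) \<bullet> (- u)" by (simp add: odd_front_def)
    with y have "chi_hat z C u y = - 1" "y \<noteq> z"
      by (auto simp: chi_hat_def interior_set_def exterior_set_def odd_front_def inner_diff_left)
    with pos[of y] show "y \<in> (\<Union>n. {y. g n y < 0})" by (auto simp: g_def)
  next
    fix y n assume "g n y < 0" "0 < (y - z) \<bullet> (- u)"
    with sign(2)[of n y] show "y \<in> odd_front z (- u) C"
      by (auto simp: chi_hat_def interior_set_def exterior_set_def odd_front_def inner_diff_left split: if_splits)
  qed
  moreover have "{y. 0 < g n y} \<in> sets lebesgue" "{y. g n y < 0} \<in> sets lebesgue" for n
    using g borel_measurable_less[of "\<lambda>_. 0" lebesgue "g n"] borel_measurable_less[of "g n" lebesgue "\<lambda>_. 0"]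
    by auto
  ultimately show ?thesis by (auto intro!: sets.Int sets.countable_UN)
next
  case False
  then obtain \<epsilon>0 where \<epsilon>0: "0 < \<epsilon>0"
    and n: "\<not> set_integrable lebesgue (- ball z \<epsilon>0) (\<lambda>y. chi_hat z C u y / norm (z - y) powr (2 + \<sigma>))"
    by auto
  \<comment> \<open>A failure of integrability off one ball persists off every smaller ball, where
    the domain is larger.\<close>
  have "truncated_curvature \<sigma> z C u \<epsilon> = 0" if "0 < \<epsilon>" "\<epsilon> < \<epsilon>0" for \<epsilon>
  proof -
    have "\<not> set_integrable lebesgue (- ball z \<epsilon>) (\<lambda>y. chi_hat z C u y / norm (z - y) powr (2 + \<sigma>))"
      using n that set_integrable_subset[of lebesgue "- ball z \<epsilon>" _ "- ball z \<epsilon>0"]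
        subset_ball[of \<epsilon> \<epsilon>0 z]
      by (auto simp: Compl_in_sets_lebesgue)
    then show ?thesis
      unfolding truncated_curvature_def set_lebesgue_integral_def set_integrable_def
      by (simp add: not_integrable_integral_eq)
  qed
  then show ?thesis using \<epsilon>0 by (auto simp: eventually_at_right_field)
qed

text \<open>Continuity from below along the radii \<open>1 / real (Suc n)\<close>. The extended-real
  form also serves sets of infinite mass.\<close>

lemma eventually_kernel_measure_gt:
  assumes "X \<in> sets lebesgue" "z \<notin> X" "c < emeasure (kernel_measure \<sigma> z) X"
  shows "\<forall>\<^sub>F \<epsilon> in at_right 0. c < emeasure (kernel_measure \<sigma> z) (X - ball z \<epsilon>)"
proof -
  let ?M = "kernel_measure \<sigma> z" and ?A = "\<lambda>n. X - ball z (1 / real (Suc n))"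
  have "(\<Union>n. ?A n) = X"
  proof safe
    fix y assume "y \<in> X"
    then have "0 < dist z y" using assms(2) by auto
    then obtain n where "1 / real (Suc n) < dist z y" by (rule nat_approx_posE)
    then show "y \<in> (\<Union>n. ?A n)" using \<open>y \<in> X\<close> by (auto intro!: exI[of _ n])
  qed
  moreover have "(\<lambda>n. emeasure ?M (?A n)) \<longlonglongrightarrow> emeasure ?M (\<Union>n. ?A n)"
  proof (rule Lim_emeasure_incseq)
    show "incseq ?A"
    proof (rule incseq_SucI, rule Diff_mono[OF order_refl], rule subset_ball)
      show "1 / real (Suc (Suc n)) \<le> 1 / real (Suc n)" for n by (simp add: field_simps)
    qed
  qed (use assms in auto)
  ultimately have "(\<lambda>n. emeasure ?M (?A n)) \<longlonglongrightarrow> emeasure ?M X" by simp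
  then have "\<forall>\<^sub>F n in sequentially. c < emeasure ?M (?A n)"
    using assms(3) by (rule order_tendstoD(1))
  then obtain n where n: "c < emeasure ?M (?A n)"
    using eventually_happens by force
  have "c < emeasure ?M (X - ball z \<epsilon>)" if "\<epsilon> < 1 / real (Suc n)" for \<epsilon>
  proof -
    have "emeasure ?M (?A n) \<le> emeasure ?M (X - ball z \<epsilon>)"
      using that assms by (intro emeasure_mono Diff_mono subset_ball) auto
    with n show ?thesis by (rule less_le_trans)
  qed
  then show ?thesis by (auto simp: eventually_at_right_field intro!: exI[of _ "1 / real (Suc n)"])
qed

lemma kernel_measure_tendsto:
  assumes "X \<in> sets lebesgue" "z \<notin> X" "emeasure (kernel_measure \<sigma> z) X < \<infinity>"
  shows "((\<lambda>\<epsilon>. measure (kernel_measure \<sigma> z) (X - ball z \<epsilon>)) \<longlongrightarrow> measure (kernel_measure \<sigma> z) X) (at_right 0)"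
proof (rule order_tendstoI)
  let ?M = "kernel_measure \<sigma> z"
  have fin: "X \<in> fmeasurable ?M" "X - ball z \<epsilon> \<in> fmeasurable ?M" for \<epsilon>
    using assms fmeasurable.Diff[of X ?M "ball z \<epsilon>"] by (auto simp: fmeasurable_def intro: le_less_trans[OF emeasure_mono])
  fix c
  { assume "c < measure ?M X"
    show "\<forall>\<^sub>F \<epsilon> in at_right 0. c < measure ?M (X - ball z \<epsilon>)"
    proof (cases "c < 0")
      case True
      then show ?thesis by (auto intro!: always_eventually simp: less_le_trans[OF True])
    next
      case False
      with \<open>c < measure ?M X\<close> have "ennreal c < emeasure ?M X"
        using fin by (simp add: emeasure_eq_measure2 ennreal_less_iff)
      then have "\<forall>\<^sub>F \<epsilon> in at_right 0. ennreal c < emeasure ?M (X - ball z \<epsilon>)"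
        by (rule eventually_kernel_measure_gt[OF assms(1,2)])
      then show ?thesis
        using False fin by (simp add: emeasure_eq_measure2 ennreal_less_iff)
    qed }
  { assume "measure ?M X < c"
    then show "\<forall>\<^sub>F \<epsilon> in at_right 0. measure ?M (X - ball z \<epsilon>) < c"
      using fin by (intro always_eventually allI) (auto intro: le_less_trans[OF measure_mono_fmeasurable] simp: fmeasurableD) }
qed

lemma not_in_odd_front [simp]: "z \<notin> odd_front z u C"
  by (simp add: odd_front_def)

lemma truncated_curvature_tendsto:
  assumes "0 < \<sigma>" and F: "odd_front z u C \<in> sets lebesgue" "emeasure (kernel_measure \<sigma> z) (odd_front z u C) < \<infinity>"
    and G: "odd_front z (- u) C \<in> sets lebesgue" "emeasure (kernel_measure \<sigma> z) (odd_front z (- u) C) < \<infinity>"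
  shows "(truncated_curvature \<sigma> z C u \<longlongrightarrow>
    measure (kernel_measure \<sigma> z) (odd_front z u C) - measure (kernel_measure \<sigma> z) (odd_front z (- u) C)) (at_right 0)"
proof (rule Lim_transform_eventually)
  show "((\<lambda>\<epsilon>. measure (kernel_measure \<sigma> z) (odd_front z u C - ball z \<epsilon>) -
    measure (kernel_measure \<sigma> z) (odd_front z (- u) C - ball z \<epsilon>)) \<longlongrightarrow>
    measure (kernel_measure \<sigma> z) (odd_front z u C) - measure (kernel_measure \<sigma> z) (odd_front z (- u) C)) (at_right 0)"
    using F G by (intro tendsto_diff kernel_measure_tendsto) auto
  show "\<forall>\<^sub>F \<epsilon> in at_right 0. measure (kernel_measure \<sigma> z) (odd_front z u C - ball z \<epsilon>) -
    measure (kernel_measure \<sigma> z) (odd_front z (- u) C - ball z \<epsilon>) = truncated_curvature \<sigma> z C u \<epsilon>"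
    using assms by (auto simp: eventually_at_right_field truncated_curvature_eq intro!: exI[of _ 1])
qed

section \<open>Charts and tangents\<close>

lemma C1_chart_at_other:
  assumes "C1_chart_at C p T g g'" "homeomorphism T (C \<inter> U) g h" "open U" "t \<in> T"
  shows "C1_chart_at C (g t) T g g'"
proof -
  have "g t \<in> C \<inter> U" using assms(2,4) by (auto simp: homeomorphism_def)
  then show ?thesis using assms unfolding C1_chart_at_def by blast
qed

text \<open>A chart is cut down to the parameters whose image lies in \<open>V\<close>. This makes
  tangents, and with them transversality, depend only on the germ of the set at the point.\<close>

lemma tangent_vector_local:
  assumes V: "open V" "p \<in> V" "C \<inter> V = C' \<inter> V" and "tangent_vector C p v"
  shows "tangent_vector C' p v"
proof -
  obtain T g g' t U h where T: "is_interval T" "interior T \<noteq> {}" and reg: "C1_regular_on g g' T"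
    and t: "t \<in> T" "g t = p" "g' t = v" and "p \<in> C" and U: "open U" "p \<in> U" "homeomorphism T (C \<inter> U) g h"
    using assms(4) unfolding tangent_vector_def C1_chart_at_def by blast
  have "continuous_on T g" using U(3) by (simp add: homeomorphism_def)
  then obtain W where W: "open W" "W \<inter> T = g -` V \<inter> T"
    using V(1) by (auto simp: continuous_on_open_invariant)
  then obtain d where d: "0 < d" "ball t d \<subseteq> W"
    using t V(2) by (metis IntD1 IntI open_contains_ball vimageI)
  define T' where "T' = T \<inter> ball t d"
  have T': "T' \<subseteq> T" "t \<in> T'" using t d by (auto simp: T'_def)
  have int: "is_interval T'"
    unfolding T'_def using T(1) by (intro is_interval_Int) (auto simp: is_interval_convex_1)
  have "convex T" using T(1) by (simp add: is_interval_convex)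
  \<comment> \<open>\<open>t\<close> may be an endpoint of \<open>T\<close>; interior points of
    \<open>T\<close> close to it keep the smaller interval nondegenerate.\<close>
  then have "t \<in> closure (interior T)"
    using convex_closure_interior[of T] T(2) t(1) closure_subset by fastforce
  then obtain x where "x \<in> interior T" "dist x t < d"
    using d(1) by (meson closure_approachable)
  then have "x \<in> interior T \<inter> ball t d" by (simp add: dist_commute)
  then have "interior T \<inter> ball t d \<noteq> {}" by blast
  then have "interior T' \<noteq> {}" by (simp add: T'_def interior_Int)
  moreover have "C1_regular_on g g' T'"
    using reg T'(1) unfolding C1_regular_on_def
    by (blast intro: has_vector_derivative_within_subset continuous_on_subset)
  \<comment> \<open>The homeomorphism carries the relatively open part of the interval to a
    relatively open part of the curve, cut out by an open set \<open>X\<close> of the plane.\<close>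
  moreover have "openin (top_of_set T) T'" by (auto simp: T'_def openin_open)
  then have "openin (top_of_set (C \<inter> U)) (g ` T')"
    using homeomorphism_imp_open_map[OF U(3)] by blast
  then obtain X where X: "open X" "g ` T' = C \<inter> U \<inter> X" by (auto simp: openin_open)
  have "g ` T' \<subseteq> V" using W d by (auto simp: T'_def)
  then have eq: "g ` T' = C' \<inter> (U \<inter> X \<inter> V)" using X V(3) by blast
  then have "homeomorphism T' (C' \<inter> (U \<inter> X \<inter> V)) g h"
    using homeomorphism_of_subsets[OF U(3) T'(1), of "C' \<inter> (U \<inter> X \<inter> V)"] X(2) by blast
  moreover have "p \<in> C' \<inter> (U \<inter> X \<inter> V)" using eq T'(2) t(2) by auto
  ultimately have "C1_chart_at C' p T' g g'"
    unfolding C1_chart_at_def using int U(1) X(1) V(1)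
    by (intro conjI exI[of _ "U \<inter> X \<inter> V"] exI[of _ h]) auto
  then show ?thesis using T'(2) t unfolding tangent_vector_def by blast
qed

section \<open>Parity depends only on the curve in one open half plane\<close>

lemma odd_crossings_local:
  assumes V: "open V" "open_segment z y \<subseteq> V" "C \<inter> V = C' \<inter> V"
  shows "(z, y) \<in> odd_crossings C \<longleftrightarrow> (z, y) \<in> odd_crossings C'"
proof -
  have eq: "C \<inter> open_segment z y = C' \<inter> open_segment z y" using V by blast
  have tv: "tangent_vector C p v \<longleftrightarrow> tangent_vector C' p v" if "p \<in> open_segment z y" for p v
    using tangent_vector_local[OF V(1) _ V(3)] tangent_vector_local[OF V(1) _ V(3)[symmetric]] that V(2) by blast
  have "transversal z y C \<longleftrightarrow> transversal z y C'"
    unfolding transversal_def using eq tv by (metis IntD1 Int_commute)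
  then show ?thesis by (simp add: odd_crossings_def eq)
qed

text \<open>The open segment from \<open>z\<close> to a point of the open half plane stays in that
  half plane, since it omits \<open>z\<close> itself.\<close>

lemma odd_front_local:
  assumes "C \<inter> {p. 0 < (p - z) \<bullet> u} = C' \<inter> {p. 0 < (p - z) \<bullet> u}"
  shows "odd_front z u C = odd_front z u C'"
proof -
  have "open {p. 0 < (p - z) \<bullet> u}" by (intro open_Collect_less continuous_intros)
  moreover have "open_segment z y \<subseteq> {p. 0 < (p - z) \<bullet> u}" if "0 < (y - z) \<bullet> u" for y
  proof
    fix p assume "p \<in> open_segment z y"
    then obtain l where "0 < l" "p = (1 - l) *\<^sub>R z + l *\<^sub>R y" by (auto simp: in_segment)
    then have "p - z = l *\<^sub>R (y - z)" by (simp add: algebra_simps)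
    then show "p \<in> {p. 0 < (p - z) \<bullet> u}" using that \<open>0 < l\<close> by simp
  qed
  ultimately show ?thesis
    using odd_crossings_local[OF _ _ assms] by (auto simp: odd_front_def)
qed

lemma rotate_clockwise_inner [simp]: "rotate_clockwise u \<bullet> u = 0" "u \<bullet> rotate_clockwise u = 0"
  by (auto simp: rotate_clockwise_def inner_vec_def sum_2)

text \<open>The added segment lies in the line through \<open>z\<close> orthogonal to
  \<open>u\<close>, hence in neither open half plane; on that line both sides are 0.\<close>

lemma chi_hat_add_segment: "chi_hat z (add_segment C z u \<delta>) u = chi_hat z C u"
proof -
  have seg: "p \<notin> closed_segment (z - \<delta> *\<^sub>R rotate_clockwise u) (z + \<delta> *\<^sub>R rotate_clockwise u)"
    if "(p - z) \<bullet> u \<noteq> 0" for p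
  proof
    assume "p \<in> closed_segment (z - \<delta> *\<^sub>R rotate_clockwise u) (z + \<delta> *\<^sub>R rotate_clockwise u)"
    then obtain l where "p = (1 - l) *\<^sub>R (z - \<delta> *\<^sub>R rotate_clockwise u) + l *\<^sub>R (z + \<delta> *\<^sub>R rotate_clockwise u)"
      by (auto simp: in_segment)
    then have "p - z = ((2 * l - 1) * \<delta>) *\<^sub>R rotate_clockwise u"
      by (simp add: vec_eq_iff algebra_simps)
    then show False using that by simp
  qed
  have "odd_front z u (add_segment C z u \<delta>) = odd_front z u C"
    using seg by (intro odd_front_local) (auto simp: add_segment_def)
  moreover have "odd_front z (- u) (add_segment C z u \<delta>) = odd_front z (- u) C"
    using seg by (intro odd_front_local) (auto simp: add_segment_def)
  ultimately show ?thesis by (auto simp: chi_hat_eq)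
qed

text \<open>By \<open>chi_hat_add_segment\<close> the auxiliary segment does not change the
  truncations, so the limit in \<open>\<delta>\<close> is that of a constant and both branches of
  the definition merge.\<close>

lemma has_nonlocal_curvature_iff:
  "has_nonlocal_curvature \<sigma> z C u k \<longleftrightarrow>
    norm u = 1 \<and> (z \<in> C \<longrightarrow> unit_normal C z u) \<and> (truncated_curvature \<sigma> z C u \<longlongrightarrow> k) (at_right 0)"
proof (cases "z \<in> C")
  case True
  then show ?thesis by (auto simp: has_nonlocal_curvature_def unit_normal_def)
next
  case False
  have eq: "truncated_curvature \<sigma> z (add_segment C z u \<delta>) u = truncated_curvature \<sigma> z C u" for \<delta>
    by (simp add: truncated_curvature_def[abs_def] chi_hat_add_segment)
  show ?thesis
  proof
    assume "has_nonlocal_curvature \<sigma> z C u k"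
    then obtain K where u: "norm u = 1"
      and K: "\<forall>\<^sub>F \<delta> in at_right 0. (truncated_curvature \<sigma> z C u \<longlongrightarrow> K \<delta>) (at_right 0)" "(K \<longlongrightarrow> k) (at_right (0::real))"
      using False by (auto simp: has_nonlocal_curvature_def eq)
    from eventually_happens[OF K(1)] obtain l where l: "(truncated_curvature \<sigma> z C u \<longlongrightarrow> l) (at_right 0)"
      by auto
    \<comment> \<open>Every eventual value of \<open>K\<close> is a limit of the same function,
      hence equal to \<open>l\<close>.\<close>
    have "\<forall>\<^sub>F \<delta> in at_right 0. K \<delta> = l"
      using K(1) by eventually_elim (rule tendsto_unique[OF _ _ l], auto)
    then have "(K \<longlongrightarrow> l) (at_right 0)" by (rule tendsto_eventually)
    with K(2) have "k = l" by (intro tendsto_unique[OF _ K(2)]) auto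
    with u l False show "norm u = 1 \<and> (z \<in> C \<longrightarrow> unit_normal C z u) \<and> (truncated_curvature \<sigma> z C u \<longlongrightarrow> k) (at_right 0)"
      by simp
  next
    assume "norm u = 1 \<and> (z \<in> C \<longrightarrow> unit_normal C z u) \<and> (truncated_curvature \<sigma> z C u \<longlongrightarrow> k) (at_right 0)"
    then show "has_nonlocal_curvature \<sigma> z C u k"
      using False by (auto simp: has_nonlocal_curvature_def eq intro!: exI[of _ "\<lambda>_. k"])
  qed
qed

lemma nonlocal_curvature_eqI:
  assumes "has_nonlocal_curvature \<sigma> z C u k"
  shows "nonlocal_curvature \<sigma> z C u = k"
  unfolding nonlocal_curvature_def
proof (rule the_equality)
  show "has_nonlocal_curvature \<sigma> z C u k" by (rule assms)
  fix l assume "has_nonlocal_curvature \<sigma> z C u l"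
  with assms show "l = k"
    unfolding has_nonlocal_curvature_iff by (intro tendsto_unique[of "at_right (0::real)"]) auto
qed

lemma truncated_curvature_uminus:
  "truncated_curvature \<sigma> z C (- u) \<epsilon> = - truncated_curvature \<sigma> z C u \<epsilon>"
proof -
  have "chi_hat z C (- u) y = - chi_hat z C u y" for y
    by (simp add: chi_hat_eq sgn_minus)
  then show ?thesis by (simp add: truncated_curvature_def set_lebesgue_integral_def)
qed

text \<open>Reduces negative values, and an infinite parity set behind \<open>z\<close>, to the half
  plane in front.\<close>

lemma has_nonlocal_curvature_uminus:
  "has_nonlocal_curvature \<sigma> z C (- u) (- k) \<longleftrightarrow> has_nonlocal_curvature \<sigma> z C u k"
proof -
  have "truncated_curvature \<sigma> z C (- u) = (\<lambda>\<epsilon>. - truncated_curvature \<sigma> z C u \<epsilon>)"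
    by (rule ext) (rule truncated_curvature_uminus)
  then show ?thesis
    by (simp add: has_nonlocal_curvature_iff unit_normal_def tendsto_minus_cancel_left)
qed

text \<open>The conclusion speaks of the set \<open>C\<close> alone, so it can be tested along any
  other chart. Continuity of the inverse \<open>h\<close> turns closeness in the plane into
  closeness of parameters.\<close>

lemma chart_normal_asymptotic:
  assumes "C1_regular_on g g' T" "homeomorphism T (C \<inter> U) g h" "open U" "t \<in> T" "w \<bullet> g' t = 0" "0 < e"
  shows "\<exists>d>0. \<forall>q\<in>C \<inter> ball (g t) d. \<bar>w \<bullet> (q - g t)\<bar> \<le> e * norm (q - g t)"
proof -
  let ?c = "norm (g' t)"
  have hom: "\<And>x. x \<in> T \<Longrightarrow> h (g x) = x" "\<And>y. y \<in> C \<inter> U \<Longrightarrow> g (h y) = y" "g ` T = C \<inter> U" "h ` (C \<inter> U) = T" "continuous_on (C \<inter> U) h"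
    using assms(2) by (auto simp: homeomorphism_def)
  have c: "0 < ?c" using assms(1,4) by (auto simp: C1_regular_on_def)
  \<comment> \<open>The first bound keeps at least half the speed, giving
    \<open>?c / 2 * \<bar>s - t\<bar> \<le> norm (q - g t)\<close>; the second makes the normal
    error at most \<open>e\<close> times that.\<close>
  define \<eta> where "\<eta> = min (?c / 2) (e * ?c / (2 * (1 + norm w)))"
  have \<eta>: "0 < \<eta>" "\<eta> \<le> ?c / 2" "norm w * \<eta> \<le> e * ?c / 2"
  proof -
    show "0 < \<eta>" using c assms(6) by (auto simp: \<eta>_def add_pos_nonneg)
    show "\<eta> \<le> ?c / 2" unfolding \<eta>_def by (rule min.cobounded1)
    have "norm w * \<eta> \<le> norm w * (e * ?c / (2 * (1 + norm w)))"
      by (intro mult_left_mono) (auto simp: \<eta>_def)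
    also have "\<dots> = (norm w / (1 + norm w)) * (e * ?c / 2)"
      by (simp add: field_simps add_nonneg_eq_0_iff)
    also have "\<dots> \<le> 1 * (e * ?c / 2)"
      using c assms(6) by (intro mult_right_mono) (auto simp: divide_le_eq add_pos_nonneg)
    finally show "norm w * \<eta> \<le> e * ?c / 2" by simp
  qed
  have "(g has_derivative (\<lambda>x. x *\<^sub>R g' t)) (at t within T)"
    using assms(1,4) by (auto simp: C1_regular_on_def has_vector_derivative_def)
  then obtain d1 where d1: "0 < d1" "\<And>s. s \<in> T \<Longrightarrow> \<bar>s - t\<bar> < d1 \<Longrightarrow> norm (g s - g t - (s - t) *\<^sub>R g' t) \<le> \<eta> * \<bar>s - t\<bar>"
    using \<eta>(1) unfolding has_derivative_within_alt by (metis real_norm_def)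
  have gt: "g t \<in> C \<inter> U" using hom assms(4) by blast
  then obtain d2 where d2: "0 < d2" "\<And>q. q \<in> C \<inter> U \<Longrightarrow> dist q (g t) < d2 \<Longrightarrow> dist (h q) (h (g t)) < d1"
    using hom(5) d1(1) unfolding continuous_on_iff by metis
  obtain d3 where d3: "0 < d3" "ball (g t) d3 \<subseteq> U"
    using gt assms(3) by (meson Int_iff open_contains_ball)
  have "\<bar>w \<bullet> (q - g t)\<bar> \<le> e * norm (q - g t)" if q: "q \<in> C \<inter> ball (g t) (min d2 d3)" for q
  proof -
    define s where "s = h q"
    have qU: "q \<in> C \<inter> U" using q d3 by auto
    then have s: "s \<in> T" "g s = q" using hom s_def by blast+
    have "\<bar>s - t\<bar> < d1"
      using d2(2)[OF qU] q hom(1)[OF assms(4)] by (simp add: s_def dist_real_def dist_commute)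
    then have le: "norm (q - g t - (s - t) *\<^sub>R g' t) \<le> \<eta> * \<bar>s - t\<bar>" using d1(2) s by blast
    have "w \<bullet> ((s - t) *\<^sub>R g' t) = 0" using assms(5) by simp
    then have "w \<bullet> (q - g t) = w \<bullet> (q - g t - (s - t) *\<^sub>R g' t)"
      by (simp only: inner_diff_right diff_zero)
    then have 1: "\<bar>w \<bullet> (q - g t)\<bar> \<le> norm w * (\<eta> * \<bar>s - t\<bar>)"
      using order_trans[OF Cauchy_Schwarz_ineq2 mult_left_mono[OF le norm_ge_zero[of w]]] by (simp only:)
    have "norm ((s - t) *\<^sub>R g' t) - norm (q - g t) \<le> norm ((s - t) *\<^sub>R g' t - (q - g t))" by (rule norm_triangle_ineq2)
    also have "\<dots> \<le> \<eta> * \<bar>s - t\<bar>" using le by (simp add: norm_minus_commute)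
    also have "\<dots> \<le> ?c / 2 * \<bar>s - t\<bar>" using \<eta>(2) by (intro mult_right_mono) auto
    finally have 2: "?c / 2 * \<bar>s - t\<bar> \<le> norm (q - g t)" by (simp add: mult.commute)
    have "norm w * (\<eta> * \<bar>s - t\<bar>) = (norm w * \<eta>) * \<bar>s - t\<bar>" by simp
    also have "\<dots> \<le> (e * ?c / 2) * \<bar>s - t\<bar>" using \<eta>(3) by (intro mult_right_mono) auto
    also have "\<dots> = e * (?c / 2 * \<bar>s - t\<bar>)" by simp
    also have "\<dots> \<le> e * norm (q - g t)" using 2 assms(6) by (intro mult_left_mono) auto
    finally show ?thesis using 1 by linarith
  qed
  then show ?thesis using d2 d3 by (intro exI[of _ "min d2 d3"]) auto
qed

text \<open>Two charts at \<open>p\<close> have parallel velocities: the points of the second chart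
  lie on \<open>C\<close>, so by the asymptotics of the first their normal displacement is of
  smaller order than their distance from \<open>p\<close>.\<close>

lemma tangent_normal_unique:
  assumes "tangent_vector C p v" "tangent_vector C p v'" "w \<bullet> v = 0"
  shows "w \<bullet> v' = 0"
proof -
  obtain T g g' t U h where A: "C1_regular_on g g' T" "homeomorphism T (C \<inter> U) g h" "open U" "t \<in> T" "g t = p" "g' t = v"
    using assms(1) unfolding tangent_vector_def C1_chart_at_def by blast
  obtain S f f' s V k where B: "C1_regular_on f f' S" "homeomorphism S (C \<inter> V) f k" "open V" "s \<in> S" "f s = p" "f' s = v'"
    and S: "is_interval S" "interior S \<noteq> {}"
    using assms(2) unfolding tangent_vector_def C1_chart_at_def by blast
  have fd: "(f has_vector_derivative v') (at s within S)" using B by (auto simp: C1_regular_on_def)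
  have "convex S" using S(1) by (simp add: is_interval_convex)
  have "\<not> (\<exists>x. S = {x})" using S(2) by auto
  then have nt: "at s within S \<noteq> bot"
    using connected_imp_perfect[of S s] \<open>convex S\<close> B(4) by (auto simp: trivial_limit_within convex_connected)
  have fC: "f ` S \<subseteq> C" and cf: "continuous_on S f" using B(2) by (auto simp: homeomorphism_def)
  show ?thesis
  proof (rule ccontr)
    define c where "c = \<bar>w \<bullet> v'\<bar>"
    assume "w \<bullet> v' \<noteq> 0"
    then have c: "0 < c" by (simp add: c_def)
    \<comment> \<open>\<open>\<eta>\<close> and \<open>e\<close> are chosen so that the two errors
      are each at most \<open>c / 3\<close> per unit of parameter; together they cannot make up
      \<open>c\<close>.\<close>
    define \<eta> where "\<eta> = c / (3 * (norm w + 1))"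
    define e where "e = c / (3 * (norm v' + \<eta> + 1))"
    have \<eta>: "0 < \<eta>" using c by (auto simp: \<eta>_def add_nonneg_pos)
    have e: "0 < e" using c \<eta> by (auto simp: e_def intro!: divide_pos_pos add_nonneg_pos)
    have le1: "norm w * \<eta> \<le> c / 3"
    proof -
      have "norm w * \<eta> = (norm w / (norm w + 1)) * (c / 3)" by (simp add: \<eta>_def algebra_simps)
      also have "\<dots> \<le> 1 * (c / 3)" using c by (intro mult_right_mono) (auto simp: divide_le_eq add_nonneg_pos)
      finally show ?thesis by simp
    qed
    have le2: "e * (norm v' + \<eta>) \<le> c / 3"
    proof -
      have "e * (norm v' + \<eta>) = ((norm v' + \<eta>) / (norm v' + \<eta> + 1)) * (c / 3)" by (simp add: e_def algebra_simps)
      also have "\<dots> \<le> 1 * (c / 3)" using c \<eta> by (intro mult_right_mono) (auto simp: divide_le_eq add_nonneg_pos)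
      finally show ?thesis by simp
    qed
    obtain d where d: "0 < d" "\<forall>q\<in>C \<inter> ball p d. \<bar>w \<bullet> (q - p)\<bar> \<le> e * norm (q - p)"
      using chart_normal_asymptotic[OF A(1-4), of w e] A(5,6) assms(3) e by auto
    have "(f has_derivative (\<lambda>x. x *\<^sub>R v')) (at s within S)"
      using fd by (simp add: has_vector_derivative_def)
    then obtain d1 where d1: "0 < d1" "\<And>x. x \<in> S \<Longrightarrow> \<bar>x - s\<bar> < d1 \<Longrightarrow> norm (f x - p - (x - s) *\<^sub>R v') \<le> \<eta> * \<bar>x - s\<bar>"
      using \<eta> B(5) unfolding has_derivative_within_alt by (metis real_norm_def)
    obtain d2 where d2: "0 < d2" "\<And>x. x \<in> S \<Longrightarrow> dist x s < d2 \<Longrightarrow> dist (f x) p < d"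
      using cf B(4,5) d(1) unfolding continuous_on_iff by metis
    have "s islimpt S" using nt by (simp add: trivial_limit_within)
    then obtain x where x: "x \<in> S" "x \<noteq> s" "dist x s < min d1 d2"
      using d1(1) d2(1) unfolding islimpt_approachable by (metis min_less_iff_conj)
    define r where "r = \<bar>x - s\<bar>"
    have r: "0 < r" using x by (simp add: r_def)
    have n: "norm (f x - p - (x - s) *\<^sub>R v') \<le> \<eta> * r" using d1(2) x by (simp add: dist_real_def r_def)
    have "f x \<in> C \<inter> ball p d" using x d2(2) fC by (auto simp: dist_commute)
    then have 1: "\<bar>w \<bullet> (f x - p)\<bar> \<le> e * norm (f x - p)" using d(2) by blast
    have "norm (f x - p) \<le> norm ((x - s) *\<^sub>R v') + norm (f x - p - (x - s) *\<^sub>R v')"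
      by (metis add_diff_cancel_left' diff_add_cancel norm_triangle_ineq add.commute)
    moreover have "norm ((x - s) *\<^sub>R v') = r * norm v'" by (simp add: r_def)
    ultimately have "norm (f x - p) \<le> r * norm v' + \<eta> * r" using n by linarith
    then have "norm (f x - p) \<le> (norm v' + \<eta>) * r" by (simp add: algebra_simps)
    then have "e * norm (f x - p) \<le> e * (norm v' + \<eta>) * r" using e by simp
    also have "\<dots> \<le> c / 3 * r" using le2 r by (intro mult_right_mono) auto
    finally have 2: "\<bar>w \<bullet> (f x - p)\<bar> \<le> c / 3 * r" using 1 by linarith
    have "\<bar>w \<bullet> (f x - p - (x - s) *\<^sub>R v')\<bar> \<le> norm w * (\<eta> * r)"
      by (rule order_trans[OF Cauchy_Schwarz_ineq2 mult_left_mono[OF n norm_ge_zero[of w]]])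
    also have "\<dots> = (norm w * \<eta>) * r" by simp
    also have "\<dots> \<le> c / 3 * r" using le1 r by (intro mult_right_mono) auto
    finally have 3: "\<bar>w \<bullet> (f x - p) - (x - s) * (w \<bullet> v')\<bar> \<le> c / 3 * r"
      by (simp add: inner_diff_right)
    have "\<bar>(x - s) * (w \<bullet> v')\<bar> = c * r" by (simp add: abs_mult c_def r_def)
    with 2 3 have "c * r \<le> c / 3 * r + c / 3 * r" by linarith
    then show False using c r by simp
  qed
qed

section \<open>Chords and their shadows\<close>

locale half_plane =
  fixes z u :: "real^2"
  assumes unit: "norm u = 1"
begin

definition height :: "real^2 \<Rightarrow> real"
  where "height y = (y - z) \<bullet> u"

definition lateral :: "real^2 \<Rightarrow> real"
  where "lateral y = (y - z) \<bullet> rotate_clockwise u"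

text \<open>The tangent of the angle with \<open>u\<close>. It is constant on each ray from
  \<open>z\<close> into the half plane and serves there as the coordinate of directions.\<close>

definition slope :: "real^2 \<Rightarrow> real"
  where "slope y = lateral y / height y"

lemma decomp: "v = (v \<bullet> rotate_clockwise u) *\<^sub>R rotate_clockwise u + (v \<bullet> u) *\<^sub>R u"
proof -
  have 1: "u $ 1 * u $ 1 + u $ 2 * u $ 2 = 1"
    using unit by (simp add: norm_eq_1 inner_vec_def sum_2)
  have "v $ 1 = v $ 1 * (u $ 1 * u $ 1 + u $ 2 * u $ 2)" "v $ 2 = v $ 2 * (u $ 1 * u $ 1 + u $ 2 * u $ 2)"
    by (simp_all add: 1)
  then show ?thesis
    by (simp add: vec_eq_iff forall_2 rotate_clockwise_def inner_vec_def sum_2 algebra_simps)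
qed

lemma lateral_height_eqI:
  assumes "lateral p = lateral q" "height p = height q"
  shows "p = q"
  using decomp[of "p - z"] decomp[of "q - z"] assms unfolding lateral_def height_def by simp

lemma height_z [simp]: "height z = 0" and lateral_z [simp]: "lateral z = 0"
  by (simp_all add: height_def lateral_def)

lemma height_combination: "height ((1 - l) *\<^sub>R p + l *\<^sub>R q) = (1 - l) * height p + l * height q"
  and lateral_combination: "lateral ((1 - l) *\<^sub>R p + l *\<^sub>R q) = (1 - l) * lateral p + l * lateral q"
  by (simp_all add: height_def lateral_def algebra_simps inner_simps)

lemma continuous_height [continuous_intros]: "continuous_on A f \<Longrightarrow> continuous_on A (\<lambda>x. height (f x))"
  and continuous_lateral [continuous_intros]: "continuous_on A f \<Longrightarrow> continuous_on A (\<lambda>x. lateral (f x))"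
  by (simp_all add: height_def lateral_def continuous_intros)

lemma height_le_norm: "\<bar>height y\<bar> \<le> norm (y - z)"
  using Cauchy_Schwarz_ineq2[of "y - z" u] unit by (simp add: height_def)

lemma lateral_slope: "0 < height y \<Longrightarrow> lateral y = slope y * height y"
  by (simp add: slope_def)

lemma slope_measurable: "slope \<in> borel_measurable borel"
  unfolding slope_def[abs_def] lateral_def height_def by measurable

lemma slope_strip_in_lebesgue:
  assumes "open G"
  shows "{y. slope y \<in> G} \<in> sets lebesgue"
proof -
  have "slope -` G \<inter> space borel \<in> sets borel"
    by (rule measurable_sets[OF slope_measurable borel_open[OF assms]])
  then have "slope -` G \<in> sets lebesgue" by simp
  then show ?thesis by (simp add: vimage_def)
qed

definition chord :: "real^2 \<Rightarrow> real^2 \<Rightarrow> bool"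
  where "chord P Q \<longleftrightarrow> 0 < height P \<and> 0 < height Q \<and> slope P < slope Q"

text \<open>The affine form \<open>chord_form P Q\<close> vanishes at \<open>z\<close> and takes the value \<open>chord_const P Q\<close> exactly on
  the line through \<open>P\<close> and \<open>Q\<close>, so comparing the two tells on which side of the chord a point lies.\<close>

definition chord_form :: "real^2 \<Rightarrow> real^2 \<Rightarrow> real^2 \<Rightarrow> real"
  where "chord_form P Q y = height P * (lateral y - slope P * height y) + height Q * (slope Q * height y - lateral y)"

definition chord_const :: "real^2 \<Rightarrow> real^2 \<Rightarrow> real"
  where "chord_const P Q = height P * height Q * (slope Q - slope P)"

text \<open>The division in \<open>slope\<close> is multiplied out, which makes the set visibly
  open. For a chord, nonpositive heights are excluded automatically, see
  \<open>cone_height_pos\<close>.\<close>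

definition cone :: "real^2 \<Rightarrow> real^2 \<Rightarrow> (real^2) set"
  where "cone P Q = {y. slope P * height y < lateral y \<and> lateral y < slope Q * height y}"

text \<open>The part of the cone hidden behind the chord when seen from \<open>z\<close>.\<close>

definition shadow :: "real^2 \<Rightarrow> real^2 \<Rightarrow> (real^2) set"
  where "shadow P Q = {y \<in> cone P Q. chord_const P Q < chord_form P Q y}"

lemma chord_const_pos: "chord P Q \<Longrightarrow> 0 < chord_const P Q"
  by (simp add: chord_def chord_const_def)

lemma cone_height_pos: "chord P Q \<Longrightarrow> y \<in> cone P Q \<Longrightarrow> 0 < height y"
proof (rule ccontr)
  assume "chord P Q" "y \<in> cone P Q" "\<not> 0 < height y"
  then have "slope Q * height y \<le> slope P * height y"
    by (intro mult_right_mono_neg) (auto simp: chord_def)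
  with \<open>y \<in> cone P Q\<close> show False by (simp add: cone_def)
qed

lemma cone_iff_slope: "0 < height y \<Longrightarrow> y \<in> cone P Q \<longleftrightarrow> slope P < slope y \<and> slope y < slope Q"
  by (simp add: cone_def slope_def field_simps)

lemma open_cone: "open (cone P Q)"
  unfolding cone_def by (intro open_Collect_conj open_Collect_less continuous_intros)

lemma open_shadow: "open (shadow P Q)"
proof -
  have "shadow P Q = cone P Q \<inter> {y. chord_const P Q < chord_form P Q y}"
    by (auto simp: shadow_def)
  then show ?thesis
    unfolding chord_form_def by (auto intro!: open_Int open_cone open_Collect_less continuous_intros)
qed

text \<open>The two summands of \<open>chord_form\<close>, divided by \<open>chord_const\<close>,
  are the barycentric weights of \<open>Q\<close> and of \<open>P\<close>.\<close>

lemma chord_segment_combination: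
  assumes "chord P Q" and p: "p = (1 - l) *\<^sub>R P + l *\<^sub>R Q"
  shows "chord_form P Q p = chord_const P Q"
    and "height P * (lateral p - slope P * height p) = l * chord_const P Q"
    and "height Q * (slope Q * height p - lateral p) = (1 - l) * chord_const P Q"
    and "height p = (1 - l) * height P + l * height Q"
proof -
  have P: "lateral P = slope P * height P" and Q: "lateral Q = slope Q * height Q"
    using assms(1) by (auto simp: chord_def lateral_slope)
  have h: "height p = (1 - l) * height P + l * height Q" and L: "lateral p = (1 - l) * (slope P * height P) + l * (slope Q * height Q)"
    unfolding p height_combination lateral_combination P Q by simp_all
  show 1: "height P * (lateral p - slope P * height p) = l * chord_const P Q"
    and 2: "height Q * (slope Q * height p - lateral p) = (1 - l) * chord_const P Q"
    unfolding h L chord_const_def by (simp_all add: algebra_simps)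
  show "chord_form P Q p = chord_const P Q"
    unfolding chord_form_def 1 2 by (simp add: algebra_simps)
  show "height p = (1 - l) * height P + l * height Q" by (rule h)
qed

lemma chord_segment_iff:
  assumes "chord P Q"
  defines "l \<equiv> \<lambda>p. height P * (lateral p - slope P * height p) / chord_const P Q"
  shows "chord_form P Q p = chord_const P Q \<longleftrightarrow> p = (1 - l p) *\<^sub>R P + l p *\<^sub>R Q"
proof
  assume eq: "chord_form P Q p = chord_const P Q"
  have c: "chord_const P Q \<noteq> 0" using chord_const_pos[OF assms(1)] by simp
  have P: "lateral P = slope P * height P" and Q: "lateral Q = slope Q * height Q"
    using assms(1) by (auto simp: chord_def lateral_slope)
  have 1: "1 - l p = height Q * (slope Q * height p - lateral p) / chord_const P Q"
    using eq c unfolding l_def chord_form_def by (simp add: field_simps)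
  have h: "height p * chord_const P Q = height Q * (slope Q * height p - lateral p) * height P + height P * (lateral p - slope P * height p) * height Q"
    by (simp add: chord_const_def algebra_simps)
  have L: "lateral p * chord_const P Q = height Q * (slope Q * height p - lateral p) * (slope P * height P) + height P * (lateral p - slope P * height p) * (slope Q * height Q)"
    by (simp add: chord_const_def algebra_simps)
  show "p = (1 - l p) *\<^sub>R P + l p *\<^sub>R Q"
  proof (rule lateral_height_eqI)
    show "height p = height ((1 - l p) *\<^sub>R P + l p *\<^sub>R Q)"
      unfolding height_combination unfolding 1 using h c by (simp add: l_def add_divide_distrib[symmetric] eq_divide_eq)
    show "lateral p = lateral ((1 - l p) *\<^sub>R P + l p *\<^sub>R Q)"
      unfolding lateral_combination P Q unfolding 1 using L c by (simp add: l_def add_divide_distrib[symmetric] eq_divide_eq)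
  qed
next
  assume "p = (1 - l p) *\<^sub>R P + l p *\<^sub>R Q"
  then show "chord_form P Q p = chord_const P Q" by (rule chord_segment_combination(1)[OF assms(1)])
qed

lemma chord_distinct: "chord P Q \<Longrightarrow> P \<noteq> Q"
  by (auto simp: chord_def)

lemma mem_open_chord_iff:
  assumes "chord P Q"
  shows "p \<in> open_segment P Q \<longleftrightarrow> p \<in> cone P Q \<and> chord_form P Q p = chord_const P Q"
proof
  assume "p \<in> open_segment P Q"
  then obtain l where l: "0 < l" "l < 1" "p = (1 - l) *\<^sub>R P + l *\<^sub>R Q" by (auto simp: in_segment)
  note s = chord_segment_combination[OF assms l(3)]
  have "0 < l * chord_const P Q" "0 < (1 - l) * chord_const P Q" using l chord_const_pos[OF assms] by auto
  then show "p \<in> cone P Q \<and> chord_form P Q p = chord_const P Q"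
    using s assms unfolding cone_def by (auto simp: chord_def zero_less_mult_iff simp flip: s(2,3))
next
  assume a: "p \<in> cone P Q \<and> chord_form P Q p = chord_const P Q"
  define l where "l = height P * (lateral p - slope P * height p) / chord_const P Q"
  have p: "p = (1 - l) *\<^sub>R P + l *\<^sub>R Q" using a chord_segment_iff[OF assms, of p] by (simp add: l_def)
  note s = chord_segment_combination[OF assms p]
  have "0 < l * chord_const P Q" "0 < (1 - l) * chord_const P Q"
    using a assms unfolding s(2)[symmetric] s(3)[symmetric] by (auto simp: cone_def chord_def)
  then have "0 < l" "l < 1" using chord_const_pos[OF assms] by (auto simp: zero_less_mult_iff)
  then show "p \<in> open_segment P Q" using p chord_distinct[OF assms] by (auto simp: in_segment)
qed

lemma closed_chord_bounds:
  assumes "chord P Q" "p \<in> closed_segment P Q"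
  shows "min (height P) (height Q) \<le> height p" "height p \<le> max (height P) (height Q)" "0 < height p"
    "slope P \<le> slope p" "slope p \<le> slope Q"
proof -
  obtain l where l: "0 \<le> l" "l \<le> 1" "p = (1 - l) *\<^sub>R P + l *\<^sub>R Q" using assms(2) by (auto simp: in_segment)
  note s = chord_segment_combination[OF assms(1) l(3)]
  let ?m = "min (height P) (height Q)" and ?M = "max (height P) (height Q)"
  have "(1 - l) * ?m + l * ?m \<le> (1 - l) * height P + l * height Q"
    using l by (intro add_mono mult_left_mono) auto
  then show 1: "?m \<le> height p" unfolding s(4) by (simp add: algebra_simps)
  have "(1 - l) * height P + l * height Q \<le> (1 - l) * ?M + l * ?M"
    using l by (intro add_mono mult_left_mono) auto
  then show "height p \<le> ?M" unfolding s(4) by (simp add: algebra_simps)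
  have "0 < ?m" using assms(1) by (simp add: chord_def)
  with 1 show p: "0 < height p" by linarith
  have "0 \<le> l * chord_const P Q" "0 \<le> (1 - l) * chord_const P Q"
    using l chord_const_pos[OF assms(1)] by auto
  then have "slope P * height p \<le> lateral p" "lateral p \<le> slope Q * height p"
    using assms(1) unfolding s(2)[symmetric] s(3)[symmetric] by (auto simp: chord_def zero_le_mult_iff)
  with p show "slope P \<le> slope p" "slope p \<le> slope Q" by (simp_all add: slope_def field_simps)
qed

lemma closed_chord_Int_cone:
  assumes "chord P Q"
  shows "closed_segment P Q \<inter> cone P Q = open_segment P Q"
proof -
  have "closed_segment P Q = open_segment P Q \<union> {P, Q}" by (rule closed_segment_eq_open)
  moreover have "P \<notin> cone P Q" "Q \<notin> cone P Q"
    using assms by (auto simp: cone_def chord_def lateral_slope)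
  moreover have "open_segment P Q \<subseteq> cone P Q" using mem_open_chord_iff[OF assms] by auto
  ultimately show ?thesis by blast
qed

lemma ray_point:
  assumes "p \<in> open_segment z y"
  obtains l where "0 < l" "l < 1" "p = (1 - l) *\<^sub>R z + l *\<^sub>R y" "height p = l * height y" "lateral p = l * lateral y"
    "chord_form P Q p = l * chord_form P Q y"
proof -
  obtain l where l: "0 < l" "l < 1" "p = (1 - l) *\<^sub>R z + l *\<^sub>R y" using assms by (auto simp: in_segment)
  then have "height p = l * height y" "lateral p = l * lateral y"
    by (simp_all add: height_combination lateral_combination)
  with l that show ?thesis by (simp add: chord_form_def algebra_simps)
qed

lemma ray_point_slope:
  assumes "p \<in> open_segment z y" "0 < height y"
  shows "slope p = slope y" "0 < height p" "height p < height y"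
  using assms by (auto elim!: ray_point simp: slope_def)

text \<open>Along the ray \<open>chord_form\<close> grows linearly from 0 at \<open>z\<close>, so it
  takes the value \<open>chord_const\<close> at most once, and before reaching \<open>y\<close>
  exactly when its value at \<open>y\<close> is larger. The quotient of the two is the crossing
  parameter.\<close>

lemma chord_Int_ray:
  assumes "chord P Q" "y \<in> cone P Q"
  shows "closed_segment P Q \<inter> open_segment z y =
    (if y \<in> shadow P Q then {(1 - chord_const P Q / chord_form P Q y) *\<^sub>R z + (chord_const P Q / chord_form P Q y) *\<^sub>R y} else {})"
proof -
  note c = chord_const_pos[OF assms(1)]
  have hy: "0 < height y" using cone_height_pos assms by blast
  have cone: "p \<in> cone P Q" if "p \<in> open_segment z y" for p
    using ray_point_slope[OF that hy] assms(2) hy by (simp add: cone_iff_slope)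
  have iff: "p \<in> closed_segment P Q \<longleftrightarrow> chord_form P Q p = chord_const P Q" if "p \<in> open_segment z y" for p
    using cone[OF that] mem_open_chord_iff[OF assms(1), of p] closed_chord_Int_cone[OF assms(1)] by blast
  show ?thesis
  proof (cases "y \<in> shadow P Q")
    case True
    define l where "l = chord_const P Q / chord_form P Q y"
    have l: "0 < l" "l < 1" "l * chord_form P Q y = chord_const P Q" using True c by (auto simp: l_def shadow_def)
    let ?p = "(1 - l) *\<^sub>R z + l *\<^sub>R y"
    have zy: "z \<noteq> y" using hy by (metis height_z less_irrefl)
    have p: "?p \<in> open_segment z y" using l zy by (auto simp: in_segment)
    have "chord_form P Q ?p = l * chord_form P Q y"
      unfolding chord_form_def height_combination lateral_combination by (simp add: algebra_simps)
    then have "?p \<in> closed_segment P Q" using iff[OF p] l by simp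
    moreover have "q = ?p" if q: "q \<in> closed_segment P Q" "q \<in> open_segment z y" for q
    proof -
      obtain k where k: "q = (1 - k) *\<^sub>R z + k *\<^sub>R y" "chord_form P Q q = k * chord_form P Q y"
        using ray_point[OF q(2)] by metis
      then have "k * chord_form P Q y = chord_const P Q" using iff q by auto
      then have "k = l"
        unfolding l_def using c by (cases "chord_form P Q y = 0") (auto simp: eq_divide_eq)
      then show ?thesis using k by simp
    qed
    ultimately have "closed_segment P Q \<inter> open_segment z y = {?p}" using p by blast
    then show ?thesis using True by (simp only: l_def if_True)
  next
    case False
    have "chord_form P Q p \<noteq> chord_const P Q" if p: "p \<in> open_segment z y" for p
    proof -
      obtain k where k: "0 < k" "k < 1" "chord_form P Q p = k * chord_form P Q y"
        using ray_point[OF p] by metis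
      have "chord_form P Q y \<le> chord_const P Q" using False assms(2) by (auto simp: shadow_def)
      then have "k * chord_form P Q y \<le> k * chord_const P Q" using k by simp
      also have "\<dots> < chord_const P Q" using k c by simp
      finally show ?thesis using k by simp
    qed
    then show ?thesis using False iff by auto
  qed
qed

text \<open>The chart is the affine parameterization over the open unit interval; its inverse is the
  barycentric weight of \<open>Q\<close>, and the cone is the open set that isolates the chord in
  \<open>S\<close>.\<close>

lemma tangent_vector_chord:
  assumes "chord P Q" "S \<inter> cone P Q = open_segment P Q" "p \<in> open_segment P Q"
  shows "tangent_vector S p (Q - P)"
proof -
  define g where "g = (\<lambda>t. (1 - t) *\<^sub>R P + t *\<^sub>R Q)"
  define h where "h = (\<lambda>p. height P * (lateral p - slope P * height p) / chord_const P Q)"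
  have c: "chord_const P Q \<noteq> 0" using chord_const_pos[OF assms(1)] by simp
  have hg: "h (g t) = t" for t
    using chord_segment_combination(2)[OF assms(1), of "g t" t] c by (simp add: h_def g_def)
  have im: "g ` {0<..<1} = open_segment P Q"
    using chord_distinct[OF assms(1)] by (auto simp: g_def in_segment)
  have hom: "homeomorphism {0<..<1} (S \<inter> cone P Q) g h"
  proof (rule homeomorphismI)
    show "continuous_on {0<..<1} g" unfolding g_def by (intro continuous_intros)
    show "continuous_on (S \<inter> cone P Q) h" unfolding h_def using c by (intro continuous_intros) auto
    show "g ` {0<..<1} \<subseteq> S \<inter> cone P Q" "h ` (S \<inter> cone P Q) \<subseteq> {0<..<1}"
      unfolding assms(2) im[symmetric] by (auto simp: hg)
    show "h (g x) = x" for x by (rule hg)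
    show "g (h y) = y" if "y \<in> S \<inter> cone P Q" for y
      using that unfolding assms(2) im[symmetric] by (auto simp: hg)
  qed
  have "(g has_vector_derivative (Q - P)) (at t within {0<..<1})" for t
    unfolding g_def by (auto intro!: derivative_eq_intros)
  then have "C1_regular_on g (\<lambda>_. Q - P) {0<..<1}"
    using chord_distinct[OF assms(1)] by (auto simp: C1_regular_on_def)
  moreover have "p \<in> S" "p \<in> cone P Q" using assms(2,3) by auto
  moreover have "interior {0<..<1::real} \<noteq> {}" by (simp add: interior_open)
  ultimately have "C1_chart_at S p {0<..<1} g (\<lambda>_. Q - P)"
    unfolding C1_chart_at_def using hom open_cone by (auto simp: is_interval_convex_1)
  moreover obtain t where "t \<in> {0<..<1}" "g t = p" using assms(3) im by (metis imageE)
  ultimately show ?thesis unfolding tangent_vector_def by blast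
qed

text \<open>\<open>chord_form\<close> has equal values at \<open>P\<close> and \<open>Q\<close>,
  while a chord equal to c times the ray direction would change it by c times its positive value at
  \<open>y\<close>.\<close>

lemma chord_not_parallel_ray:
  assumes "chord P Q" "y \<in> cone P Q" "0 < chord_form P Q y"
  shows "\<not> (\<exists>c. Q - P = c *\<^sub>R (y - z))"
proof
  assume "\<exists>c. Q - P = c *\<^sub>R (y - z)"
  then obtain c where c: "Q - P = c *\<^sub>R (y - z)" by blast
  have hl: "height Q - height P = c * height y" "lateral Q - lateral P = c * lateral y"
    using arg_cong[OF c, of "\<lambda>v. v \<bullet> u"] arg_cong[OF c, of "\<lambda>v. v \<bullet> rotate_clockwise u"]
    by (simp_all add: height_def lateral_def inner_diff_left)
  have "chord_form P Q Q - chord_form P Q P = c * chord_form P Q y"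
  proof -
    have "chord_form P Q Q - chord_form P Q P =
      height P * ((lateral Q - lateral P) - slope P * (height Q - height P)) + height Q * (slope Q * (height Q - height P) - (lateral Q - lateral P))"
      by (simp add: chord_form_def algebra_simps)
    also have "\<dots> = c * chord_form P Q y" unfolding hl by (simp add: chord_form_def algebra_simps)
    finally show ?thesis .
  qed
  moreover have "chord_form P Q Q = chord_const P Q" "chord_form P Q P = chord_const P Q"
    using chord_segment_combination(1)[OF assms(1), of Q 1] chord_segment_combination(1)[OF assms(1), of P 0] by simp_all
  ultimately have "c = 0" using assms(3) by simp
  with c chord_distinct[OF assms(1)] show False by simp
qed

text \<open>Allows countably many rays to be discarded, such as those through chord ends or boundary
  points of the curve.\<close>

lemma negligible_slope: "negligible {y. 0 < height y \<and> slope y = c}"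
proof -
  have sub: "{y. 0 < height y \<and> slope y = c} \<subseteq> {y. (rotate_clockwise u - c *\<^sub>R u) \<bullet> y = (rotate_clockwise u - c *\<^sub>R u) \<bullet> z}"
  proof clarify
    fix y assume "0 < height y" "c = slope y"
    then have "lateral y - slope y * height y = 0" by (simp add: lateral_slope)
    then show "(rotate_clockwise u - slope y *\<^sub>R u) \<bullet> y = (rotate_clockwise u - slope y *\<^sub>R u) \<bullet> z"
      by (simp add: lateral_def height_def inner_simps inner_commute algebra_simps)
  qed
  have "rotate_clockwise u - c *\<^sub>R u \<noteq> 0"
  proof
    assume "rotate_clockwise u - c *\<^sub>R u = 0"
    then have r: "rotate_clockwise u = c *\<^sub>R u" by simp
    have "u \<noteq> 0" using unit by auto
    with arg_cong[OF r, of "\<lambda>v. v \<bullet> u"] have "c = 0" by simp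
    with r decomp[of u] decomp[of "rotate_clockwise u"] have "rotate_clockwise u = 0" by simp
    then have "u $ 1 = 0" "u $ 2 = 0" by (auto simp: rotate_clockwise_def vec_eq_iff forall_2)
    then have "u = 0" by (simp add: vec_eq_iff forall_2)
    with unit show False by simp
  qed
  then show ?thesis by (intro negligible_subset[OF negligible_hyperplane sub]) simp
qed

end

section \<open>Polygons of chords with disjoint slope ranges\<close>

locale chord_family = half_plane +
  fixes I :: "nat set" and P Q :: "nat \<Rightarrow> real^2"
  assumes chords: "i \<in> I \<Longrightarrow> chord (P i) (Q i)"
    and slopes_disjoint: "i \<in> I \<Longrightarrow> j \<in> I \<Longrightarrow> i \<noteq> j \<Longrightarrow>
      {slope (P i)..slope (Q i)} \<inter> {slope (P j)..slope (Q j)} = {}"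
begin

abbreviation polygon :: "(real^2) set"
  where "polygon \<equiv> (\<Union>i\<in>I. closed_segment (P i) (Q i))"

lemma polygon_height: "p \<in> polygon \<Longrightarrow> 0 < height p"
  using closed_chord_bounds(3) chords by blast

lemma z_notin_polygon: "z \<notin> polygon"
  using polygon_height[of z] by auto

text \<open>The closed slope ranges are disjoint, so the slope of a point of the polygon determines
  its chord, endpoints included; no ray meets two chords.\<close>

lemma polygon_slope:
  assumes "p \<in> polygon" "i \<in> I" "slope (P i) \<le> slope p" "slope p \<le> slope (Q i)"
  shows "p \<in> closed_segment (P i) (Q i)"
proof -
  obtain j where j: "j \<in> I" "p \<in> closed_segment (P j) (Q j)" using assms(1) by blast
  then have "slope p \<in> {slope (P j)..slope (Q j)}"
    using closed_chord_bounds(4,5)[OF chords[OF j(1)] j(2)] by simp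
  then have "i = j" using assms slopes_disjoint[OF assms(2) j(1)] by fastforce
  then show ?thesis using j by simp
qed

lemma polygon_Int_cone:
  assumes "i \<in> I"
  shows "polygon \<inter> cone (P i) (Q i) = open_segment (P i) (Q i)"
proof -
  have "polygon \<inter> cone (P i) (Q i) = closed_segment (P i) (Q i) \<inter> cone (P i) (Q i)"
  proof -
    have "x \<in> closed_segment (P i) (Q i)" if x: "x \<in> polygon" "x \<in> cone (P i) (Q i)" for x
    proof -
      have "slope (P i) < slope x" "slope x < slope (Q i)"
        using x(2) polygon_height[OF x(1)] by (simp_all add: cone_iff_slope)
      then show ?thesis using x assms by (intro polygon_slope) auto
    qed
    then show ?thesis using assms by blast
  qed
  then show ?thesis using closed_chord_Int_cone[OF chords[OF assms]] by simp
qed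

lemma polygon_Int_ray:
  assumes "i \<in> I" "y \<in> cone (P i) (Q i)"
  shows "polygon \<inter> open_segment z y = closed_segment (P i) (Q i) \<inter> open_segment z y"
proof -
  have hy: "0 < height y" using cone_height_pos chords assms by blast
  have "slope (P i) < slope p \<and> slope p < slope (Q i)" if "p \<in> open_segment z y" for p
    using ray_point_slope[OF that hy] assms(2) hy by (simp add: cone_iff_slope)
  then show ?thesis using polygon_slope[OF _ assms(1)] assms(1) by (fastforce intro: less_imp_le)
qed

text \<open>A ray into a shadow crosses its own chord exactly once and no other; inside the cone the
  polygon is that open chord, which supplies the tangent for transversality.\<close>

lemma shadow_subset_odd_front:
  assumes "i \<in> I"
  shows "shadow (P i) (Q i) \<subseteq> odd_front z u polygon"
proof
  fix y assume y: "y \<in> shadow (P i) (Q i)"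
  note ch = chords[OF assms]
  have cone: "y \<in> cone (P i) (Q i)" using y by (simp add: shadow_def)
  have hy: "0 < height y" using cone_height_pos ch cone by blast
  have form: "0 < chord_form (P i) (Q i) y" using y chord_const_pos[OF ch] by (simp add: shadow_def)
  have "card (polygon \<inter> open_segment z y) = 1"
    unfolding polygon_Int_ray[OF assms cone] chord_Int_ray[OF ch cone] using y by simp
  moreover have "transversal z y polygon"
    unfolding transversal_def
  proof
    fix p assume p: "p \<in> open_segment z y \<inter> polygon"
    have "p \<in> cone (P i) (Q i)"
      using p ray_point_slope[of p y] hy cone by (simp add: cone_iff_slope)
    then have "p \<in> open_segment (P i) (Q i)" using polygon_Int_cone[OF assms] p by blast
    then have "tangent_vector polygon p (Q i - P i)"
      by (intro tangent_vector_chord ch polygon_Int_cone assms)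
    with chord_not_parallel_ray[OF ch cone form]
    show "\<exists>v. tangent_vector polygon p v \<and> \<not> (\<exists>c. v = c *\<^sub>R (y - z))" by blast
  qed
  ultimately show "y \<in> odd_front z u polygon" using hy by (simp add: odd_front_def odd_crossings_def height_def)
qed

text \<open>Odd parity forces a crossing with some chord. If the ray runs inside the open cone of
  this chord, then \<open>y\<close> is in its shadow; the parity on rays through chord ends is left
  open.\<close>

lemma odd_front_subset_shadows:
  "odd_front z u polygon - (\<Union>i\<in>I. shadow (P i) (Q i)) \<subseteq>
    (\<Union>i\<in>I. {y. 0 < height y \<and> slope y = slope (P i)} \<union> {y. 0 < height y \<and> slope y = slope (Q i)})"
proof
  fix y assume y: "y \<in> odd_front z u polygon - (\<Union>i\<in>I. shadow (P i) (Q i))"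
  then have hy: "0 < height y" and odd: "odd (card (polygon \<inter> open_segment z y))"
    by (auto simp: odd_front_def odd_crossings_def height_def)
  then have "polygon \<inter> open_segment z y \<noteq> {}" by (metis card.empty even_zero)
  then obtain p where p: "p \<in> open_segment z y" "p \<in> polygon" by blast
  then obtain i where i: "i \<in> I" "p \<in> closed_segment (P i) (Q i)" by blast
  have s: "slope (P i) \<le> slope y" "slope y \<le> slope (Q i)"
    using closed_chord_bounds(4,5)[OF chords[OF i(1)] i(2)] ray_point_slope[OF p(1) hy] by auto
  have "y \<notin> cone (P i) (Q i)"
  proof
    assume c: "y \<in> cone (P i) (Q i)"
    have "y \<notin> shadow (P i) (Q i)" using y i by blast
    then have "closed_segment (P i) (Q i) \<inter> open_segment z y = {}"
      using chord_Int_ray[OF chords[OF i(1)] c] by simp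
    with i p show False by blast
  qed
  then have "slope y = slope (P i) \<or> slope y = slope (Q i)" using s hy by (auto simp: cone_iff_slope)
  with hy i show "y \<in> (\<Union>i\<in>I. {y. 0 < height y \<and> slope y = slope (P i)} \<union> {y. 0 < height y \<and> slope y = slope (Q i)})"
    by blast
qed

text \<open>The polygon has positive height throughout, so its curvature is a single mass rather
  than a difference.\<close>

lemma odd_front_back: "odd_front z (- u) polygon = {}"
proof (rule ccontr)
  assume "odd_front z (- u) polygon \<noteq> {}"
  then obtain y where y: "height y < 0" "odd (card (polygon \<inter> open_segment z y))"
    by (auto simp: odd_front_def odd_crossings_def height_def)
  then have "polygon \<inter> open_segment z y \<noteq> {}" by (metis card.empty even_zero)
  then obtain p where p: "p \<in> open_segment z y" "p \<in> polygon" by blast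
  obtain l where "0 < l" "height p = l * height y" using ray_point[OF p(1)] by metis
  then have "height p < 0" using y by (simp add: mult_pos_neg)
  with polygon_height[OF p(2)] show False by simp
qed

lemma shadows_in_lebesgue: "(\<Union>i\<in>I. shadow (P i) (Q i)) \<in> sets lebesgue"
  using open_shadow by (auto intro!: borel_open)

text \<open>The shadows are open, and completeness of Lebesgue measure makes the negligible rest
  measurable as well.\<close>

lemma
  shows odd_front_polygon_measurable: "odd_front z u polygon \<in> sets lebesgue"
    and emeasure_odd_front_polygon: "emeasure (kernel_measure \<sigma> z) (odd_front z u polygon) =
      emeasure (kernel_measure \<sigma> z) (\<Union>i\<in>I. shadow (P i) (Q i))"
proof -
  let ?S = "\<Union>i\<in>I. shadow (P i) (Q i)" and ?O = "odd_front z u polygon"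
  have "negligible (\<Union>i\<in>I. {y. 0 < height y \<and> slope y = slope (P i)} \<union> {y. 0 < height y \<and> slope y = slope (Q i)})"
  proof (rule negligible_countable_Union)
    show "countable ((\<lambda>i. {y. 0 < height y \<and> slope y = slope (P i)} \<union> {y. 0 < height y \<and> slope y = slope (Q i)}) ` I)"
      by (intro countable_image countableI_type)
  qed (elim imageE, simp only:, intro negligible_Un negligible_slope)
  then have neg: "negligible (?O - ?S)" using odd_front_subset_shadows by (rule negligible_subset)
  have eq: "?O = ?S \<union> (?O - ?S)" using shadow_subset_odd_front by blast
  have "?O - ?S \<in> sets lebesgue" using neg by (simp add: negligible_iff_null_sets null_setsD2)
  with shadows_in_lebesgue have "?S \<union> (?O - ?S) \<in> sets lebesgue" by (rule sets.Un)
  then show "?O \<in> sets lebesgue" by (rule back_subst[of "\<lambda>X. X \<in> sets lebesgue", OF _ eq[symmetric]])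
  have "emeasure (kernel_measure \<sigma> z) (?S \<union> (?O - ?S)) = emeasure (kernel_measure \<sigma> z) ?S"
    using shadows_in_lebesgue kernel_null_set[OF neg] by (intro emeasure_Un_null_set) auto
  then show "emeasure (kernel_measure \<sigma> z) ?O = emeasure (kernel_measure \<sigma> z) ?S"
    by (rule back_subst[of "\<lambda>X. emeasure (kernel_measure \<sigma> z) X = emeasure (kernel_measure \<sigma> z) ?S", OF _ eq[symmetric]])
qed

end

section \<open>Chords inscribed in the curve\<close>

definition boundary_points :: "(real^2) set \<Rightarrow> (real^2) set"
  where "boundary_points C = {p \<in> C. \<not> (\<exists>T g g' t. C1_chart_at C p T g g' \<and> t \<in> interior T \<and> g t = p)}"

lemma finite_interval_diff_interior:
  assumes "is_interval (T :: real set)"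
  shows "finite (T - interior T)"
proof (rule finite_subset)
  show "T - interior T \<subseteq> {Inf T, Sup T}"
  proof
    fix x assume x: "x \<in> T - interior T"
    have "(\<forall>y\<in>T. x \<le> y) \<or> (\<forall>y\<in>T. y \<le> x)"
    proof (rule ccontr)
      assume "\<not> ((\<forall>y\<in>T. x \<le> y) \<or> (\<forall>y\<in>T. y \<le> x))"
      then obtain a b where ab: "a \<in> T" "a < x" "b \<in> T" "x < b" by (auto simp: not_le)
      have "{a<..<b} \<subseteq> T"
      proof
        fix y assume "y \<in> {a<..<b}"
        then have "a \<le> y" "y \<le> b" by auto
        with assms ab show "y \<in> T" unfolding is_interval_1 by blast
      qed
      then have "x \<in> interior T" using ab by (intro interiorI[of "{a<..<b}"]) auto
      with x show False by simp
    qed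
    then show "x \<in> {Inf T, Sup T}"
      using x cInf_eq_minimum[of x T] cSup_eq_maximum[of x T] by auto
  qed
qed simp

text \<open>In a chart only endpoint parameters can give boundary points, so each point of
  \<open>C\<close> has a neighbourhood with finitely many of them; Lindelof leaves countably many
  neighbourhoods.\<close>

lemma countable_boundary_points:
  assumes "\<And>p. p \<in> C \<Longrightarrow> \<exists>T g g'. C1_chart_at C p T g g'"
  shows "countable (boundary_points C)"
proof -
  let ?B = "boundary_points C"
  define F where "F = {U. open U \<and> finite (?B \<inter> U)}"
  have BF: "?B \<subseteq> \<Union>F"
  proof
    fix p assume "p \<in> ?B"
    then have "p \<in> C" by (simp add: boundary_points_def)
    from assms[OF this] obtain T g g' where ch: "C1_chart_at C p T g g'" by blast
    then obtain U h where U: "open U" "p \<in> U" "homeomorphism T (C \<inter> U) g h" and T: "is_interval T"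
      unfolding C1_chart_at_def by blast
    have "?B \<inter> U \<subseteq> g ` (T - interior T)"
    proof
      fix q assume q: "q \<in> ?B \<inter> U"
      then have "q \<in> g ` T" using U(3) by (auto simp: homeomorphism_def boundary_points_def)
      then obtain t where t: "t \<in> T" "g t = q" by blast
      have "C1_chart_at C q T g g'" using C1_chart_at_other[OF ch U(3,1) t(1)] t(2) by simp
      then have "t \<notin> interior T" using q t unfolding boundary_points_def by blast
      with t show "q \<in> g ` (T - interior T)" by blast
    qed
    then have "finite (?B \<inter> U)"
      using finite_interval_diff_interior[OF T] by (meson finite_imageI finite_subset)
    with U show "p \<in> \<Union>F" by (auto simp: F_def)
  qed
  obtain F' where F': "F' \<subseteq> F" "countable F'" "\<Union>F' = \<Union>F"
    by (rule Lindelof[of F]) (auto simp: F_def)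
  have "?B = ?B \<inter> \<Union>F'" using BF F'(3) by (simp only: Int_absorb2)
  then have "?B = (\<Union>U\<in>F'. ?B \<inter> U)" by (simp only: Int_Union)
  moreover have "countable (\<Union>U\<in>F'. ?B \<inter> U)"
  proof (rule countable_UN)
    fix U assume "U \<in> F'"
    then have "U \<in> F" using F'(1) by (rule set_rev_mp)
    then show "countable (?B \<inter> U)" unfolding F_def by (intro countable_finite) blast
  qed (rule F'(2))
  ultimately show ?thesis by (simp only:)
qed

context half_plane
begin

text \<open>Segments are compared as sets, since the subcurve may run from \<open>Q\<close> to
  \<open>P\<close>. Its confinement to the slope range of the chord makes subcurves over disjoint
  ranges disjoint.\<close>

definition inscribed :: "(real^2) set \<Rightarrow> real^2 \<Rightarrow> real^2 \<Rightarrow> bool"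
  where "inscribed C P Q \<longleftrightarrow> (\<exists>g \<alpha> \<beta>. subcurve_param C g \<alpha> \<beta> \<and>
    g ` {\<alpha>..\<beta>} \<subseteq> {y. 0 < height y \<and> slope P \<le> slope y \<and> slope y \<le> slope Q} \<and>
    closed_segment (g \<alpha>) (g \<beta>) = closed_segment P Q)"

lemma negligible_rays_through_boundary:
  assumes "\<And>p. p \<in> C \<Longrightarrow> \<exists>T g g'. C1_chart_at C p T g g'"
  shows "negligible {y. 0 < height y \<and> open_segment z y \<inter> boundary_points C \<noteq> {}}"
proof (rule negligible_subset)
  show "negligible (\<Union>p\<in>boundary_points C. {y. 0 < height y \<and> slope y = slope p})"
  proof (rule negligible_countable_Union)
    show "countable ((\<lambda>p. {y. 0 < height y \<and> slope y = slope p}) ` boundary_points C)"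
      using countable_boundary_points[OF assms] by (rule countable_image)
  qed (elim imageE, simp only:, rule negligible_slope)
  show "{y. 0 < height y \<and> open_segment z y \<inter> boundary_points C \<noteq> {}} \<subseteq>
    (\<Union>p\<in>boundary_points C. {y. 0 < height y \<and> slope y = slope p})"
  proof
    fix y assume "y \<in> {y. 0 < height y \<and> open_segment z y \<inter> boundary_points C \<noteq> {}}"
    then obtain p where p: "0 < height y" "p \<in> open_segment z y" "p \<in> boundary_points C" by blast
    then have "slope y = slope p" using ray_point_slope(1)[of p y] by simp
    with p show "y \<in> (\<Union>p\<in>boundary_points C. {y. 0 < height y \<and> slope y = slope p})" by blast
  qed
qed

text \<open>The lower bound on the height keeps the slab off a ball around \<open>z\<close>, so its
  mass is finite; continuity from above then applies to slabs shrinking to a ray, which is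
  null.\<close>

lemma slab_measure_small:
  assumes "0 < \<sigma>" "0 < m" "0 < \<eta>"
  shows "\<exists>d>0. emeasure (kernel_measure \<sigma> z) {y. m \<le> height y \<and> \<bar>slope y - c\<bar> \<le> d} < \<eta>"
proof -
  let ?M = "kernel_measure \<sigma> z"
  define A where "A n = {y. m \<le> height y \<and> \<bar>slope y - c\<bar> \<le> 1 / real (Suc n)}" for n
  have eq: "A n = {y. m \<le> height y} \<inter> {y. \<bar>lateral y - c * height y\<bar> \<le> height y * (1 / real (Suc n))}" for n
  proof -
    have "\<bar>slope y - c\<bar> \<le> 1 / real (Suc n) \<longleftrightarrow> \<bar>lateral y - c * height y\<bar> \<le> height y * (1 / real (Suc n))"
      if "0 < height y" for y
    proof -
      have "lateral y - c * height y = height y * (slope y - c)"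
        using that by (simp add: lateral_slope algebra_simps)
      then have "\<bar>lateral y - c * height y\<bar> = height y * \<bar>slope y - c\<bar>" using that by (simp add: abs_mult)
      then show ?thesis using that mult_le_cancel_left_pos[of "height y"] by metis
    qed
    then show ?thesis using assms(2) by (force simp: A_def)
  qed
  have "closed {y. m \<le> height y}" by (intro closed_Collect_le continuous_intros)
  moreover have "closed {y. \<bar>lateral y - c * height y\<bar> \<le> height y * (1 / real (Suc n))}" for n
    by (intro closed_Collect_le continuous_intros)
  ultimately have "closed (A n)" for n unfolding eq by (rule closed_Int)
  then have meas: "A n \<in> sets lebesgue" for n by (simp add: borel_closed)
  have sub: "A n \<subseteq> - ball z m" for n
  proof
    fix y assume "y \<in> A n"
    then have "m \<le> height y" by (simp add: A_def)
    with height_le_norm[of y] have "m \<le> norm (y - z)" by linarith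
    then show "y \<in> - ball z m" by (simp add: dist_norm norm_minus_commute)
  qed
  have fin: "emeasure ?M (A n) \<noteq> \<infinity>" for n
    using emeasure_mono[OF sub[of n], of ?M] kernel_measure_off_ball[OF assms(1,2), of z]
    by (auto simp: Compl_in_sets_lebesgue dest: le_less_trans)
  have "decseq A"
  proof (rule decseq_SucI)
    fix n
    have "1 / real (Suc (Suc n)) \<le> 1 / real (Suc n)" by (simp add: field_simps)
    then show "A (Suc n) \<subseteq> A n" unfolding A_def by auto
  qed
  then have lim: "(\<lambda>n. emeasure ?M (A n)) \<longlonglongrightarrow> emeasure ?M (\<Inter>n. A n)"
    using meas fin by (intro Lim_emeasure_decseq) auto
  have "(\<Inter>n. A n) \<subseteq> {y. 0 < height y \<and> slope y = c}"
  proof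
    fix y assume y: "y \<in> (\<Inter>n. A n)"
    then have "m \<le> height y" by (auto simp: A_def)
    moreover have "slope y = c"
    proof (rule ccontr)
      assume "slope y \<noteq> c"
      then have "0 < \<bar>slope y - c\<bar>" by simp
      then obtain n where "1 / real (Suc n) < \<bar>slope y - c\<bar>" by (rule nat_approx_posE)
      moreover have "y \<in> A n" using y by blast
      ultimately show False by (simp add: A_def)
    qed
    ultimately show "y \<in> {y. 0 < height y \<and> slope y = c}" using assms(2) by simp
  qed
  then have "emeasure ?M (\<Inter>n. A n) = 0"
    using kernel_null_set[OF negligible_subset[OF negligible_slope]] by (blast dest: null_setsD1)
  with lim assms(3) have "\<forall>\<^sub>F n in sequentially. emeasure ?M (A n) < \<eta>"
    by (intro order_tendstoD(2)) auto
  then obtain n where "emeasure ?M (A n) < \<eta>" using eventually_happens by force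
  then show ?thesis by (intro exI[of _ "1 / real (Suc n)"]) (simp add: A_def)
qed

lemma shadow_height:
  assumes "chord P Q" "y \<in> shadow P Q"
  shows "min (height P) (height Q) \<le> height y" "slope P < slope y" "slope y < slope Q"
proof -
  have cone: "y \<in> cone P Q" using assms by (simp add: shadow_def)
  have hy: "0 < height y" using cone_height_pos assms(1) cone by blast
  obtain p where p: "p \<in> closed_segment P Q" "p \<in> open_segment z y"
    using chord_Int_ray[OF assms(1) cone] assms(2) by auto
  show "min (height P) (height Q) \<le> height y"
    using closed_chord_bounds(1)[OF assms(1) p(1)] ray_point_slope(3)[OF p(2) hy] by linarith
  show "slope P < slope y" "slope y < slope Q" using cone hy by (auto simp: cone_iff_slope)
qed

text \<open>The ray through \<open>y\<close> meets the chord at a height not above the higher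
  endpoint, hence before it reaches \<open>y\<close>.\<close>

lemma high_in_shadow:
  assumes "chord P Q" "y \<in> cone P Q" "max (height P) (height Q) < height y"
  shows "y \<in> shadow P Q"
proof -
  note c = chord_const_pos[OF assms(1)]
  have f: "0 < chord_form P Q y"
    unfolding chord_form_def using assms(1,2) by (auto simp: chord_def cone_def intro!: add_pos_pos)
  define l where "l = chord_const P Q / chord_form P Q y"
  have l: "0 < l" "l * chord_form P Q y = chord_const P Q" using f c by (auto simp: l_def)
  define p where "p = (1 - l) *\<^sub>R z + l *\<^sub>R y"
  have hp: "height p = l * height y" "lateral p = l * lateral y"
    unfolding p_def height_combination lateral_combination by simp_all
  have "chord_form P Q p = l * chord_form P Q y" unfolding chord_form_def hp by (simp add: algebra_simps)
  moreover have "p \<in> cone P Q"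
  proof -
    have "l * (slope P * height y) < l * lateral y" "l * lateral y < l * (slope Q * height y)"
      using assms(2) l by (auto simp: cone_def)
    then show ?thesis by (simp add: cone_def hp algebra_simps)
  qed
  ultimately have "p \<in> open_segment P Q" using l by (simp add: mem_open_chord_iff[OF assms(1)])
  then have "height p \<le> max (height P) (height Q)"
    by (intro closed_chord_bounds(2)[OF assms(1)]) (auto simp: open_segment_def)
  with assms(3) hp have "l * height y < 1 * height y" by linarith
  then have "l < 1" using cone_height_pos[OF assms(1,2)] by (simp only: mult_less_cancel_right_pos)
  then show ?thesis using assms(2) f by (simp add: shadow_def l_def)
qed

text \<open>Odd parity supplies a crossing below \<open>y\<close>, and the absence of boundary
  points a chart that runs through it on both sides. By transversality the slope is strictly
  monotone along this arc, so it attains all slopes near that of \<open>y\<close>; a narrow slope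
  window makes the shadow small.\<close>

lemma local_inscribed_chords:
  assumes "0 < \<sigma>" "0 < \<eta>" and y: "y \<in> odd_front z u C" "open_segment z y \<inter> boundary_points C = {}"
  shows "\<exists>\<delta>>0. \<forall>a b. slope y - \<delta> < a \<longrightarrow> a < b \<longrightarrow> b < slope y + \<delta> \<longrightarrow>
    (\<exists>P Q. chord P Q \<and> slope P = a \<and> slope Q = b \<and> height P < height y - \<delta> \<and> height Q < height y - \<delta> \<and>
      inscribed C P Q \<and> emeasure (kernel_measure \<sigma> z) (shadow P Q) < \<eta>)"
proof -
  let ?e = "rotate_clockwise u"
  have hy: "0 < height y" and odd: "odd (card (C \<inter> open_segment z y))" and tr: "transversal z y C"
    using y(1) by (auto simp: odd_front_def odd_crossings_def height_def)
  \<comment> \<open>An empty intersection would have the even cardinality 0.\<close>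
  have "C \<inter> open_segment z y \<noteq> {}" using odd by (metis card.empty even_zero)
  then obtain q where q: "q \<in> C" "q \<in> open_segment z y" by blast
  then obtain v where v: "tangent_vector C q v" "\<not> (\<exists>c. v = c *\<^sub>R (y - z))"
    using tr unfolding transversal_def by blast
  have "q \<notin> boundary_points C" using q(2) y(2) by blast
  then obtain T g g' t where ch: "C1_chart_at C q T g g'" and t: "t \<in> interior T" "g t = q"
    using q(1) unfolding boundary_points_def by blast
  have tT: "t \<in> T" using t interior_subset by blast
  have v': "tangent_vector C q (g' t)" using ch tT t unfolding tangent_vector_def by blast
  obtain U h where U: "homeomorphism T (C \<inter> U) g h" and reg: "C1_regular_on g g' T"
    using ch unfolding C1_chart_at_def by blast
  \<comment> \<open>\<open>w\<close> is orthogonal to \<open>y - z\<close>, so its product with a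
    vector vanishes exactly for multiples of \<open>y - z\<close>.\<close>
  define w where "w = height y *\<^sub>R ?e - lateral y *\<^sub>R u"
  have "w \<bullet> v \<noteq> 0"
  proof
    assume "w \<bullet> v = 0"
    then have eq: "height y * (v \<bullet> ?e) = lateral y * (v \<bullet> u)" by (simp add: w_def inner_diff_left inner_diff_right inner_commute)
    have "v = ((v \<bullet> u) / height y) *\<^sub>R (lateral y *\<^sub>R ?e + height y *\<^sub>R u)"
    proof -
      have "((v \<bullet> u) / height y) * lateral y = v \<bullet> ?e" using eq hy by (simp add: field_simps)
      then have "((v \<bullet> u) / height y) *\<^sub>R (lateral y *\<^sub>R ?e + height y *\<^sub>R u) = (v \<bullet> ?e) *\<^sub>R ?e + (v \<bullet> u) *\<^sub>R u"
        using hy by (simp add: scaleR_add_right)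
      then show ?thesis using decomp[of v] by simp
    qed
    also have "lateral y *\<^sub>R ?e + height y *\<^sub>R u = y - z"
      unfolding lateral_def height_def by (rule decomp[symmetric])
    finally show False using v(2) by blast
  qed
  \<comment> \<open>Transversality provides a tangent vector from some chart; uniqueness of the
    tangent line carries it over to the chart in which \<open>t\<close> is interior.\<close>
  then have wv': "w \<bullet> g' t \<noteq> 0" using tangent_normal_unique[OF v' v(1)] by blast
  obtain l where l: "0 < l" "l < 1" "height q = l * height y" "lateral q = l * lateral y"
    using ray_point[OF q(2)] by metis
  have hq: "0 < height q" "height q < height y" "slope q = slope y" using ray_point_slope[OF q(2) hy] by auto
  \<comment> \<open>The numerator in the quotient rule for the slope of \<open>g r\<close>.\<close>
  define k where "k = (\<lambda>r. height (g r) * (g' r \<bullet> ?e) - lateral (g r) * (g' r \<bullet> u))"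
  have gc: "continuous_on T g" using U by (simp add: homeomorphism_def)
  have g'c: "continuous_on T g'" using reg by (simp add: C1_regular_on_def)
  have kc: "continuous_on T k" unfolding k_def by (intro continuous_intros gc g'c)
  have hc: "continuous_on T (\<lambda>r. height (g r))" by (intro continuous_intros gc)
  have kt: "k t \<noteq> 0"
  proof -
    have "k t = l * (w \<bullet> g' t)" by (simp add: k_def t l w_def inner_diff_left inner_commute algebra_simps)
    then show ?thesis using wv' l by simp
  qed
  have "isCont k t" "isCont (\<lambda>r. height (g r)) t"
    using continuous_on_interior[OF kc t(1)] continuous_on_interior[OF hc t(1)] by auto
  then have kn: "(k \<longlongrightarrow> k t) (nhds t)" and hn: "((\<lambda>r. height (g r)) \<longlongrightarrow> height q) (nhds t)"
    using tendsto_at_iff_tendsto_nhds[of k t] tendsto_at_iff_tendsto_nhds[of "\<lambda>r. height (g r)" t] t(2)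
    by (simp_all add: isCont_def)
  \<comment> \<open>\<open>m\<close> keeps the arc away from height 0, as
    \<open>slab_measure_small\<close> requires; \<open>M\<close> leaves a gap below
    \<open>y\<close>.\<close>
  define m M where "m = height q / 2" and "M = (height q + height y) / 2"
  have mM: "0 < m" "m < height q" "height q < M" "M < height y" using hq by (auto simp: m_def M_def)
  have "\<forall>\<^sub>F r in nhds t. k r \<noteq> 0" using tendsto_imp_eventually_ne[OF kn kt] .
  moreover have "\<forall>\<^sub>F r in nhds t. m < height (g r)" "\<forall>\<^sub>F r in nhds t. height (g r) < M"
    using order_tendstoD[OF hn] mM by auto
  moreover have "\<forall>\<^sub>F r in nhds t. r \<in> interior T" using t(1) by (intro eventually_nhds_in_open) auto
  ultimately have "\<forall>\<^sub>F r in nhds t. k r \<noteq> 0 \<and> m < height (g r) \<and> height (g r) < M \<and> r \<in> T"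
    by eventually_elim (use interior_subset in blast)
  then obtain d where d: "0 < d" "\<And>r. dist r t < d \<Longrightarrow> k r \<noteq> 0 \<and> m < height (g r) \<and> height (g r) < M \<and> r \<in> T"
    unfolding eventually_nhds_metric by blast
  define A B where "A = t - d / 2" and "B = t + d / 2"
  have AB: "A < t" "t < B" using d by (auto simp: A_def B_def)
  have I: "k r \<noteq> 0" "m < height (g r)" "height (g r) < M" "r \<in> T" if "r \<in> {A..B}" for r
    using d(2)[of r] that d(1) by (auto simp: A_def B_def dist_real_def abs_le_iff abs_less_iff)
  have IT: "{A..B} \<subseteq> T" using I by blast
  define f where "f = (\<lambda>r. slope (g r))"
  have der: "(f has_real_derivative k r / (height (g r))\<^sup>2) (at r within {A..B})" if "r \<in> {A..B}" for r
  proof -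
    have gd: "(g has_vector_derivative g' r) (at r within {A..B})"
      using reg I(4)[OF that] IT by (meson C1_regular_on_def has_vector_derivative_within_subset)
    have gz: "((\<lambda>r. g r - z) has_vector_derivative g' r) (at r within {A..B})"
      using has_vector_derivative_diff[OF gd has_vector_derivative_const[of z]] by simp
    have 1: "((\<lambda>r. lateral (g r)) has_real_derivative g' r \<bullet> ?e) (at r within {A..B})"
      unfolding lateral_def has_real_derivative_iff_has_vector_derivative
      using bounded_linear.has_vector_derivative[OF bounded_linear_inner_left gz] .
    have 2: "((\<lambda>r. height (g r)) has_real_derivative g' r \<bullet> u) (at r within {A..B})"
      unfolding height_def has_real_derivative_iff_has_vector_derivative
      using bounded_linear.has_vector_derivative[OF bounded_linear_inner_left gz] .
    have "height (g r) \<noteq> 0" using I(2)[OF that] mM by simp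
    from DERIV_divide[OF 1 2 this]
    show ?thesis by (simp add: f_def slope_def k_def power2_eq_square algebra_simps)
  qed
  have fc: "continuous_on {A..B} f" by (rule DERIV_continuous_on[OF der])
  \<comment> \<open>The derivative has no zero, so the mean value theorem makes \<open>f\<close>
    injective; with continuity it is strictly monotone, increasing or decreasing.\<close>
  have neq: "f r \<noteq> f s" if "r \<in> {A..B}" "s \<in> {A..B}" "r < s" for r s
  proof
    assume "f r = f s"
    have sub: "{r..s} \<subseteq> {A..B}" using that by auto
    have "(f has_derivative (*) (k \<xi> / (height (g \<xi>))\<^sup>2)) (at \<xi> within {r..s})" if "r \<le> \<xi>" "\<xi> \<le> s" for \<xi>
    proof -
      have "\<xi> \<in> {A..B}" using that sub by auto
      from DERIV_subset[OF der[OF this] sub] show ?thesis by (simp add: has_field_derivative_def)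
    qed
    from mvt_simple[OF \<open>r < s\<close> this] obtain \<xi> where \<xi>: "\<xi> \<in> {r<..<s}" "f s - f r = k \<xi> / (height (g \<xi>))\<^sup>2 * (s - r)"
      by blast
    then have "k \<xi> \<noteq> 0" "height (g \<xi>) \<noteq> 0" using I(1,2)[of \<xi>] sub mM by auto
    with \<xi> \<open>f r = f s\<close> \<open>r < s\<close> show False by simp
  qed
  have finj: "inj_on f {A..B}" using neq by (intro inj_onI) (metis linorder_neqE)
  have ft: "f t = slope y" using t hq by (simp add: f_def)
  have mono: "(f A < f t \<and> f t < f B) \<or> (f B < f t \<and> f t < f A)"
    using continuous_inj_imp_mono[OF AB fc finj] .
  define lo hi where "lo = min (f A) (f B)" and "hi = max (f A) (f B)"
  have lohi: "lo < slope y" "slope y < hi" using mono ft by (auto simp: lo_def hi_def)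
  have onto: "\<exists>r\<in>{A..B}. f r = x" if "lo < x" "x < hi" for x
  proof -
    have "connected (f ` {A..B})" using fc by (intro connected_continuous_image) auto
    then have iv: "is_interval (f ` {A..B})" by (simp add: is_interval_connected_1)
    have "lo \<in> f ` {A..B}" "hi \<in> f ` {A..B}" using AB by (auto simp: lo_def hi_def min_def max_def)
    then have "x \<in> f ` {A..B}" using iv that unfolding is_interval_1 by (meson less_imp_le)
    then show ?thesis by auto
  qed
  obtain d' where d': "0 < d'" "emeasure (kernel_measure \<sigma> z) {x. m \<le> height x \<and> \<bar>slope x - slope y\<bar> \<le> d'} < \<eta>"
    using slab_measure_small[OF assms(1) mM(1) assms(2)] by blast
  \<comment> \<open>The first two bounds keep the prescribed slopes in the range of
    \<open>f\<close>, the third keeps the shadow in the small slab, the last puts the chord ends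
    below \<open>height y - \<delta>\<close>.\<close>
  define \<delta> where "\<delta> = Min {slope y - lo, hi - slope y, d', height y - M}"
  have \<delta>: "0 < \<delta>" "\<delta> \<le> slope y - lo" "\<delta> \<le> hi - slope y" "\<delta> \<le> d'" "\<delta> \<le> height y - M"
    using lohi d' mM by (auto simp: \<delta>_def)
  show ?thesis
  proof (intro exI[of _ \<delta>] conjI allI impI)
    show "0 < \<delta>" by (rule \<delta>)
    fix a b assume ab: "slope y - \<delta> < a" "a < b" "b < slope y + \<delta>"
    obtain ra where ra: "ra \<in> {A..B}" "f ra = a" using onto[of a] ab \<delta> by force
    obtain rb where rb: "rb \<in> {A..B}" "f rb = b" using onto[of b] ab \<delta> by force
    \<comment> \<open>If the slope decreases along the arc, \<open>rb\<close> precedes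
      \<open>ra\<close>.\<close>
    define \<alpha> \<beta> where "\<alpha> = min ra rb" and "\<beta> = max ra rb"
    have "ra \<noteq> rb" using ra rb ab by auto
    then have \<alpha>\<beta>: "\<alpha> < \<beta>" "{\<alpha>..\<beta>} \<subseteq> {A..B}" using ra rb by (auto simp: \<alpha>_def \<beta>_def min_def max_def)
    have range: "a \<le> f r \<and> f r \<le> b" if r: "r \<in> {\<alpha>..\<beta>}" for r
    proof -
      have ends: "a \<le> f \<alpha> \<and> f \<alpha> \<le> b \<and> a \<le> f \<beta> \<and> f \<beta> \<le> b"
        using ra rb ab by (auto simp: \<alpha>_def \<beta>_def min_def max_def)
      consider "r = \<alpha>" | "r = \<beta>" | "\<alpha> < r" "r < \<beta>" using r by fastforce
      then show ?thesis
      proof cases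
        case 3
        have "(f \<alpha> < f r \<and> f r < f \<beta>) \<or> (f \<beta> < f r \<and> f r < f \<alpha>)"
          using 3 \<alpha>\<beta> continuous_on_subset[OF fc] inj_on_subset[OF finj] by (intro continuous_inj_imp_mono) auto
        then show ?thesis using ends by linarith
      qed (use ends in auto)
    qed
    have ginj: "inj_on g {\<alpha>..\<beta>}"
      using inj_on_subset[OF finj \<alpha>\<beta>(2)] by (auto simp: f_def inj_on_def)
    let ?P = "g ra" and ?Q = "g rb"
    have PQ: "slope ?P = a" "slope ?Q = b" using ra rb by (auto simp: f_def)
    have ch: "chord ?P ?Q" using PQ ab I(2)[OF ra(1)] I(2)[OF rb(1)] mM by (auto simp: chord_def)
    have "C1_regular_on g g' {\<alpha>..\<beta>}"
      using reg \<alpha>\<beta>(2) IT unfolding C1_regular_on_def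
      by (meson continuous_on_subset has_vector_derivative_within_subset subset_trans subsetD)
    moreover have "g ` {\<alpha>..\<beta>} \<subseteq> C"
    proof -
      have "g ` T \<subseteq> C" using U by (simp add: homeomorphism_def)
      then show ?thesis using image_mono[of "{\<alpha>..\<beta>}" T g] \<alpha>\<beta>(2) IT by blast
    qed
    ultimately have "subcurve_param C g \<alpha> \<beta>"
      unfolding subcurve_param_def using \<alpha>\<beta>(1) ginj by (auto intro: inj_on_subset)
    moreover have "g ` {\<alpha>..\<beta>} \<subseteq> {y. 0 < height y \<and> slope ?P \<le> slope y \<and> slope y \<le> slope ?Q}"
    proof (rule image_subsetI)
      fix r assume r: "r \<in> {\<alpha>..\<beta>}"
      then have "m < height (g r)" using I(2) \<alpha>\<beta>(2) by blast
      with range[OF r] mM show "g r \<in> {y. 0 < height y \<and> slope ?P \<le> slope y \<and> slope y \<le> slope ?Q}"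
        unfolding PQ f_def by simp
    qed
    moreover have "closed_segment (g \<alpha>) (g \<beta>) = closed_segment ?P ?Q"
      by (auto simp: \<alpha>_def \<beta>_def min_def max_def closed_segment_commute)
    ultimately have ins: "inscribed C ?P ?Q" unfolding inscribed_def by blast
    have "emeasure (kernel_measure \<sigma> z) (shadow ?P ?Q) \<le>
      emeasure (kernel_measure \<sigma> z) {x. m \<le> height x \<and> \<bar>slope x - slope y\<bar> \<le> d'}"
    proof (rule emeasure_mono)
      show "shadow ?P ?Q \<subseteq> {x. m \<le> height x \<and> \<bar>slope x - slope y\<bar> \<le> d'}"
      proof
        fix x assume "x \<in> shadow ?P ?Q"
        from shadow_height[OF ch this] show "x \<in> {x. m \<le> height x \<and> \<bar>slope x - slope y\<bar> \<le> d'}"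
          using PQ ab \<delta> I(2)[OF ra(1)] I(2)[OF rb(1)] by (auto simp: abs_le_iff)
      qed
      note [measurable] = slope_measurable
      have "{x. m \<le> height x \<and> \<bar>slope x - slope y\<bar> \<le> d'} =
        {x. m \<le> height x} \<inter> {x. \<bar>slope x - slope y\<bar> \<le> d'}" by auto
      moreover have "{x. \<bar>slope x - slope y\<bar> \<le> d'} \<in> sets borel" "{x. m \<le> height x} \<in> sets borel"
        unfolding height_def by measurable
      ultimately have "{x. m \<le> height x \<and> \<bar>slope x - slope y\<bar> \<le> d'} \<in> sets borel"
        by (simp only: sets.Int)
      then show "{x. m \<le> height x \<and> \<bar>slope x - slope y\<bar> \<le> d'} \<in> sets (kernel_measure \<sigma> z)"
        by simp
    qed
    with d' have small: "emeasure (kernel_measure \<sigma> z) (shadow ?P ?Q) < \<eta>" by simp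
    show "\<exists>P Q. chord P Q \<and> slope P = a \<and> slope Q = b \<and> height P < height y - \<delta> \<and> height Q < height y - \<delta> \<and>
      inscribed C P Q \<and> emeasure (kernel_measure \<sigma> z) (shadow P Q) < \<eta>"
      using ch PQ ins small I(3)[OF ra(1)] I(3)[OF rb(1)] \<delta>(5) by (intro exI[of _ ?P] exI[of _ ?Q]) auto
  qed
qed

end

section \<open>Shadowing compact sets\<close>

text \<open>Cutting off a ball around \<open>z\<close> and the far field leaves a bounded set of
  finite mass, on which the kernel is bounded; there inner regularity of Lebesgue measure carries
  over. The mass of \<open>X\<close> may be infinite.\<close>

lemma inner_compact_kernel_measure:
  assumes "0 < \<sigma>" "X \<in> sets lebesgue" "z \<notin> X" "c < emeasure (kernel_measure \<sigma> z) X"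
  shows "\<exists>K. compact K \<and> K \<subseteq> X \<and> c < emeasure (kernel_measure \<sigma> z) K"
proof -
  let ?M = "kernel_measure \<sigma> z"
  obtain \<epsilon> where \<epsilon>: "0 < \<epsilon>" "c < emeasure ?M (X - ball z \<epsilon>)"
  proof -
    have "\<forall>\<^sub>F \<epsilon> in at_right 0. c < emeasure ?M (X - ball z \<epsilon>)"
      using assms by (intro eventually_kernel_measure_gt)
    then obtain b where "0 < b" "\<And>\<epsilon>. 0 < \<epsilon> \<Longrightarrow> \<epsilon> < b \<Longrightarrow> c < emeasure ?M (X - ball z \<epsilon>)"
      by (auto simp: eventually_at_right_field)
    then show thesis using that[of "b / 2"] by simp
  qed
  define Y where "Y = X - ball z \<epsilon>"
  have Y: "Y \<in> sets lebesgue" "Y \<subseteq> X" "Y \<inter> ball z \<epsilon> = {}" using assms(2) by (auto simp: Y_def)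
  have cb: "cball z r \<in> sets lebesgue" for r by (simp add: borel_closed)
  have "(\<lambda>n. emeasure ?M (Y \<inter> cball z (real n))) \<longlonglongrightarrow> emeasure ?M (\<Union>n. Y \<inter> cball z (real n))"
    using Y(1) cb by (intro Lim_emeasure_incseq) (auto simp: incseq_def)
  moreover have "(\<Union>n. Y \<inter> cball z (real n)) = Y" by (auto intro: real_arch_simple)
  ultimately have "\<forall>\<^sub>F n in sequentially. c < emeasure ?M (Y \<inter> cball z (real n))"
    using \<epsilon>(2) unfolding Y_def[symmetric] by (intro order_tendstoD(1)) auto
  then obtain n where n: "c < emeasure ?M (Y \<inter> cball z (real n))" using eventually_happens by force
  define V where "V = Y \<inter> cball z (real n)"
  have V: "V \<in> sets lebesgue" "V \<subseteq> X" "V \<inter> ball z \<epsilon> = {}" "bounded V" "c < emeasure ?M V"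
    using Y cb n bounded_cball by (auto simp: V_def)
  have "emeasure ?M V \<le> emeasure ?M (- ball z \<epsilon>)"
    using V by (intro emeasure_mono) (auto simp: Compl_in_sets_lebesgue)
  also have "\<dots> < \<infinity>" using assms(1) \<epsilon>(1) by (rule kernel_measure_off_ball)
  finally have fin: "emeasure ?M V < \<infinity>" .
  obtain r where r: "emeasure ?M V = ennreal r" "0 \<le> r" using fin by (cases "emeasure ?M V") auto
  obtain s where s: "c = ennreal s" "0 \<le> s" using less_trans[OF V(5) fin] by (cases c) auto
  have sr: "s < r" using V(5) r s by (simp add: ennreal_less_iff)
  \<comment> \<open>The bound of the kernel off the ball: discarding Lebesgue measure below
    \<open>(r - s) / (2 * L)\<close> costs at most half of the surplus \<open>r - s\<close>.\<close>
  define L where "L = 1 / \<epsilon> powr (2 + \<sigma>)"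
  have L: "0 < L" using \<epsilon> by (simp add: L_def)
  obtain T where T: "closed T" "T \<subseteq> V" "V - T \<in> lmeasurable" "emeasure lebesgue (V - T) < ennreal ((r - s) / (2 * L))"
    using sets_lebesgue_inner_closed[OF V(1), of "(r - s) / (2 * L)"] sr L by auto
  have Tm: "T \<in> sets lebesgue" using T(1) by (simp add: borel_closed)
  have "compact T" using T V(4) bounded_subset compact_eq_bounded_closed by blast
  moreover have "c < emeasure ?M T"
  proof (rule ccontr)
    assume "\<not> c < emeasure ?M T"
    then have le: "emeasure ?M T \<le> ennreal s" using s by simp
    have "emeasure ?M (V - T) \<le> ennreal L * emeasure lebesgue (V - T)"
      unfolding L_def using V Tm \<epsilon> assms(1) by (intro kernel_measure_le) auto
    also have "\<dots> \<le> ennreal L * ennreal ((r - s) / (2 * L))" using T(4) by (intro mult_left_mono) auto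
    also have "\<dots> = ennreal ((r - s) / 2)" using L sr by (subst ennreal_mult[symmetric]) auto
    finally have le2: "emeasure ?M (V - T) \<le> ennreal ((r - s) / 2)" .
    have "ennreal r = emeasure ?M T + emeasure ?M (V - T)"
      unfolding r(1)[symmetric] using T(2) Tm V(1) by (subst plus_emeasure) (auto simp: Un_absorb1)
    also have "\<dots> \<le> ennreal s + ennreal ((r - s) / 2)" using le le2 by (rule add_mono)
    also have "\<dots> = ennreal (s + (r - s) / 2)" using sr s by (subst ennreal_plus) auto
    finally have "r \<le> s + (r - s) / 2" using sr s by (subst (asm) ennreal_le_iff) auto
    then show False using sr by (simp add: field_simps)
  qed
  ultimately show ?thesis using T(2) V(2) by blast
qed

text \<open>Greedy choice: terms are added until the sum first exceeds \<open>c\<close>, and the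
  last term overshoots by at most \<open>\<eta>\<close>.\<close>

lemma subset_sum_in_window:
  fixes w :: "'a \<Rightarrow> real"
  assumes "finite I" "\<And>i. i \<in> I \<Longrightarrow> w i \<le> \<eta>" "0 \<le> c" "c < sum w I"
  shows "\<exists>J\<subseteq>I. c < sum w J \<and> sum w J \<le> c + \<eta>"
  using assms
proof (induction I)
  case (insert i I)
  show ?case
  proof (cases "c < sum w I")
    case True
    then show ?thesis using insert by (metis insertCI subset_insertI2)
  next
    case False
    then show ?thesis using insert by (intro exI[of _ "insert i I"]) force
  qed
qed simp

context half_plane
begin

text \<open>The set \<open>G\<close> confines the slopes, so that families over disjoint sets of
  slopes can be merged into one.\<close>

definition inscribed_family :: "(real^2) set \<Rightarrow> real set \<Rightarrow> nat set \<Rightarrow> (nat \<Rightarrow> real^2) \<Rightarrow> (nat \<Rightarrow> real^2) \<Rightarrow> bool"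
  where "inscribed_family C G I P Q \<longleftrightarrow> chord_family z u I P Q \<and>
    (\<forall>i\<in>I. inscribed C (P i) (Q i) \<and> {slope (P i)..slope (Q i)} \<subseteq> G)"

lemma inscribed_family_subset:
  assumes "inscribed_family C G I P Q" "J \<subseteq> I"
  shows "inscribed_family C G J P Q"
proof -
  interpret chord_family z u I P Q using assms(1) by (simp add: inscribed_family_def)
  have "chord_family z u J P Q"
  proof
    show "chord (P i) (Q i)" if "i \<in> J" for i using chords that assms(2) by blast
    show "{slope (P i)..slope (Q i)} \<inter> {slope (P j)..slope (Q j)} = {}" if "i \<in> J" "j \<in> J" "i \<noteq> j" for i j
      using slopes_disjoint that assms(2) by blast
  qed
  then show ?thesis using assms by (auto simp: inscribed_family_def)
qed

lemma emeasure_shadows: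
  assumes "chord_family z u I P Q" "finite I"
  shows "emeasure (kernel_measure \<sigma> z) (\<Union>i\<in>I. shadow (P i) (Q i)) =
    (\<Sum>i\<in>I. emeasure (kernel_measure \<sigma> z) (shadow (P i) (Q i)))"
proof -
  interpret chord_family z u I P Q by (rule assms)
  have "disjoint_family_on (\<lambda>i. shadow (P i) (Q i)) I"
    unfolding disjoint_family_on_def
  proof (intro ballI impI)
    fix i j assume ij: "i \<in> I" "j \<in> I" "i \<noteq> j"
    show "shadow (P i) (Q i) \<inter> shadow (P j) (Q j) = {}"
    proof (rule ccontr)
      assume "shadow (P i) (Q i) \<inter> shadow (P j) (Q j) \<noteq> {}"
      then obtain y where y: "y \<in> shadow (P i) (Q i)" "y \<in> shadow (P j) (Q j)" by blast
      have "slope y \<in> {slope (P i)..slope (Q i)} \<inter> {slope (P j)..slope (Q j)}"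
        using shadow_height(2,3)[OF chords[OF ij(1)] y(1)] shadow_height(2,3)[OF chords[OF ij(2)] y(2)] by auto
      then show False using slopes_disjoint[OF ij] by blast
    qed
  qed
  moreover have "(\<lambda>i. shadow (P i) (Q i)) ` I \<subseteq> sets (kernel_measure \<sigma> z)"
    using open_shadow by (auto simp: borel_open)
  ultimately show ?thesis using assms(2) sum_emeasure[of "\<lambda>i. shadow (P i) (Q i)" I "kernel_measure \<sigma> z"] by simp
qed

lemma slope_strip_iff:
  "0 < height y \<Longrightarrow> \<bar>slope y - c\<bar> < d \<longleftrightarrow> \<bar>lateral y - c * height y\<bar> < d * height y"
  "0 < height y \<Longrightarrow> a \<le> slope y \<longleftrightarrow> a * height y \<le> lateral y"
  "0 < height y \<Longrightarrow> slope y \<le> b \<longleftrightarrow> lateral y \<le> b * height y"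
proof -
  assume h: "0 < height y"
  have "lateral y - c * height y = (slope y - c) * height y" using h by (simp add: lateral_slope algebra_simps)
  then have "\<bar>lateral y - c * height y\<bar> = \<bar>slope y - c\<bar> * height y" using h by (simp add: abs_mult)
  then show "\<bar>slope y - c\<bar> < d \<longleftrightarrow> \<bar>lateral y - c * height y\<bar> < d * height y" using h by simp
qed (simp_all add: slope_def field_simps)

lemma compact_slopes_bounded:
  assumes "compact K" "K \<subseteq> {y. 0 < height y}"
  obtains R where "0 < R" "\<And>y. y \<in> K \<Longrightarrow> \<bar>slope y\<bar> < R"
proof -
  have "continuous_on K slope" unfolding slope_def[abs_def]
    using assms(2) by (intro continuous_intros) auto
  then have "bounded (slope ` K)" using assms(1) by (intro compact_imp_bounded compact_continuous_image)
  then obtain R where "\<And>y. y \<in> K \<Longrightarrow> \<bar>slope y\<bar> \<le> R" unfolding bounded_iff by auto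
  then show thesis using that[of "\<bar>R\<bar> + 1"] by force
qed

text \<open>Thin columns of slopes: a chord below the lowest point of \<open>K\<close> in a column shadows all of \<open>K\<close>
  in that column. The columns are shrunk a little to make the subcurves disjoint.\<close>

lemma inscribed_family_shadowing_compact:
  assumes "0 < \<sigma>" "0 < \<eta>" and K: "compact K" "K \<subseteq> odd_front z u C"
    "\<And>y. y \<in> K \<Longrightarrow> open_segment z y \<inter> boundary_points C = {}"
    and G: "open G" "slope ` K \<subseteq> G" and c: "c < emeasure (kernel_measure \<sigma> z) K"
  shows "\<exists>I P Q. finite I \<and> inscribed_family C G I P Q \<and>
    (\<forall>i\<in>I. emeasure (kernel_measure \<sigma> z) (shadow (P i) (Q i)) < \<eta>) \<and>
    c < emeasure (kernel_measure \<sigma> z) (\<Union>i\<in>I. shadow (P i) (Q i))"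
proof -
  let ?M = "kernel_measure \<sigma> z"
  have Kh: "0 < height y" if "y \<in> K" for y using K(2) that by (auto simp: odd_front_def height_def)
  define good where "good y \<delta> a b P Q \<longleftrightarrow> chord P Q \<and> slope P = a \<and> slope Q = b \<and> height P < height y - \<delta> \<and> height Q < height y - \<delta> \<and>
      inscribed C P Q \<and> emeasure ?M (shadow P Q) < \<eta>" for y P Q and \<delta> a b :: real
  have "\<exists>\<delta>>0. {slope y - \<delta><..<slope y + \<delta>} \<subseteq> G \<and> (\<forall>a b. slope y - \<delta> < a \<longrightarrow> a < b \<longrightarrow> b < slope y + \<delta> \<longrightarrow> (\<exists>P Q. good y \<delta> a b P Q))"
    if y: "y \<in> K" for y
  proof -
    have "y \<in> odd_front z u C" using K(2) y by blast
    from local_inscribed_chords[OF assms(1,2) this K(3)[OF y], folded good_def]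
    obtain \<delta>1 where \<delta>1: "0 < \<delta>1"
      "\<forall>a b. slope y - \<delta>1 < a \<longrightarrow> a < b \<longrightarrow> b < slope y + \<delta>1 \<longrightarrow> (\<exists>P Q. good y \<delta>1 a b P Q)"
      by (elim exE conjE) (rule that)
    have "slope y \<in> G" using G(2) y by (rule subsetD[OF _ imageI])
    then obtain \<delta>2 where \<delta>2: "0 < \<delta>2" "ball (slope y) \<delta>2 \<subseteq> G"
      using G(1) unfolding open_contains_ball by blast
    have "\<exists>P Q. good y (min \<delta>1 \<delta>2) a b P Q"
      if ab: "slope y - min \<delta>1 \<delta>2 < a" "a < b" "b < slope y + min \<delta>1 \<delta>2" for a b
    proof -
      have le: "min \<delta>1 \<delta>2 \<le> \<delta>1" by simp
      have "slope y - \<delta>1 < a" "b < slope y + \<delta>1" using ab le by linarith+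
      then obtain P Q where "good y \<delta>1 a b P Q" using \<delta>1(2) ab(2) by blast
      with le have "good y (min \<delta>1 \<delta>2) a b P Q" unfolding good_def by auto
      then show ?thesis by blast
    qed
    moreover have "{slope y - min \<delta>1 \<delta>2<..<slope y + min \<delta>1 \<delta>2} \<subseteq> G"
      using \<delta>2(2) by (auto simp: ball_def dist_real_def subset_iff)
    ultimately show ?thesis using \<delta>1(1) \<delta>2(1) by (intro exI[of _ "min \<delta>1 \<delta>2"]) auto
  qed
  then obtain \<delta> where \<delta>: "\<And>y. y \<in> K \<Longrightarrow> 0 < \<delta> y" "\<And>y. y \<in> K \<Longrightarrow> {slope y - \<delta> y<..<slope y + \<delta> y} \<subseteq> G"
    "\<And>y a b. y \<in> K \<Longrightarrow> slope y - \<delta> y < a \<Longrightarrow> a < b \<Longrightarrow> b < slope y + \<delta> y \<Longrightarrow> \<exists>P Q. good y (\<delta> y) a b P Q"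
    by metis
  \<comment> \<open>Only half of the slope window is used, so a narrow column meeting
    \<open>V y\<close> still fits into the whole window; the height bound lies above the ends of
    every chord offered by \<open>good\<close>.\<close>
  define V where "V y = {x. \<bar>lateral x - slope y * height x\<bar> < \<delta> y / 2 * height x} \<inter> {x. height y - \<delta> y < height x}" for y
  have Vo: "open (V y)" for y unfolding V_def by (intro open_Int open_Collect_less continuous_intros)
  have V: "x \<in> V y \<longleftrightarrow> \<bar>slope x - slope y\<bar> < \<delta> y / 2 \<and> height y - \<delta> y < height x" if "x \<in> K" for x y
    unfolding V_def Int_iff mem_Collect_eq slope_strip_iff(1)[OF Kh[OF that]] ..
  have cover: "K \<subseteq> (\<Union>y\<in>K. V y)"
  proof
    fix y assume y: "y \<in> K"
    then have "y \<in> V y" using V[OF y, of y] \<delta>(1)[OF y] by simp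
    with y show "y \<in> (\<Union>y\<in>K. V y)" by blast
  qed
  obtain Y where Y: "Y \<subseteq> K" "finite Y" "K \<subseteq> (\<Union>y\<in>Y. V y)"
    using compactE_image[OF K(1) Vo cover] by metis
  have "K \<noteq> {}" using c by auto
  then have "Y \<noteq> {}" using Y(3) by auto
  \<comment> \<open>A column of width below \<open>\<delta> y / 4\<close> that contains a slope
    within \<open>\<delta> y / 2\<close> of that of \<open>y\<close> stays within
    \<open>\<delta> y\<close>.\<close>
  define \<omega> where "\<omega> = Min (\<delta> ` Y) / 4"
  have \<omega>: "0 < \<omega>" using Y \<delta>(1) \<open>Y \<noteq> {}\<close> by (auto simp: \<omega>_def)
  have \<omega>4: "4 * \<omega> \<le> \<delta> y" if "y \<in> Y" for y using Y that by (simp add: \<omega>_def)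
  obtain R where R: "0 < R" "\<And>y. y \<in> K \<Longrightarrow> \<bar>slope y\<bar> < R"
    using compact_slopes_bounded[OF K(1)] Kh by blast
  define l where "l i = - R + real i * \<omega>" for i :: nat
  have l_Suc: "l (Suc i) = l i + \<omega>" for i by (simp add: l_def algebra_simps)
  have l_mono: "l i \<le> l j" if "i \<le> j" for i j using that \<omega> by (simp add: l_def)
  obtain N :: nat where N: "2 * R < real N * \<omega>" using reals_Archimedean3[OF \<omega>] by blast
  have column: "\<exists>i<N. l i \<le> slope y \<and> slope y < l (Suc i)" if y: "y \<in> K" for y
  proof -
    define i where "i = nat \<lfloor>(slope y + R) / \<omega>\<rfloor>"
    have p: "0 \<le> (slope y + R) / \<omega>" using R(2)[OF y] \<omega> by simp
    have i: "real i \<le> (slope y + R) / \<omega>" "(slope y + R) / \<omega> < real i + 1"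
      using p unfolding i_def by auto
    have "real i * \<omega> \<le> slope y + R" "slope y + R < (real i + 1) * \<omega>" using i \<omega> by (auto simp: field_simps)
    moreover from this have "real i * \<omega> < real N * \<omega>" using N R(2)[OF y] by simp
    ultimately show ?thesis using \<omega> by (intro exI[of _ i]) (auto simp: l_def algebra_simps)
  qed
  \<comment> \<open>The margins tend to 0, so the shrunk columns exhaust the full ones; the offset 3
    gives \<open>2 * s n < \<omega>\<close> already for \<open>n = 0\<close>.\<close>
  define s where "s n = \<omega> / real (n + 3)" for n :: nat
  have s: "0 < s n" "2 * s n < \<omega>" for n using \<omega> by (auto simp: s_def field_simps intro: add_pos_nonneg)
  define X where "X n = K \<inter> (\<Union>i<N. {y. l i + s n \<le> slope y \<and> slope y \<le> l (Suc i) - s n})" for n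
  have Kcol: "compact (K \<inter> {y. a \<le> slope y \<and> slope y \<le> b})" for a b
  proof -
    have "K \<inter> {y. a \<le> slope y \<and> slope y \<le> b} = K \<inter> ({y. a * height y \<le> lateral y} \<inter> {y. lateral y \<le> b * height y})"
    proof -
      have "a \<le> slope y \<and> slope y \<le> b \<longleftrightarrow> a * height y \<le> lateral y \<and> lateral y \<le> b * height y" if "y \<in> K" for y
        using slope_strip_iff(2,3)[OF Kh[OF that]] by simp
      then show ?thesis by auto
    qed
    moreover have "closed ({y. a * height y \<le> lateral y} \<inter> {y. lateral y \<le> b * height y})"
      by (intro closed_Int closed_Collect_le continuous_intros)
    ultimately show ?thesis using compact_Int_closed[OF K(1)] by (simp only:)
  qed
  have X_eq: "X n = (\<Union>i<N. K \<inter> {y. l i + s n \<le> slope y \<and> slope y \<le> l (Suc i) - s n})" for n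
    unfolding X_def by blast
  have "compact (X n)" for n unfolding X_eq by (intro compact_UN Kcol) auto
  then have Xm: "X n \<in> sets lebesgue" for n by (simp add: borel_closed compact_imp_closed)
  have "incseq X"
  proof (rule incseq_SucI)
    fix n
    have "s (Suc n) \<le> s n" using \<omega> by (simp add: s_def field_simps)
    then show "X n \<subseteq> X (Suc n)" unfolding X_def by fastforce
  qed
  then have "(\<lambda>n. emeasure ?M (X n)) \<longlonglongrightarrow> emeasure ?M (\<Union>n. X n)"
    using Xm by (intro Lim_emeasure_incseq) auto
  \<comment> \<open>In the limit only the grid slopes \<open>l i\<close> are lost, finitely many
    rays.\<close>
  moreover have "emeasure ?M (\<Union>n. X n) = emeasure ?M K"
  proof (rule emeasure_eq_AE)
    have "negligible (\<Union>i\<in>{..<N}. {y. 0 < height y \<and> slope y = l i})"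
      by (intro negligible_Union) (auto intro: negligible_slope)
    then have "AE y in ?M. y \<notin> (\<Union>i\<in>{..<N}. {y. 0 < height y \<and> slope y = l i})"
      by (intro AE_not_in kernel_null_set)
    then show "AE y in ?M. (y \<in> (\<Union>n. X n)) = (y \<in> K)"
    proof eventually_elim
      case (elim y)
      have "y \<in> (\<Union>n. X n)" if y: "y \<in> K"
      proof -
        obtain i where i: "i < N" "l i \<le> slope y" "slope y < l (Suc i)" using column[OF y] by blast
        have "l i \<noteq> slope y"
        proof
          assume "l i = slope y"
          then have "y \<in> (\<Union>i\<in>{..<N}. {y. 0 < height y \<and> slope y = l i})"
            using i(1) Kh[OF y] by (intro UN_I[of i]) auto
          with elim show False by blast
        qed
        with i have "0 < min (slope y - l i) (l (Suc i) - slope y) / \<omega>" using \<omega> by auto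
        then obtain n where n: "1 / real (Suc n) < min (slope y - l i) (l (Suc i) - slope y) / \<omega>"
          by (rule nat_approx_posE)
        have "s n \<le> \<omega> * (1 / real (Suc n))" using \<omega> by (simp add: s_def field_simps)
        also have "\<dots> < min (slope y - l i) (l (Suc i) - slope y)" using n \<omega> by (simp add: field_simps)
        finally have "y \<in> X n" unfolding X_def using y i(1) by force
        then show ?thesis by blast
      qed
      then show ?case by (auto simp: X_def)
    qed
  qed (use Xm K(1) in \<open>auto simp: borel_closed compact_imp_closed\<close>)
  ultimately have "\<forall>\<^sub>F n in sequentially. c < emeasure ?M (X n)" using c by (intro order_tendstoD(1)) auto
  then obtain n where n: "c < emeasure ?M (X n)" using eventually_happens by force
  define a b where "a i = l i + s n" and "b i = l (Suc i) - s n" for i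
  have ab: "a i < b i" "b i - a i < \<omega>" for i using s[of n] by (auto simp: a_def b_def l_Suc)
  define col where "col i = K \<inter> {y. a i \<le> slope y \<and> slope y \<le> b i}" for i
  define I where "I = {i. i < N \<and> col i \<noteq> {}}"
  have "\<exists>P Q. chord P Q \<and> slope P = a i \<and> slope Q = b i \<and> (\<forall>x\<in>col i. max (height P) (height Q) < height x) \<and>
      inscribed C P Q \<and> emeasure ?M (shadow P Q) < \<eta> \<and> {a i..b i} \<subseteq> G" if i: "i \<in> I" for i
  proof -
    have "continuous_on (col i) height"
      using continuous_height[OF continuous_on_id] by (auto intro: continuous_on_subset)
    \<comment> \<open>The lowest point of the column. The centre \<open>y\<close> of a covering set
      \<open>V y\<close> containing \<open>x\<close> supplies a chord below \<open>x\<close>, hence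
      below the whole column.\<close>
    then obtain x where x: "x \<in> col i" "\<And>y. y \<in> col i \<Longrightarrow> height x \<le> height y"
      using continuous_attains_inf[of "col i" height] Kcol i unfolding I_def col_def by blast
    have xK: "x \<in> K" using x by (simp add: col_def)
    then obtain y where y: "y \<in> Y" "x \<in> V y" using Y(3) by blast
    have yK: "y \<in> K" using y Y by blast
    have xy: "\<bar>slope x - slope y\<bar> < \<delta> y / 2" "height y - \<delta> y < height x" using V[OF xK] y by auto
    have w: "slope y - \<delta> y < a i" "b i < slope y + \<delta> y"
    proof -
      have "a i \<le> slope x" "slope x \<le> b i" using x(1) by (auto simp: col_def)
      moreover have "slope y - \<delta> y / 2 < slope x" "slope x < slope y + \<delta> y / 2" using xy(1) by linarith+
      ultimately show "slope y - \<delta> y < a i" "b i < slope y + \<delta> y"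
        using ab(2)[of i] \<omega>4[OF y(1)] \<omega> by linarith+
    qed
    from \<delta>(3)[OF yK w(1) ab(1) w(2)] obtain P Q where "good y (\<delta> y) (a i) (b i) P Q" by blast
    moreover have "{a i..b i} \<subseteq> G" using \<delta>(2)[OF yK] w by force
    ultimately show ?thesis using x(2) xy(2) unfolding good_def
      by (intro exI[of _ P] exI[of _ Q]) fastforce
  qed
  then obtain P Q where PQ: "\<And>i. i \<in> I \<Longrightarrow> chord (P i) (Q i) \<and> slope (P i) = a i \<and> slope (Q i) = b i \<and>
      (\<forall>x\<in>col i. max (height (P i)) (height (Q i)) < height x) \<and>
      inscribed C (P i) (Q i) \<and> emeasure ?M (shadow (P i) (Q i)) < \<eta> \<and> {a i..b i} \<subseteq> G"
    by metis
  have fam: "chord_family z u I P Q"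
  proof
    show "chord (P i) (Q i)" if "i \<in> I" for i using PQ that by blast
    have less: "b i < a j" if "i < j" for i j
      using l_mono[of "Suc i" j] that s[of n] by (simp add: a_def b_def)
    show "{slope (P i)..slope (Q i)} \<inter> {slope (P j)..slope (Q j)} = {}" if ij: "i \<in> I" "j \<in> I" "i \<noteq> j" for i j
      using PQ[OF ij(1)] PQ[OF ij(2)] less[of i j] less[of j i] ij(3) by (cases "i < j") auto
  qed
  \<comment> \<open>Points in the open cone of their column lie above the chord and are shadowed;
    what remains has one of the two end slopes.\<close>
  have "X n - (\<Union>i\<in>I. shadow (P i) (Q i)) \<subseteq> (\<Union>i\<in>I. {y. 0 < height y \<and> slope y = a i} \<union> {y. 0 < height y \<and> slope y = b i})"
  proof
    fix x assume x: "x \<in> X n - (\<Union>i\<in>I. shadow (P i) (Q i))"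
    then obtain i where i: "i < N" "x \<in> col i" unfolding X_eq col_def a_def b_def by blast
    then have iI: "i \<in> I" by (auto simp: I_def)
    have hx: "0 < height x" using i Kh by (auto simp: col_def)
    have "x \<notin> cone (P i) (Q i)"
    proof
      assume "x \<in> cone (P i) (Q i)"
      then have "x \<in> shadow (P i) (Q i)" using PQ[OF iI] i(2) by (intro high_in_shadow) auto
      with x iI show False by blast
    qed
    then have "slope x = a i \<or> slope x = b i"
      using PQ[OF iI] i(2) hx by (auto simp: cone_iff_slope col_def)
    with iI hx show "x \<in> (\<Union>i\<in>I. {y. 0 < height y \<and> slope y = a i} \<union> {y. 0 < height y \<and> slope y = b i})" by blast
  qed
  moreover have finI: "finite I" by (simp add: I_def)
  then have "negligible (\<Union>i\<in>I. {y. 0 < height y \<and> slope y = a i} \<union> {y. 0 < height y \<and> slope y = b i})"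
    by (intro negligible_Union) (auto intro: negligible_slope)
  ultimately have "negligible (X n - (\<Union>i\<in>I. shadow (P i) (Q i)))" by (meson negligible_subset)
  then have null: "X n - (\<Union>i\<in>I. shadow (P i) (Q i)) \<in> null_sets ?M" by (rule kernel_null_set)
  have Sm: "(\<Union>i\<in>I. shadow (P i) (Q i)) \<in> sets ?M" using open_shadow by (auto intro!: borel_open)
  have "emeasure ?M (X n) \<le> emeasure ?M ((\<Union>i\<in>I. shadow (P i) (Q i)) \<union> (X n - (\<Union>i\<in>I. shadow (P i) (Q i))))"
    using Sm null by (intro emeasure_mono sets.Un) auto
  also have "\<dots> = emeasure ?M (\<Union>i\<in>I. shadow (P i) (Q i))" using Sm null by (rule emeasure_Un_null_set)
  finally have "c < emeasure ?M (\<Union>i\<in>I. shadow (P i) (Q i))" by (rule less_le_trans[OF n])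
  moreover have "inscribed_family C G I P Q" unfolding inscribed_family_def using fam PQ by auto
  ultimately show ?thesis using finI PQ by blast
qed

text \<open>Shadowing gives a total above \<open>k\<close> but with no upper bound, since chords
  below \<open>K\<close> may also shadow points outside the parity set. As each shadow has mass
  below \<open>\<eta>\<close>, a subfamily lands in the window.\<close>

lemma inscribed_family_approx:
  assumes "0 < \<sigma>" "0 < \<eta>" "0 \<le> k" and C: "\<And>p. p \<in> C \<Longrightarrow> \<exists>T g g'. C1_chart_at C p T g g'"
    and F: "odd_front z u C \<in> sets lebesgue"
    and G: "open G" and k: "ennreal k < emeasure (kernel_measure \<sigma> z) (odd_front z u C \<inter> {y. slope y \<in> G})"
  shows "\<exists>I P Q r. finite I \<and> inscribed_family C G I P Q \<and> k < r \<and> r \<le> k + \<eta> \<and>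
    emeasure (kernel_measure \<sigma> z) (\<Union>i\<in>I. shadow (P i) (Q i)) = ennreal r"
proof -
  let ?M = "kernel_measure \<sigma> z"
  define N where "N = {y. 0 < height y \<and> open_segment z y \<inter> boundary_points C \<noteq> {}}"
  have N: "N \<in> null_sets ?M" unfolding N_def by (intro kernel_null_set negligible_rays_through_boundary C)
  have Gm: "{y. slope y \<in> G} \<in> sets lebesgue" using G by (rule slope_strip_in_lebesgue)
  let ?X = "odd_front z u C \<inter> {y. slope y \<in> G} - N"
  have "emeasure ?M ?X = emeasure ?M (odd_front z u C \<inter> {y. slope y \<in> G})"
    using N F Gm by (intro emeasure_Diff_null_set) auto
  then have "\<exists>K. compact K \<and> K \<subseteq> ?X \<and> ennreal k < emeasure ?M K"
    using assms(1) F Gm k N by (intro inner_compact_kernel_measure) (auto simp: null_sets_def)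
  then obtain K where K: "compact K" "K \<subseteq> ?X" "ennreal k < emeasure ?M K" by blast
  have Kb: "open_segment z y \<inter> boundary_points C = {}" if "y \<in> K" for y
    using K(2) that by (auto simp: N_def odd_front_def height_def)
  have KF: "K \<subseteq> odd_front z u C" and KG: "slope ` K \<subseteq> G" using K(2) by auto
  have "0 < ennreal \<eta>" using assms(2) by simp
  from inscribed_family_shadowing_compact[OF assms(1) this K(1) KF Kb G KG K(3)]
  obtain I P Q where I: "finite I" "inscribed_family C G I P Q"
    "\<And>i. i \<in> I \<Longrightarrow> emeasure ?M (shadow (P i) (Q i)) < ennreal \<eta>"
    "ennreal k < emeasure ?M (\<Union>i\<in>I. shadow (P i) (Q i))"
    by blast
  define w where "w i = enn2real (emeasure ?M (shadow (P i) (Q i)))" for i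
  have w: "emeasure ?M (shadow (P i) (Q i)) = ennreal (w i)" "w i \<le> \<eta>" "0 \<le> w i" if "i \<in> I" for i
  proof -
    have "emeasure ?M (shadow (P i) (Q i)) < top" using I(3)[OF that] by (rule less_trans) simp
    then show "emeasure ?M (shadow (P i) (Q i)) = ennreal (w i)" by (simp add: w_def)
    then have "ennreal (w i) < ennreal \<eta>" using I(3)[OF that] by (simp only:)
    then show "w i \<le> \<eta>" using assms(2) by (simp add: ennreal_less_iff w_def)
  qed (simp add: w_def)
  have sum: "emeasure ?M (\<Union>i\<in>J. shadow (P i) (Q i)) = ennreal (sum w J)" if "J \<subseteq> I" for J
  proof -
    have "chord_family z u J P Q" using inscribed_family_subset[OF I(2) that] by (simp add: inscribed_family_def)
    then have "emeasure ?M (\<Union>i\<in>J. shadow (P i) (Q i)) = (\<Sum>i\<in>J. emeasure ?M (shadow (P i) (Q i)))"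
      using finite_subset[OF that I(1)] by (rule emeasure_shadows)
    also have "\<dots> = (\<Sum>i\<in>J. ennreal (w i))" using w that by (intro sum.cong) auto
    also have "\<dots> = ennreal (sum w J)" using w that by (intro sum_ennreal) auto
    finally show ?thesis .
  qed
  have "k < sum w I" using I(4) sum[OF order_refl] assms(3) by (simp add: ennreal_less_iff)
  then obtain J where J: "J \<subseteq> I" "k < sum w J" "sum w J \<le> k + \<eta>"
    using subset_sum_in_window[OF I(1), of w \<eta> k] w assms(3) by blast
  then show ?thesis
    using inscribed_family_subset[OF I(2) J(1)] sum[OF J(1)] finite_subset[OF J(1) I(1)]
    by (intro exI[of _ J] exI[of _ P] exI[of _ Q] exI[of _ "sum w J"]) auto
qed

end

section \<open>Existence of the curvature\<close>

text \<open>Integrating the Hoelder bound gives a Taylor remainder of order \<open>1 + a\<close> in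
  the parameter. The linear term is tangential, so the normal component comes from the remainder
  alone.\<close>

lemma chart_normal_bound:
  assumes "C1_chart_at C z T g g'" "holder_on a g' T" "0 < a" "unit_normal C z u"
  shows "\<exists>d M. 0 < d \<and> 0 \<le> M \<and> (\<forall>q\<in>C \<inter> ball z d. \<bar>(q - z) \<bullet> u\<bar> \<le> M * norm (q - z) powr (1 + a))"
proof -
  obtain U h where T: "is_interval T" and reg: "C1_regular_on g g' T" and U: "open U" "z \<in> U" "homeomorphism T (C \<inter> U) g h" and zC: "z \<in> C"
    using assms(1) unfolding C1_chart_at_def by blast
  have hom: "\<And>x. x \<in> T \<Longrightarrow> h (g x) = x" "\<And>y. y \<in> C \<inter> U \<Longrightarrow> g (h y) = y" "h ` (C \<inter> U) = T" "continuous_on (C \<inter> U) h"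
    using U(3) by (auto simp: homeomorphism_def)
  define t where "t = h z"
  have zU: "z \<in> C \<inter> U" using zC U(2) by blast
  have t: "t \<in> T" "g t = z" using hom(2)[OF zU] hom(3) zU by (auto simp: t_def)
  obtain v where v: "tangent_vector C z v" "u \<bullet> v = 0" using assms(4) by (auto simp: unit_normal_def)
  have "tangent_vector C z (g' t)" using assms(1) t unfolding tangent_vector_def by blast
  then have ug: "u \<bullet> g' t = 0" using tangent_normal_unique[OF v(1) _ v(2)] by blast
  have nu: "norm u = 1" using assms(4) by (simp add: unit_normal_def)
  obtain H where H: "\<And>s r. s \<in> T \<Longrightarrow> r \<in> T \<Longrightarrow> norm (g' s - g' r) \<le> H * \<bar>s - r\<bar> powr a"
    using assms(2) by (auto simp: holder_on_def)
  define L where "L = \<bar>H\<bar>"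
  have L: "0 \<le> L" "norm (g' s - g' r) \<le> L * \<bar>s - r\<bar> powr a" if "s \<in> T" "r \<in> T" for s r
  proof -
    have "H * \<bar>s - r\<bar> powr a \<le> L * \<bar>s - r\<bar> powr a" by (intro mult_right_mono) (auto simp: L_def)
    then show "norm (g' s - g' r) \<le> L * \<bar>s - r\<bar> powr a" using H[OF that] by linarith
  qed (simp add: L_def)
  have L0: "0 \<le> L" by (simp add: L_def)
  have est: "norm (g s - z - (s - t) *\<^sub>R g' t) \<le> L * \<bar>s - t\<bar> powr (1 + a)" if s: "s \<in> T" for s
  proof -
    have cs: "closed_segment t s \<subseteq> T"
      using T t(1) s by (simp add: closed_segment_subset is_interval_convex)
    \<comment> \<open>Mean value inequality for \<open>g r - r *\<^sub>R g' t\<close>, whose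
      derivative is the increment of \<open>g'\<close> from \<open>t\<close>.\<close>
    have "norm ((g s - s *\<^sub>R g' t) - (g t - t *\<^sub>R g' t)) \<le> (L * \<bar>s - t\<bar> powr a) * norm (s - t)"
    proof (rule differentiable_bound[where S="closed_segment t s" and f="\<lambda>r. g r - r *\<^sub>R g' t" and f'="\<lambda>x y. y *\<^sub>R (g' x - g' t)"])
      fix x assume x: "x \<in> closed_segment t s"
      have "(g has_vector_derivative g' x) (at x within closed_segment t s)"
        using reg x cs unfolding C1_regular_on_def by (meson has_vector_derivative_within_subset subsetD)
      then have "((\<lambda>r. g r - r *\<^sub>R g' t) has_vector_derivative (g' x - 1 *\<^sub>R g' t)) (at x within closed_segment t s)"
        by (intro derivative_intros) (auto intro!: derivative_eq_intros)
      then show "((\<lambda>r. g r - r *\<^sub>R g' t) has_derivative (\<lambda>y. y *\<^sub>R (g' x - g' t))) (at x within closed_segment t s)"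
        by (simp add: has_vector_derivative_def)
      have "\<bar>x - t\<bar> \<le> \<bar>s - t\<bar>" using x by (auto simp: closed_segment_eq_real_ivl split: if_splits)
      then have "\<bar>x - t\<bar> powr a \<le> \<bar>s - t\<bar> powr a" using assms(3) by (intro powr_mono2) auto
      then have "L * \<bar>x - t\<bar> powr a \<le> L * \<bar>s - t\<bar> powr a" using L0 by (rule mult_left_mono)
      then have n: "norm (g' x - g' t) \<le> L * \<bar>s - t\<bar> powr a" using L(2)[of x t] x cs t by force
      show "onorm (\<lambda>y. y *\<^sub>R (g' x - g' t)) \<le> L * \<bar>s - t\<bar> powr a"
        using n by (intro onorm_le) (simp add: mult.commute mult_left_mono)
    qed auto
    also have "(g s - s *\<^sub>R g' t) - (g t - t *\<^sub>R g' t) = g s - z - (s - t) *\<^sub>R g' t"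
      using t by (simp add: algebra_simps)
    also have "(L * \<bar>s - t\<bar> powr a) * norm (s - t) = L * \<bar>s - t\<bar> powr (1 + a)"
      using powr_mult_base[of "\<bar>s - t\<bar>" a] by (simp add: ac_simps)
    finally show ?thesis .
  qed
  define c where "c = norm (g' t)"
  have c: "0 < c" using reg t by (auto simp: c_def C1_regular_on_def)
  have "((\<lambda>r. L * r powr a) \<longlongrightarrow> 0) (at_right 0)"
  proof -
    have "((\<lambda>r::real. L * r powr a) \<longlongrightarrow> L * 0 powr a) (at_right 0)"
      using assms(3) by (intro tendsto_mult tendsto_const tendsto_powr') (auto simp: eventually_at_right_field intro!: exI[of _ 1])
    then show ?thesis by simp
  qed
  then have "\<forall>\<^sub>F r in at_right 0. L * r powr a < c / 2" using c by (intro order_tendstoD(2)) auto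
  then obtain e where e: "0 < e" "\<And>r. 0 < r \<Longrightarrow> r < e \<Longrightarrow> L * r powr a < c / 2"
    by (auto simp: eventually_at_right_field)
  obtain d1 where d1: "0 < d1" "\<And>q. q \<in> C \<inter> U \<Longrightarrow> dist q z < d1 \<Longrightarrow> dist (h q) t < e"
    using hom(4) zU e(1) unfolding continuous_on_iff t_def by metis
  obtain d2 where d2: "0 < d2" "ball z d2 \<subseteq> U" using U by (meson open_contains_ball)
  have "\<bar>(q - z) \<bullet> u\<bar> \<le> (L * (2 / c) powr (1 + a)) * norm (q - z) powr (1 + a)" if q: "q \<in> C \<inter> ball z (min d1 d2)" for q
  proof (cases "q = z")
    case False
    have qU: "q \<in> C \<inter> U" using q d2 by auto
    define s where "s = h q"
    have s: "s \<in> T" "g s = q" using hom qU s_def by blast+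
    have st: "0 < \<bar>s - t\<bar>" "\<bar>s - t\<bar> < e"
      using False s t d1(2)[OF qU] q by (auto simp: s_def dist_real_def dist_commute)
    have "((s - t) *\<^sub>R g' t) \<bullet> u = 0" using ug by (simp add: inner_commute)
    then have "(q - z) \<bullet> u = (q - z - (s - t) *\<^sub>R g' t) \<bullet> u" by (simp only: inner_diff_left diff_zero)
    then have 1: "\<bar>(q - z) \<bullet> u\<bar> \<le> L * \<bar>s - t\<bar> powr (1 + a)"
      using Cauchy_Schwarz_ineq2[of "q - z - (s - t) *\<^sub>R g' t" u] est[OF s(1)] s(2) nu by simp
    \<comment> \<open>For parameters within \<open>e\<close> of \<open>t\<close> the remainder
      consumes at most half the speed, so distance in the plane controls distance of
      parameters.\<close>
    have "norm ((s - t) *\<^sub>R g' t) - norm (q - z) \<le> norm ((s - t) *\<^sub>R g' t - (q - z))" by (rule norm_triangle_ineq2)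
    also have "\<dots> \<le> L * \<bar>s - t\<bar> powr (1 + a)" using est[OF s(1)] s(2) by (simp add: norm_minus_commute)
    also have "\<dots> = \<bar>s - t\<bar> * (L * \<bar>s - t\<bar> powr a)"
      using powr_mult_base[of "\<bar>s - t\<bar>" a] by (simp add: ac_simps)
    also have "\<dots> \<le> \<bar>s - t\<bar> * (c / 2)" using e(2)[OF st] st by (intro mult_left_mono) auto
    finally have "\<bar>s - t\<bar> * c - \<bar>s - t\<bar> * (c / 2) \<le> norm (q - z)" by (simp add: c_def)
    then have "\<bar>s - t\<bar> \<le> (2 / c) * norm (q - z)" using c by (simp add: field_simps)
    then have "\<bar>s - t\<bar> powr (1 + a) \<le> ((2 / c) * norm (q - z)) powr (1 + a)" using assms(3) by (intro powr_mono2) auto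
    also have "\<dots> = (2 / c) powr (1 + a) * norm (q - z) powr (1 + a)" by (rule powr_mult)
    finally have "L * \<bar>s - t\<bar> powr (1 + a) \<le> L * ((2 / c) powr (1 + a) * norm (q - z) powr (1 + a))"
      using L0 by (rule mult_left_mono)
    with 1 show ?thesis by simp
  qed simp
  then show ?thesis using d1 d2 L0 by (intro exI[of _ "min d1 d2"] exI[of _ "L * (2 / c) powr (1 + a)"]) auto
qed

section \<open>Finite mass of the parity sets off accumulation points\<close>

lemma odd_front_ray_crossing:
  assumes "y \<in> odd_front z u C"
  obtains q l where "q \<in> C" "0 < l" "l < 1" "q - z = l *\<^sub>R (y - z)"
proof -
  have "odd (card (C \<inter> open_segment z y))" using assms by (auto simp: odd_front_def odd_crossings_def)
  then have "C \<inter> open_segment z y \<noteq> {}" by (metis card.empty even_zero)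
  then obtain q where "q \<in> C" "q \<in> open_segment z y" by blast
  then obtain l where l: "0 < l" "l < 1" "q = (1 - l) *\<^sub>R z + l *\<^sub>R y" by (auto simp: in_segment)
  have "q - z = l *\<^sub>R (y - z)" unfolding l(3) by (simp add: algebra_simps)
  with \<open>q \<in> C\<close> l(1,2) show thesis by (rule that)
qed

text \<open>The crossing \<open>q\<close> divides the segment from \<open>z\<close> to
  \<open>y\<close> in ratio \<open>l\<close>. Its bound scales with \<open>l powr (1 + a)\<close>
  against \<open>l\<close> on the left; after division the factor \<open>l powr a\<close> is at most
  1.\<close>

lemma odd_front_near_subset_wedge:
  assumes "0 < a" "0 \<le> M" "norm u = 1"
    and M: "\<And>q. q \<in> C \<Longrightarrow> norm (q - z) < d \<Longrightarrow> \<bar>(q - z) \<bullet> u\<bar> \<le> M * norm (q - z) powr (1 + a)"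
    and w: "w = u \<or> w = - u"
  shows "odd_front z w C \<subseteq> {y. y \<noteq> z \<and> norm (y - z) < d \<and> \<bar>(y - z) \<bullet> u\<bar> \<le> M * norm (y - z) powr (1 + a)} \<union> - ball z d"
proof
  fix y assume y: "y \<in> odd_front z w C"
  obtain q l where q: "q \<in> C" "0 < l" "l < 1" "q - z = l *\<^sub>R (y - z)" using odd_front_ray_crossing[OF y] .
  have yz: "y \<noteq> z" using y by auto
  show "y \<in> {y. y \<noteq> z \<and> norm (y - z) < d \<and> \<bar>(y - z) \<bullet> u\<bar> \<le> M * norm (y - z) powr (1 + a)} \<union> - ball z d"
  proof (cases "norm (y - z) < d")
    case True
    define r where "r = norm (y - z)"
    have r: "0 < r" using yz by (simp add: r_def)
    have nq: "norm (q - z) = l * r" using q by (simp add: r_def)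
    have "l * r \<le> r" using q r by simp
    then have "norm (q - z) < d" using True nq by (simp add: r_def)
    from M[OF q(1) this] have "l * \<bar>(y - z) \<bullet> u\<bar> \<le> M * (l * r) powr (1 + a)"
      unfolding nq unfolding q(4) using q(2) by (simp add: abs_mult)
    also have "\<dots> = l * (M * (l powr a * r powr (1 + a)))"
      using q(2) r by (simp add: powr_mult powr_add)
    finally have "\<bar>(y - z) \<bullet> u\<bar> \<le> M * (l powr a * r powr (1 + a))" using q(2) by (simp only: mult_le_cancel_left_pos)
    also have "\<dots> \<le> M * (1 * r powr (1 + a))"
      using q assms(1,2) powr_mono2[of a l 1] by (intro mult_left_mono mult_right_mono) auto
    finally show ?thesis using True yz by (simp add: r_def)
  qed (simp add: dist_norm norm_minus_commute)
qed

text \<open>On the curve the wedge comes from the Hoelder chart; off the closure a ball free of the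
  curve gives it vacuously with \<open>M = 0\<close>. If a parity set is not measurable, the
  truncations are eventually 0 and converge as well.\<close>

lemma truncated_curvature_converges:
  assumes "0 < \<sigma>" "\<sigma> < a" "norm u = 1" "C1_holder_curve a C" "z \<in> C \<Longrightarrow> unit_normal C z u" "z \<notin> closure C - C"
  shows "\<exists>k. (truncated_curvature \<sigma> z C u \<longlongrightarrow> k) (at_right 0)"
proof -
  have "\<exists>d M. 0 < d \<and> 0 \<le> M \<and> (\<forall>q\<in>C \<inter> ball z d. \<bar>(q - z) \<bullet> u\<bar> \<le> M * norm (q - z) powr (1 + a))"
  proof (cases "z \<in> C")
    case True
    then obtain T g g' where "C1_chart_at C z T g g'" "holder_on a g' T"
      using assms(4) unfolding C1_holder_curve_def by blast
    then show ?thesis using assms True by (intro chart_normal_bound) auto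
  next
    case False
    then have "z \<notin> closure C" using assms(6) by blast
    then have "z \<in> - closure C" "open (- closure C)" by auto
    then obtain d where d: "0 < d" "ball z d \<subseteq> - closure C" unfolding open_contains_ball by blast
    then have "C \<inter> ball z d = {}" using closure_subset[of C] by blast
    with d(1) show ?thesis by (intro exI[of _ d] exI[of _ 0]) simp
  qed
  then obtain d M where d: "0 < d" "0 \<le> M"
    and M: "\<And>q. q \<in> C \<Longrightarrow> norm (q - z) < d \<Longrightarrow> \<bar>(q - z) \<bullet> u\<bar> \<le> M * norm (q - z) powr (1 + a)"
    by (auto simp: dist_norm norm_minus_commute)
  define W where "W = {y. y \<noteq> z \<and> norm (y - z) < d \<and> \<bar>(y - z) \<bullet> u\<bar> \<le> M * norm (y - z) powr (1 + a)}"
  have W: "emeasure (kernel_measure \<sigma> z) W < \<infinity>"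
    unfolding W_def using assms d by (intro kernel_measure_wedge) auto
  have Wm: "W \<in> sets lebesgue"
  proof -
    have "W \<in> sets borel" unfolding W_def by measurable
    then show ?thesis by simp
  qed
  have fin: "emeasure (kernel_measure \<sigma> z) (odd_front z w C) < \<infinity>" if "w = u \<or> w = - u" for w
  proof -
    have "0 < a" using assms(1,2) by simp
    have "odd_front z w C \<subseteq> W \<union> - ball z d"
      unfolding W_def by (rule odd_front_near_subset_wedge[OF \<open>0 < a\<close> d(2) assms(3) M that])
    then have "emeasure (kernel_measure \<sigma> z) (odd_front z w C) \<le> emeasure (kernel_measure \<sigma> z) (W \<union> - ball z d)"
      using Wm by (intro emeasure_mono) (auto simp: Compl_in_sets_lebesgue)
    also have "\<dots> \<le> emeasure (kernel_measure \<sigma> z) W + emeasure (kernel_measure \<sigma> z) (- ball z d)"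
      using Wm by (intro emeasure_subadditive) (auto simp: Compl_in_sets_lebesgue)
    also have "\<dots> < \<infinity>" using W kernel_measure_off_ball[OF assms(1) d(1), of z] by simp
    finally show ?thesis .
  qed
  show ?thesis
    using odd_front_measurable_or_truncated_zero[OF assms(1), of z u C]
  proof
    assume "odd_front z u C \<in> sets lebesgue \<and> odd_front z (- u) C \<in> sets lebesgue"
    then show ?thesis using truncated_curvature_tendsto[OF assms(1)] fin by blast
  next
    assume "\<forall>\<^sub>F \<epsilon> in at_right 0. truncated_curvature \<sigma> z C u \<epsilon> = 0"
    then show ?thesis by (intro exI[of _ 0] tendsto_eventually)
  qed
qed

section \<open>Curvature of polygons made of chords\<close>

context chord_family
begin

lemma has_nonlocal_curvature_polygon:
  assumes "0 < \<sigma>" "emeasure (kernel_measure \<sigma> z) (\<Union>i\<in>I. shadow (P i) (Q i)) = ennreal r" "0 \<le> r"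
  shows "has_nonlocal_curvature \<sigma> z polygon u r"
proof -
  have m: "measure (kernel_measure \<sigma> z) (odd_front z u polygon) = r"
    using assms emeasure_odd_front_polygon[of \<sigma>] by (simp add: measure_def)
  have "(truncated_curvature \<sigma> z polygon u \<longlongrightarrow>
    measure (kernel_measure \<sigma> z) (odd_front z u polygon) - measure (kernel_measure \<sigma> z) (odd_front z (- u) polygon)) (at_right 0)"
    using assms(1,2) odd_front_polygon_measurable emeasure_odd_front_polygon[of \<sigma>]
    by (intro truncated_curvature_tendsto) (auto simp: odd_front_back)
  then show ?thesis
    unfolding has_nonlocal_curvature_iff using unit z_notin_polygon m by (simp add: odd_front_back)
qed

text \<open>Nothing cancels from behind, so the truncations are the masses off small balls and
  exceed every bound.\<close>

lemma no_nonlocal_curvature_polygon: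
  assumes "0 < \<sigma>" "emeasure (kernel_measure \<sigma> z) (\<Union>i\<in>I. shadow (P i) (Q i)) = \<infinity>"
  shows "\<not> has_nonlocal_curvature \<sigma> z polygon u k"
proof
  let ?M = "kernel_measure \<sigma> z" and ?F = "odd_front z u polygon"
  assume "has_nonlocal_curvature \<sigma> z polygon u k"
  then have "(truncated_curvature \<sigma> z polygon u \<longlongrightarrow> k) (at_right 0)" by (simp add: has_nonlocal_curvature_iff)
  then have 1: "\<forall>\<^sub>F \<epsilon> in at_right 0. truncated_curvature \<sigma> z polygon u \<epsilon> < \<bar>k\<bar> + 1"
    by (intro order_tendstoD(2)) auto
  have 2: "\<forall>\<^sub>F \<epsilon> in at_right 0. ennreal (\<bar>k\<bar> + 1) < emeasure ?M (?F - ball z \<epsilon>)"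
    using odd_front_polygon_measurable emeasure_odd_front_polygon[of \<sigma>] assms(2)
    by (intro eventually_kernel_measure_gt) auto
  have 3: "\<forall>\<^sub>F \<epsilon> in at_right 0. (0::real) < \<epsilon>" by (simp add: eventually_at_right_less)
  from eventually_happens[OF eventually_conj[OF 1 eventually_conj[OF 2 3]]] obtain \<epsilon> where
    \<epsilon>: "truncated_curvature \<sigma> z polygon u \<epsilon> < \<bar>k\<bar> + 1" "ennreal (\<bar>k\<bar> + 1) < emeasure ?M (?F - ball z \<epsilon>)" "0 < \<epsilon>"
    by auto
  have t: "truncated_curvature \<sigma> z polygon u \<epsilon> = measure ?M (?F - ball z \<epsilon>)"
    using truncated_curvature_eq[OF assms(1) \<epsilon>(3) odd_front_polygon_measurable] by (simp add: odd_front_back)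
  have "emeasure ?M (?F - ball z \<epsilon>) \<le> emeasure ?M (- ball z \<epsilon>)"
    by (intro emeasure_mono) (auto simp: Compl_in_sets_lebesgue)
  also have "\<dots> < \<infinity>" using assms(1) \<epsilon>(3) by (rule kernel_measure_off_ball)
  finally have "emeasure ?M (?F - ball z \<epsilon>) = ennreal (measure ?M (?F - ball z \<epsilon>))"
    by (intro emeasure_eq_ennreal_measure) auto
  with \<epsilon>(2) have "ennreal (\<bar>k\<bar> + 1) < ennreal (measure ?M (?F - ball z \<epsilon>))" by (simp only:)
  then have "\<bar>k\<bar> + 1 < measure ?M (?F - ball z \<epsilon>)" by (subst (asm) ennreal_less_iff) auto
  with \<epsilon>(1) t show False by simp
qed

end

section \<open>Approximation by splines\<close>

context half_plane
begin

text \<open>The slopes are cut at a value with mass above 1 on either side. One side keeps infinite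
  mass and can be cut again; the other is set aside as \<open>H\<close>.\<close>

lemma split_infinite_measure:
  assumes "0 < \<sigma>" and X: "X \<in> sets lebesgue" "X \<subseteq> {y. 0 < height y}"
    and G: "open G" "emeasure (kernel_measure \<sigma> z) (X \<inter> {y. slope y \<in> G}) = \<infinity>"
  shows "\<exists>G' H. open G' \<and> open H \<and> G' \<subseteq> G \<and> H \<subseteq> G \<and> G' \<inter> H = {} \<and>
    emeasure (kernel_measure \<sigma> z) (X \<inter> {y. slope y \<in> G'}) = \<infinity> \<and>
    1 < emeasure (kernel_measure \<sigma> z) (X \<inter> {y. slope y \<in> H})"
proof -
  let ?M = "kernel_measure \<sigma> z"
  note strip = slope_strip_in_lebesgue
  have "z \<notin> X \<inter> {y. slope y \<in> G}" using X(2) by auto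
  \<comment> \<open>With mass above 3, a cut leaving 3/2 on the left leaves more than 1 on the
    right.\<close>
  then obtain K where K: "compact K" "K \<subseteq> X \<inter> {y. slope y \<in> G}" "ennreal 3 < emeasure ?M K"
    using inner_compact_kernel_measure[OF assms(1), of "X \<inter> {y. slope y \<in> G}" z "ennreal 3"] X(1) strip[OF G(1)] G(2) by auto
  have Kh: "K \<subseteq> {y. 0 < height y}" using K(2) X(2) by blast
  have Km: "K \<in> sets lebesgue" using K(1) by (simp add: borel_closed compact_imp_closed)
  have "K \<noteq> {}" using K(3) by auto
  moreover have "continuous_on K height"
    using continuous_height[OF continuous_on_id] by (auto intro: continuous_on_subset)
  ultimately obtain x0 where x0: "x0 \<in> K" "\<And>y. y \<in> K \<Longrightarrow> height x0 \<le> height y"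
    using continuous_attains_inf[OF K(1)] by blast
  define m where "m = height x0"
  have m: "0 < m" "\<And>y. y \<in> K \<Longrightarrow> m \<le> height y" using x0 Kh by (auto simp: m_def)
  have "K \<subseteq> - ball z m"
  proof
    fix y assume "y \<in> K"
    then have "m \<le> norm (y - z)" using m(2)[of y] height_le_norm[of y] by linarith
    then show "y \<in> - ball z m" by (simp add: dist_norm norm_minus_commute)
  qed
  then have "emeasure ?M K \<le> emeasure ?M (- ball z m)"
    by (intro emeasure_mono) (auto simp: Compl_in_sets_lebesgue)
  also have "\<dots> < \<infinity>" using assms(1) m(1) by (rule kernel_measure_off_ball)
  finally have Kfin: "K \<in> fmeasurable ?M" using Km by (simp add: fmeasurable_def)
  obtain R where R: "0 < R" "\<And>y. y \<in> K \<Longrightarrow> \<bar>slope y\<bar> < R"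
    using compact_slopes_bounded[OF K(1) Kh] by blast
  have L: "{y. slope y < x} \<in> sets lebesgue" "{y. x < slope y} \<in> sets lebesgue" for x
    using strip[of "{..<x}"] strip[of "{x<..}"] by auto
  \<comment> \<open>The distribution function of the slopes in \<open>K\<close>. It is continuous
    because rays are null, so the intermediate value theorem finds the cut.\<close>
  define \<phi> where "\<phi> x = measure ?M (K \<inter> {y. slope y < x})" for x
  have part: "K \<inter> A \<in> fmeasurable ?M" if "A \<in> sets lebesgue" for A
    using fmeasurable_Int_fmeasurable[OF Kfin, of A] that by simp
  have S: "{y. \<bar>slope y - c\<bar> \<le> d} \<in> sets lebesgue" for c d
  proof -
    have "{y. \<bar>slope y - c\<bar> \<le> d} = - ({y. slope y < c - d} \<union> {y. c + d < slope y})" by (auto simp: abs_le_iff)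
    then show ?thesis using L by (auto simp: Compl_in_sets_lebesgue)
  qed
  have \<phi>_diff: "\<bar>\<phi> x - \<phi> c\<bar> \<le> measure ?M (K \<inter> {y. \<bar>slope y - c\<bar> \<le> d})" if "\<bar>x - c\<bar> \<le> d" for x c d
  proof -
    have le: "\<phi> a \<le> \<phi> b + measure ?M (K \<inter> {y. \<bar>slope y - c\<bar> \<le> d})" if "\<bar>a - c\<bar> \<le> d" "\<bar>b - c\<bar> \<le> d" for a b
    proof -
      have "\<phi> a \<le> measure ?M ((K \<inter> {y. slope y < b}) \<union> (K \<inter> {y. \<bar>slope y - c\<bar> \<le> d}))"
        unfolding \<phi>_def using that
        by (intro measure_mono_fmeasurable fmeasurable.Un fmeasurableD[OF part[OF L(1)]] part L S)
          (auto simp: abs_le_iff)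
      also have "\<dots> \<le> \<phi> b + measure ?M (K \<inter> {y. \<bar>slope y - c\<bar> \<le> d})"
        unfolding \<phi>_def by (intro measure_Un_le) (use Km L S in auto)
      finally show ?thesis .
    qed
    have "\<bar>c - c\<bar> \<le> d" using that by linarith
    from le[OF that this] le[OF this that] show ?thesis by (simp add: abs_le_iff)
  qed
  have "continuous_on UNIV \<phi>"
    unfolding continuous_on_iff
  proof (intro ballI allI impI)
    fix c e :: real assume "0 < e"
    then obtain d where d: "0 < d" "emeasure ?M {y. m \<le> height y \<and> \<bar>slope y - c\<bar> \<le> d} < ennreal e"
      using slab_measure_small[OF assms(1) m(1), of "ennreal e" c] by auto
    have "dist (\<phi> x) (\<phi> c) < e" if "dist x c < d" for x
    proof -
      have "emeasure ?M (K \<inter> {y. \<bar>slope y - c\<bar> \<le> d}) \<le> emeasure ?M {y. m \<le> height y \<and> \<bar>slope y - c\<bar> \<le> d}"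
      proof (rule emeasure_mono)
        have "{y. m \<le> height y \<and> \<bar>slope y - c\<bar> \<le> d} =
          {y. m \<le> height y} \<inter> - ({y. slope y < c - d} \<union> {y. c + d < slope y})" by (auto simp: abs_le_iff)
        moreover have "closed {y. m \<le> height y}" by (intro closed_Collect_le continuous_intros)
        ultimately show "{y. m \<le> height y \<and> \<bar>slope y - c\<bar> \<le> d} \<in> sets ?M"
          using L by (auto simp: Compl_in_sets_lebesgue borel_closed)
      qed (use m(2) in auto)
      with d(2) have lt: "emeasure ?M (K \<inter> {y. \<bar>slope y - c\<bar> \<le> d}) < ennreal e" by (rule le_less_trans[rotated])
      then have "measure ?M (K \<inter> {y. \<bar>slope y - c\<bar> \<le> d}) < e"
        by (simp add: emeasure_eq_measure2[OF part[OF S]] ennreal_less_iff)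
      then show ?thesis using \<phi>_diff[of x c d] that by (simp add: dist_real_def)
    qed
    with d(1) show "\<exists>d>0. \<forall>x\<in>UNIV. dist x c < d \<longrightarrow> dist (\<phi> x) (\<phi> c) < e" by blast
  qed
  then have "continuous_on {- R..R} \<phi>" by (rule continuous_on_subset) auto
  moreover have "\<phi> (- R) = 0"
  proof -
    have "K \<inter> {y. slope y < - R} = {}" using R(2) by fastforce
    then show ?thesis by (simp add: \<phi>_def)
  qed
  moreover have K3: "3 < measure ?M K" using K(3) Kfin by (simp add: emeasure_eq_measure2 ennreal_less_iff)
  moreover have "\<phi> R = measure ?M K"
  proof -
    have "K \<inter> {y. slope y < R} = K" using R(2) by fastforce
    then show ?thesis by (simp add: \<phi>_def)
  qed
  ultimately obtain x where x: "\<phi> x = 3 / 2" using IVT'[of \<phi> "- R" "3 / 2" R] R(1) by auto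
  have left: "1 < emeasure ?M (X \<inter> {y. slope y \<in> G \<inter> {..<x}})"
  proof -
    have "1 < ennreal (\<phi> x)" unfolding x by simp
    also have "\<dots> = emeasure ?M (K \<inter> {y. slope y < x})"
      using part[OF L(1)] by (simp add: \<phi>_def emeasure_eq_measure2)
    also have "\<dots> \<le> emeasure ?M (X \<inter> {y. slope y \<in> G \<inter> {..<x}})"
      using K(2) X(1) strip[of "G \<inter> {..<x}"] G(1) by (intro emeasure_mono) (auto simp: open_Int)
    finally show ?thesis .
  qed
  have null: "{y. 0 < height y \<and> slope y = x} \<in> null_sets ?M" by (rule kernel_null_set[OF negligible_slope])
  have right: "1 < emeasure ?M (X \<inter> {y. slope y \<in> G \<inter> {x<..}})"
  proof -
    have "emeasure ?M K \<le> emeasure ?M ((K \<inter> {y. slope y < x}) \<union> (K \<inter> {y. x < slope y}) \<union> {y. 0 < height y \<and> slope y = x})"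
      using Kh Km L null by (intro emeasure_mono) (auto simp: null_sets_def)
    also have "\<dots> = emeasure ?M ((K \<inter> {y. slope y < x}) \<union> (K \<inter> {y. x < slope y}))"
      using null Km L by (intro emeasure_Un_null_set) auto
    also have "\<dots> \<le> emeasure ?M (K \<inter> {y. slope y < x}) + emeasure ?M (K \<inter> {y. x < slope y})"
      using Km L by (intro emeasure_subadditive) auto
    also have "\<dots> = ennreal (\<phi> x) + ennreal (measure ?M (K \<inter> {y. x < slope y}))"
      using part[OF L(1)] part[OF L(2)] by (simp add: \<phi>_def emeasure_eq_measure2)
    also have "\<dots> = ennreal (3 / 2 + measure ?M (K \<inter> {y. x < slope y}))"
      unfolding x by (subst ennreal_plus) auto
    finally have "ennreal (measure ?M K) \<le> ennreal (3 / 2 + measure ?M (K \<inter> {y. x < slope y}))"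
      by (simp only: emeasure_eq_measure2[OF Kfin])
    then have "measure ?M K \<le> 3 / 2 + measure ?M (K \<inter> {y. x < slope y})"
      by (subst (asm) ennreal_le_iff) auto
    then have "1 < measure ?M (K \<inter> {y. x < slope y})" using K3 by linarith
    then have "1 < ennreal (measure ?M (K \<inter> {y. x < slope y}))" by simp
    also have "\<dots> = emeasure ?M (K \<inter> {y. x < slope y})"
      using part[OF L(2)] by (simp add: emeasure_eq_measure2)
    also have "\<dots> \<le> emeasure ?M (X \<inter> {y. slope y \<in> G \<inter> {x<..}})"
      using K(2) X(1) strip[of "G \<inter> {x<..}"] G(1) by (intro emeasure_mono) (auto simp: open_Int)
    finally show ?thesis .
  qed
  \<comment> \<open>The two halves and the null ray at slope \<open>x\<close> cover the whole, so at
    least one half has infinite mass.\<close>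
  have "\<infinity> \<le> emeasure ?M (X \<inter> {y. slope y \<in> G \<inter> {..<x}}) + emeasure ?M (X \<inter> {y. slope y \<in> G \<inter> {x<..}})"
  proof -
    have "\<infinity> \<le> emeasure ?M ((X \<inter> {y. slope y \<in> G \<inter> {..<x}}) \<union> (X \<inter> {y. slope y \<in> G \<inter> {x<..}}) \<union> {y. 0 < height y \<and> slope y = x})"
      unfolding G(2)[symmetric] using X strip[of "G \<inter> {..<x}"] strip[of "G \<inter> {x<..}"] G(1) null
      by (intro emeasure_mono) (auto simp: null_sets_def open_Int)
    also have "\<dots> = emeasure ?M ((X \<inter> {y. slope y \<in> G \<inter> {..<x}}) \<union> (X \<inter> {y. slope y \<in> G \<inter> {x<..}}))"
      using X strip[of "G \<inter> {..<x}"] strip[of "G \<inter> {x<..}"] G(1) null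
      by (intro emeasure_Un_null_set sets.Un) (auto simp: open_Int)
    also have "\<dots> \<le> emeasure ?M (X \<inter> {y. slope y \<in> G \<inter> {..<x}}) + emeasure ?M (X \<inter> {y. slope y \<in> G \<inter> {x<..}})"
      using X strip[of "G \<inter> {..<x}"] strip[of "G \<inter> {x<..}"] G(1)
      by (intro emeasure_subadditive) (auto simp: open_Int)
    finally show ?thesis .
  qed
  then have "emeasure ?M (X \<inter> {y. slope y \<in> G \<inter> {..<x}}) = \<infinity> \<or> emeasure ?M (X \<inter> {y. slope y \<in> G \<inter> {x<..}}) = \<infinity>"
    by (simp add: top_unique)
  then show ?thesis
  proof
    assume "emeasure ?M (X \<inter> {y. slope y \<in> G \<inter> {..<x}}) = \<infinity>"
    then show ?thesis using right G(1)
      by (intro exI[of _ "G \<inter> {..<x}"] exI[of _ "G \<inter> {x<..}"] conjI) (auto simp: open_Int)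
  next
    assume "emeasure ?M (X \<inter> {y. slope y \<in> G \<inter> {x<..}}) = \<infinity>"
    then show ?thesis using left G(1)
      by (intro exI[of _ "G \<inter> {x<..}"] exI[of _ "G \<inter> {..<x}"] conjI) (auto simp: open_Int)
  qed
qed

text \<open>Repeated splitting by dependent choice: each strip set aside is disjoint from the
  infinite remainder, hence from all later strips.\<close>

lemma infinite_measure_disjoint_strips:
  assumes "0 < \<sigma>" and X: "X \<in> sets lebesgue" "X \<subseteq> {y. 0 < height y}" "emeasure (kernel_measure \<sigma> z) X = \<infinity>"
  shows "\<exists>H :: nat \<Rightarrow> real set. (\<forall>n. open (H n) \<and> 1 < emeasure (kernel_measure \<sigma> z) (X \<inter> {y. slope y \<in> H n})) \<and> disjoint_family H"
proof -
  let ?M = "kernel_measure \<sigma> z"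
  define inf where "inf G \<longleftrightarrow> open G \<and> emeasure ?M (X \<inter> {y. slope y \<in> G}) = \<infinity>" for G
  define step where "step G G' \<longleftrightarrow> G' \<subseteq> G \<and> (\<exists>H. open H \<and> H \<subseteq> G \<and> G' \<inter> H = {} \<and> 1 < emeasure ?M (X \<inter> {y. slope y \<in> H}))" for G G'
  have "inf UNIV" using X(3) by (simp add: inf_def)
  moreover have "\<exists>G'. inf G' \<and> step G G'" if "inf G" for G
    using split_infinite_measure[OF assms(1) X(1,2), of G] that unfolding inf_def step_def by metis
  ultimately obtain G where G: "\<And>n::nat. inf (G n)" "\<And>n. step (G n) (G (Suc n))"
    using dependent_nat_choice[of "\<lambda>_. inf" "\<lambda>_. step"] by metis
  then have "\<forall>n. \<exists>H. open H \<and> H \<subseteq> G n \<and> G (Suc n) \<inter> H = {} \<and> 1 < emeasure ?M (X \<inter> {y. slope y \<in> H})"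
    by (simp add: step_def)
  then obtain H where H: "\<And>n. open (H n)" "\<And>n. H n \<subseteq> G n" "\<And>n. G (Suc n) \<inter> H n = {}"
    "\<And>n. 1 < emeasure ?M (X \<inter> {y. slope y \<in> H n})"
    by metis
  have anti: "G j \<subseteq> G i" if "i \<le> j" for i j
    using that G(2) lift_Suc_antimono_le[of G] by (simp add: step_def)
  have disj: "H i \<inter> H j = {}" if "i < j" for i j
    using H(2)[of j] H(3)[of i] anti[of "Suc i" j] that by fastforce
  have "disjoint_family H"
    unfolding disjoint_family_on_def using disj by (metis Int_commute linorder_neqE_nat)
  with H show ?thesis by blast
qed

lemma inscribed_family_infinite:
  assumes "0 < \<sigma>" and C: "\<And>p. p \<in> C \<Longrightarrow> \<exists>T g g'. C1_chart_at C p T g g'"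
    and F: "odd_front z u C \<in> sets lebesgue" "emeasure (kernel_measure \<sigma> z) (odd_front z u C) = \<infinity>"
  shows "\<exists>I P Q. inscribed_family C UNIV I P Q \<and>
    emeasure (kernel_measure \<sigma> z) (\<Union>i\<in>I. shadow (P i) (Q i)) = \<infinity>"
proof -
  let ?M = "kernel_measure \<sigma> z" and ?F = "odd_front z u C"
  have "?F \<subseteq> {y. 0 < height y}" by (auto simp: odd_front_def height_def)
  then obtain H :: "nat \<Rightarrow> real set" where H: "\<And>n. open (H n)" "\<And>n. 1 < emeasure ?M (?F \<inter> {y. slope y \<in> H n})" "disjoint_family H"
    using infinite_measure_disjoint_strips[OF assms(1) F(1) _ F(2)] by metis
  have "\<exists>I P Q. inscribed_family C (H n) I P Q \<and> 1 < emeasure ?M (\<Union>i\<in>I. shadow (P i) (Q i))" for n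
  proof -
    have "ennreal 1 < emeasure ?M (?F \<inter> {y. slope y \<in> H n})" using H(2) by simp
    from inscribed_family_approx[OF assms(1) zero_less_one zero_le_one C F(1) H(1) this]
    obtain I P Q r where "inscribed_family C (H n) I P Q" "1 < r" "emeasure ?M (\<Union>i\<in>I. shadow (P i) (Q i)) = ennreal r"
      by blast
    then show ?thesis by (intro exI[of _ I] exI[of _ P] exI[of _ Q]) auto
  qed
  then obtain J P Q where J: "\<And>n. inscribed_family C (H n) (J n) (P n) (Q n)"
    "\<And>n. 1 < emeasure ?M (\<Union>i\<in>J n. shadow (P n i) (Q n i))"
    by metis
  \<comment> \<open>The finite families of all strips, reindexed by the pairing of natural
    numbers.\<close>
  define I where "I = {k. snd (prod_decode k) \<in> J (fst (prod_decode k))}"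
  define P' Q' where "P' k = P (fst (prod_decode k)) (snd (prod_decode k))"
    and "Q' k = Q (fst (prod_decode k)) (snd (prod_decode k))" for k
  have sub: "{slope (P n i)..slope (Q n i)} \<subseteq> H n" "inscribed C (P n i) (Q n i)" "chord (P n i) (Q n i)" if "i \<in> J n" for n i
    using J(1)[of n] that by (auto simp: inscribed_family_def chord_family_def chord_family_axioms_def)
  have fam: "chord_family z u I P' Q'"
  proof
    show "chord (P' k) (Q' k)" if "k \<in> I" for k
      using that sub(3) by (simp add: I_def P'_def Q'_def)
    fix k l assume kl: "k \<in> I" "l \<in> I" "k \<noteq> l"
    obtain n i m j where ni: "prod_decode k = (n, i)" "prod_decode l = (m, j)" by (metis surj_pair)
    have ij: "i \<in> J n" "j \<in> J m" using kl ni by (auto simp: I_def)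
    have "(n, i) \<noteq> (m, j)" using kl(3) ni by (metis prod_decode_inverse)
    then consider "n \<noteq> m" | "n = m" "i \<noteq> j" by blast
    then have "{slope (P n i)..slope (Q n i)} \<inter> {slope (P m j)..slope (Q m j)} = {}"
    proof cases
      case 1
      then have "H n \<inter> H m = {}" using H(3) by (auto simp: disjoint_family_on_def)
      then show ?thesis using sub(1)[OF ij(1)] sub(1)[OF ij(2)] by blast
    next
      case 2
      then show ?thesis using J(1)[of n] ij by (auto simp: inscribed_family_def chord_family_def chord_family_axioms_def)
    qed
    then show "{slope (P' k)..slope (Q' k)} \<inter> {slope (P' l)..slope (Q' l)} = {}" using ni by (simp add: P'_def Q'_def)
  qed
  then have ins: "inscribed_family C UNIV I P' Q'"
    using sub(2) by (auto simp: inscribed_family_def I_def P'_def Q'_def)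
  define S where "S n = (\<Union>i\<in>J n. shadow (P n i) (Q n i))" for n
  have Sm: "S n \<in> sets lebesgue" for n using open_shadow by (auto simp: S_def intro!: borel_open)
  have slopeS: "slope y \<in> H n" if "y \<in> S n" for y n
  proof -
    obtain i where i: "i \<in> J n" "y \<in> shadow (P n i) (Q n i)" using \<open>y \<in> S n\<close> by (auto simp: S_def)
    then show ?thesis using shadow_height(2,3)[OF sub(3)[OF i(1)] i(2)] sub(1)[OF i(1)] by auto
  qed
  have "S n \<inter> S m = {}" if "n \<noteq> m" for n m
    using slopeS H(3) that unfolding disjoint_family_on_def by blast
  then have disj: "disjoint_family S" by (simp add: disjoint_family_on_def)
  have SI: "(\<Union>n. S n) = (\<Union>k\<in>I. shadow (P' k) (Q' k))"
  proof (intro equalityI subsetI)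
    fix y assume "y \<in> (\<Union>n. S n)"
    then obtain n i where "i \<in> J n" "y \<in> shadow (P n i) (Q n i)" by (auto simp: S_def)
    then show "y \<in> (\<Union>k\<in>I. shadow (P' k) (Q' k))"
      by (intro UN_I[of "prod_encode (n, i)"]) (auto simp: I_def P'_def Q'_def)
  next
    fix y assume "y \<in> (\<Union>k\<in>I. shadow (P' k) (Q' k))"
    then show "y \<in> (\<Union>n. S n)" by (auto simp: S_def I_def P'_def Q'_def)
  qed
  have "emeasure ?M (\<Union>n. S n) = (\<Sum>n. emeasure ?M (S n))"
    using Sm disj by (intro suminf_emeasure[symmetric]) auto
  moreover have "(\<Sum>n. emeasure ?M (S n)) = \<infinity>"
  proof (rule ccontr)
    assume ne: "(\<Sum>n. emeasure ?M (S n)) \<noteq> \<infinity>"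
    then obtain r where r: "(\<Sum>n. emeasure ?M (S n)) = ennreal r" "0 \<le> r" by (cases "\<Sum>n. emeasure ?M (S n)") auto
    obtain N :: nat where N: "r < real N" using reals_Archimedean2 by blast
    have "ennreal (real N) = (\<Sum>n<N. 1)" by (simp add: ennreal_of_nat_eq_real_of_nat)
    also have "\<dots> \<le> (\<Sum>n<N. emeasure ?M (S n))" using J(2) by (intro sum_mono) (simp add: S_def less_imp_le)
    also have "\<dots> \<le> (\<Sum>n. emeasure ?M (S n))" by (intro sum_le_suminf) auto
    finally have "ennreal (real N) \<le> ennreal r" using r by simp
    then show False using N r(2) by (simp add: ennreal_le_iff)
  qed
  ultimately show ?thesis using ins SI by metis
qed

text \<open>Each chord is a spline with a single piece, \<open>n = 1\<close>. The subcurves are told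
  apart by their slopes.\<close>

lemma inscribed_family_splines:
  assumes "inscribed_family C G I P Q"
  shows "\<exists>D. (\<forall>i\<in>I. partial_linear_spline C (D i) (closed_segment (P i) (Q i))) \<and> disjoint_family_on D I"
proof -
  interpret chord_family z u I P Q using assms by (simp add: inscribed_family_def)
  have "\<forall>i\<in>I. \<exists>D. partial_linear_spline C D (closed_segment (P i) (Q i)) \<and>
    slope ` D \<subseteq> {slope (P i)..slope (Q i)}"
  proof
    fix i assume "i \<in> I"
    then have "inscribed C (P i) (Q i)" using assms by (simp add: inscribed_family_def)
    then obtain g \<alpha> \<beta> where g: "subcurve_param C g \<alpha> \<beta>"
      "g ` {\<alpha>..\<beta>} \<subseteq> {y. 0 < height y \<and> slope (P i) \<le> slope y \<and> slope y \<le> slope (Q i)}"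
      "closed_segment (g \<alpha>) (g \<beta>) = closed_segment (P i) (Q i)"
      unfolding inscribed_def by (elim exE conjE) (rule that)
    have "linear_spline g \<alpha> \<beta> 1 = closed_segment (P i) (Q i)" using g(3) by (simp add: linear_spline_def)
    then have "partial_linear_spline C (g ` {\<alpha>..\<beta>}) (closed_segment (P i) (Q i))"
      unfolding partial_linear_spline_def using g(1)
      by (intro exI[of _ g] exI[of _ \<alpha>] exI[of _ \<beta>] exI[of _ 1]) simp
    moreover have "slope ` g ` {\<alpha>..\<beta>} \<subseteq> {slope (P i)..slope (Q i)}" using g(2) by auto
    ultimately show "\<exists>D. partial_linear_spline C D (closed_segment (P i) (Q i)) \<and>
      slope ` D \<subseteq> {slope (P i)..slope (Q i)}" by (intro exI conjI)
  qed
  from bchoice[OF this] obtain D where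
    D: "\<forall>i\<in>I. partial_linear_spline C (D i) (closed_segment (P i) (Q i)) \<and> slope ` D i \<subseteq> {slope (P i)..slope (Q i)}"
    by (elim exE) (rule that)
  have "D i \<inter> D j = {}" if ij: "i \<in> I" "j \<in> I" "i \<noteq> j" for i j
  proof (rule ccontr)
    assume "D i \<inter> D j \<noteq> {}"
    then obtain y where y: "y \<in> D i" "y \<in> D j" by blast
    have "slope y \<in> {slope (P i)..slope (Q i)} \<inter> {slope (P j)..slope (Q j)}"
      using D ij(1,2) imageI[OF y(1), of slope] imageI[OF y(2), of slope] by blast
    then show False using slopes_disjoint[OF ij] by (simp only: empty_iff)
  qed
  then have "disjoint_family_on D I" by (simp add: disjoint_family_on_def)
  with D show ?thesis by (intro exI[of _ D] conjI ballI) (simp_all only:)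
qed

text \<open>Only a lower bound on the front parity set is needed: its mass exceeds
  \<open>k - \<eta>\<close>, and the family is trimmed to a total between \<open>k - \<eta>\<close>
  and \<open>k\<close>.\<close>

lemma spline_approximation_pos:
  assumes "0 < \<sigma>" "0 < \<epsilon>" "0 < k" and C: "\<And>p. p \<in> C \<Longrightarrow> \<exists>T g g'. C1_chart_at C p T g g'"
    and k: "(truncated_curvature \<sigma> z C u \<longlongrightarrow> k) (at_right 0)"
  shows "\<exists>(I :: nat set) D S r. (\<forall>i\<in>I. partial_linear_spline C (D i) (S i)) \<and> disjoint_family_on D I \<and>
    has_nonlocal_curvature \<sigma> z (\<Union>i\<in>I. S i) u r \<and> \<bar>k - r\<bar> < \<epsilon>"
proof -
  let ?M = "kernel_measure \<sigma> z"
  \<comment> \<open>Small enough that \<open>k - \<eta>\<close> is still positive and a window of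
    this width lies within \<open>\<epsilon>\<close> of \<open>k\<close>.\<close>
  define \<eta> where "\<eta> = min \<epsilon> k / 3"
  have \<eta>: "0 < \<eta>" "\<eta> < \<epsilon>" "\<eta> < k" using assms(2,3) by (auto simp: \<eta>_def)
  have ev: "\<forall>\<^sub>F \<delta> in at_right 0. k - \<eta> < truncated_curvature \<sigma> z C u \<delta>"
    using k \<eta> by (intro order_tendstoD(1)) auto
  have F: "odd_front z u C \<in> sets lebesgue" "odd_front z (- u) C \<in> sets lebesgue"
  proof -
    \<comment> \<open>A positive limit excludes the default value 0, and with it the nonmeasurable
      case.\<close>
    have "\<not> (\<forall>\<^sub>F \<delta> in at_right 0. truncated_curvature \<sigma> z C u \<delta> = 0)"
    proof
      assume "\<forall>\<^sub>F \<delta> in at_right 0. truncated_curvature \<sigma> z C u \<delta> = 0"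
      then have "(truncated_curvature \<sigma> z C u \<longlongrightarrow> 0) (at_right 0)" by (rule tendsto_eventually)
      then have "k = 0" by (intro tendsto_unique[OF _ k]) auto
      with assms(3) show False by simp
    qed
    then show "odd_front z u C \<in> sets lebesgue" "odd_front z (- u) C \<in> sets lebesgue"
      using odd_front_measurable_or_truncated_zero[OF assms(1), of z u C] by auto
  qed
  have "\<forall>\<^sub>F \<delta> in at_right 0. (0::real) < \<delta>" by (simp add: eventually_at_right_less)
  from eventually_happens[OF eventually_conj[OF ev this]] obtain \<delta> where
    \<delta>: "k - \<eta> < truncated_curvature \<sigma> z C u \<delta>" "0 < \<delta>"
    by auto
  \<comment> \<open>Dropping the subtracted back part only increases the value.\<close>
  have "k - \<eta> < measure ?M (odd_front z u C - ball z \<delta>)"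
    using \<delta> truncated_curvature_eq[OF assms(1) \<delta>(2) F] measure_nonneg[of ?M "odd_front z (- u) C - ball z \<delta>"] by linarith
  then have "ennreal (k - \<eta>) < ennreal (measure ?M (odd_front z u C - ball z \<delta>))"
    using \<eta> by (simp add: ennreal_less_iff)
  also have "\<dots> \<le> emeasure ?M (odd_front z u C - ball z \<delta>)"
    by (simp add: measure_def ennreal_enn2real_if)
  also have "\<dots> \<le> emeasure ?M (odd_front z u C \<inter> {y. slope y \<in> UNIV})"
    using F by (intro emeasure_mono) auto
  finally have "ennreal (k - \<eta>) < emeasure ?M (odd_front z u C \<inter> {y. slope y \<in> UNIV})" .
  from inscribed_family_approx[OF assms(1) \<eta>(1) _ C F(1) open_UNIV this] \<eta>
  obtain I P Q r where I: "inscribed_family C UNIV I P Q" "k - \<eta> < r" "r \<le> k - \<eta> + \<eta>"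
    "emeasure ?M (\<Union>i\<in>I. shadow (P i) (Q i)) = ennreal r"
    by auto
  interpret chord_family z u I P Q using I(1) by (simp add: inscribed_family_def)
  have curv: "has_nonlocal_curvature \<sigma> z (\<Union>i\<in>I. closed_segment (P i) (Q i)) u r"
    using I \<eta> by (intro has_nonlocal_curvature_polygon assms(1)) auto
  have close: "\<bar>k - r\<bar> < \<epsilon>" using I \<eta> by (simp add: abs_less_iff)
  obtain D where "\<forall>i\<in>I. partial_linear_spline C (D i) (closed_segment (P i) (Q i))" "disjoint_family_on D I"
    using inscribed_family_splines[OF I(1)] by blast
  with curv close show ?thesis
    by (intro exI[of _ I] exI[of _ D] exI[of _ "\<lambda>i. closed_segment (P i) (Q i)"] exI[of _ r] conjI)
qed

lemma spline_nonexistence: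
  assumes "0 < \<sigma>" and C: "\<And>p. p \<in> C \<Longrightarrow> \<exists>T g g'. C1_chart_at C p T g g'"
    and F: "odd_front z u C \<in> sets lebesgue" "emeasure (kernel_measure \<sigma> z) (odd_front z u C) = \<infinity>"
  shows "\<exists>(I :: nat set) D S. (\<forall>i\<in>I. partial_linear_spline C (D i) (S i)) \<and> disjoint_family_on D I \<and>
    (\<forall>k. \<not> has_nonlocal_curvature \<sigma> z (\<Union>i\<in>I. S i) u k)"
proof -
  obtain I P Q where I: "inscribed_family C UNIV I P Q"
    "emeasure (kernel_measure \<sigma> z) (\<Union>i\<in>I. shadow (P i) (Q i)) = \<infinity>"
    using inscribed_family_infinite[OF assms(1) C F] by blast
  interpret chord_family z u I P Q using I(1) by (simp add: inscribed_family_def)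
  obtain D where "\<forall>i\<in>I. partial_linear_spline C (D i) (closed_segment (P i) (Q i))" "disjoint_family_on D I"
    using inscribed_family_splines[OF I(1)] by blast
  moreover have "\<forall>k. \<not> has_nonlocal_curvature \<sigma> z (\<Union>i\<in>I. closed_segment (P i) (Q i)) u k"
    using no_nonlocal_curvature_polygon[OF assms(1) I(2)] by blast
  ultimately show ?thesis
    by (intro exI[of _ I] exI[of _ D] exI[of _ "\<lambda>i. closed_segment (P i) (Q i)"] conjI)
qed

end

text \<open>The sign of \<open>k\<close> selects the half plane in which the chords are
  placed.\<close>

lemma spline_approximation_of_curvature:
  assumes "0 < \<sigma>" "0 < \<epsilon>" "norm u = 1" and C: "\<And>p. p \<in> C \<Longrightarrow> \<exists>T g g'. C1_chart_at C p T g g'"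
    and k: "has_nonlocal_curvature \<sigma> z C u k"
  shows "\<exists>(I :: nat set) D S r. (\<forall>i\<in>I. partial_linear_spline C (D i) (S i)) \<and> disjoint_family_on D I \<and>
    has_nonlocal_curvature \<sigma> z (\<Union>i\<in>I. S i) u r \<and> \<bar>k - r\<bar> < \<epsilon>"
proof -
  consider "0 < k" | "k < 0" | "k = 0" by linarith
  then show ?thesis
  proof cases
    case 1
    interpret half_plane z u by unfold_locales (rule assms(3))
    show ?thesis using spline_approximation_pos[OF assms(1,2) 1 C] k by (simp add: has_nonlocal_curvature_iff)
  next
    case 2
    interpret half_plane z "- u" by unfold_locales (simp add: assms(3))
    have "has_nonlocal_curvature \<sigma> z C (- u) (- k)" using k by (simp add: has_nonlocal_curvature_uminus)
    then have "(truncated_curvature \<sigma> z C (- u) \<longlongrightarrow> - k) (at_right 0)" by (simp add: has_nonlocal_curvature_iff)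
    from spline_approximation_pos[OF assms(1,2) _ C this] 2
    obtain I :: "nat set" and D S r where *: "\<forall>i\<in>I. partial_linear_spline C (D i) (S i)" "disjoint_family_on D I"
      "has_nonlocal_curvature \<sigma> z (\<Union>i\<in>I. S i) (- u) r" "\<bar>- k - r\<bar> < \<epsilon>"
      by auto
    have "has_nonlocal_curvature \<sigma> z (\<Union>i\<in>I. S i) u (- r)"
      using *(3) has_nonlocal_curvature_uminus[of \<sigma> z _ u "- r"] by simp
    with * show ?thesis by (intro exI[of _ I] exI[of _ D] exI[of _ S] exI[of _ "- r"]) auto
  next
    case 3
    \<comment> \<open>For \<open>k = 0\<close> the empty family is exact.\<close>
    have "odd_front z w {} = {}" for w by (auto simp: odd_front_def odd_crossings_def)
    then have "(truncated_curvature \<sigma> z {} u \<longlongrightarrow> 0) (at_right 0)"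
      using truncated_curvature_tendsto[OF assms(1), of z u "{}"] by simp
    then have "has_nonlocal_curvature \<sigma> z {} u 0" using assms(3) by (simp add: has_nonlocal_curvature_iff)
    then show ?thesis using 3 assms(2)
      by (intro exI[of _ "{}"] exI[of _ "\<lambda>_. {}"] exI[of _ 0]) (simp add: disjoint_family_on_def)
  qed
qed

text \<open>Without a limit both parity sets must be measurable, and they cannot both have finite
  mass; the chords are placed on a side of infinite mass.\<close>

lemma spline_preserving_nonexistence:
  assumes "0 < \<sigma>" "norm u = 1" and C: "\<And>p. p \<in> C \<Longrightarrow> \<exists>T g g'. C1_chart_at C p T g g'"
    and "\<not> (\<exists>k. (truncated_curvature \<sigma> z C u \<longlongrightarrow> k) (at_right 0))"
  shows "\<exists>(I :: nat set) D S. (\<forall>i\<in>I. partial_linear_spline C (D i) (S i)) \<and> disjoint_family_on D I \<and>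
    (\<forall>k. \<not> has_nonlocal_curvature \<sigma> z (\<Union>i\<in>I. S i) u k)"
proof -
  let ?M = "kernel_measure \<sigma> z"
  have F: "odd_front z u C \<in> sets lebesgue" "odd_front z (- u) C \<in> sets lebesgue"
    using odd_front_measurable_or_truncated_zero[OF assms(1), of z u C] assms(4) tendsto_eventually by blast+
  have "emeasure ?M (odd_front z u C) = \<infinity> \<or> emeasure ?M (odd_front z (- u) C) = \<infinity>"
    using truncated_curvature_tendsto[OF assms(1) F(1) _ F(2)] assms(4) by (auto simp: less_top[symmetric])
  then show ?thesis
  proof
    assume inf: "emeasure ?M (odd_front z u C) = \<infinity>"
    interpret half_plane z u by unfold_locales (rule assms(2))
    show ?thesis using spline_nonexistence[OF assms(1) C F(1) inf] .
  next
    assume inf: "emeasure ?M (odd_front z (- u) C) = \<infinity>"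
    interpret half_plane z "- u" by unfold_locales (simp add: assms(2))
    show ?thesis using spline_nonexistence[OF assms(1) C F(2) inf] has_nonlocal_curvature_uminus by metis
  qed
qed

text \<open>\<open>nonlocal_curvature\<close> is total, so the clause on existence guarantees that a
  genuine curvature is approximated by a genuine curvature and not by a default value.\<close>

theorem theorem1:
  fixes \<sigma> a :: real and C :: "(real^2) set" and z u :: "real^2"
  assumes "0 < \<sigma>" and "\<sigma> < 1" and "\<sigma> < a"
    and "C1_holder_curve a C"
    and "norm u = 1"
    and "z \<in> C \<Longrightarrow> unit_normal C z u"
  shows "(z \<notin> closure C - C \<longrightarrow> nonlocal_curvature_exists \<sigma> z C u) \<and>
    (\<forall>\<epsilon>>0. \<exists>(I :: nat set) D S.
       (\<forall>i\<in>I. partial_linear_spline C (D i) (S i)) \<and>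
       disjoint_family_on D I \<and>
       (nonlocal_curvature_exists \<sigma> z C u \<longrightarrow>
          nonlocal_curvature_exists \<sigma> z (\<Union>i\<in>I. S i) u) \<and>
       \<bar>nonlocal_curvature \<sigma> z C u - nonlocal_curvature \<sigma> z (\<Union>i\<in>I. S i) u\<bar> < \<epsilon>)"
proof (intro conjI impI allI)
  have has: "has_nonlocal_curvature \<sigma> z C u k \<longleftrightarrow> (truncated_curvature \<sigma> z C u \<longlongrightarrow> k) (at_right 0)" for k
    using assms(5,6) by (auto simp: has_nonlocal_curvature_iff)
  assume "z \<notin> closure C - C"
  then show "nonlocal_curvature_exists \<sigma> z C u"
    using truncated_curvature_converges[OF assms(1,3,5,4,6)] by (simp add: nonlocal_curvature_exists_def has)
next
  fix \<epsilon> :: real assume \<epsilon>: "0 < \<epsilon>"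
  have C: "\<exists>T g g'. C1_chart_at C p T g g'" if "p \<in> C" for p
    using assms(4) that unfolding C1_holder_curve_def by blast
  show "\<exists>(I :: nat set) D S.
       (\<forall>i\<in>I. partial_linear_spline C (D i) (S i)) \<and>
       disjoint_family_on D I \<and>
       (nonlocal_curvature_exists \<sigma> z C u \<longrightarrow>
          nonlocal_curvature_exists \<sigma> z (\<Union>i\<in>I. S i) u) \<and>
       \<bar>nonlocal_curvature \<sigma> z C u - nonlocal_curvature \<sigma> z (\<Union>i\<in>I. S i) u\<bar> < \<epsilon>"
  proof (cases "nonlocal_curvature_exists \<sigma> z C u")
    case True
    then obtain k where k: "has_nonlocal_curvature \<sigma> z C u k" by (auto simp: nonlocal_curvature_exists_def)
    obtain I :: "nat set" and D S r where *: "\<forall>i\<in>I. partial_linear_spline C (D i) (S i)" "disjoint_family_on D I"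
      "has_nonlocal_curvature \<sigma> z (\<Union>i\<in>I. S i) u r" "\<bar>k - r\<bar> < \<epsilon>"
      using spline_approximation_of_curvature[OF assms(1) \<epsilon> assms(5) C k] by blast
    have "nonlocal_curvature_exists \<sigma> z (\<Union>i\<in>I. S i) u" using *(3) unfolding nonlocal_curvature_exists_def by blast
    with * nonlocal_curvature_eqI[OF k] nonlocal_curvature_eqI[OF *(3)] show ?thesis
      by (intro exI[of _ I] exI[of _ D] exI[of _ S]) auto
  next
    case False
    then have n: "\<not> has_nonlocal_curvature \<sigma> z C u k" for k by (simp add: nonlocal_curvature_exists_def)
    then have "\<not> (\<exists>k. (truncated_curvature \<sigma> z C u \<longlongrightarrow> k) (at_right 0))"
      using assms(5,6) by (auto simp: has_nonlocal_curvature_iff)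
    then have "\<exists>(I :: nat set) D S. (\<forall>i\<in>I. partial_linear_spline C (D i) (S i)) \<and> disjoint_family_on D I \<and>
      (\<forall>k. \<not> has_nonlocal_curvature \<sigma> z (\<Union>i\<in>I. S i) u k)"
      by (intro spline_preserving_nonexistence assms(1,5) C)
    then obtain I :: "nat set" and D S where *: "\<forall>i\<in>I. partial_linear_spline C (D i) (S i)" "disjoint_family_on D I"
      "\<forall>k. \<not> has_nonlocal_curvature \<sigma> z (\<Union>i\<in>I. S i) u k"
      by (elim exE conjE) (rule that)
    \<comment> \<open>Both predicates are false everywhere, hence equal as functions, so the
      definite descriptions denote the same unspecified number.\<close>
    have "has_nonlocal_curvature \<sigma> z C u = has_nonlocal_curvature \<sigma> z (\<Union>i\<in>I. S i) u"
      by (rule ext) (simp only: n *(3))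
    then have "nonlocal_curvature \<sigma> z C u = nonlocal_curvature \<sigma> z (\<Union>i\<in>I. S i) u"
      by (simp only: nonlocal_curvature_def)
    with * False \<epsilon> show ?thesis by (intro exI[of _ I] exI[of _ D] exI[of _ S]) auto
  qed
qed

end
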